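(* Let $N,n\ge1$ be integers, $1\le p\le\infty$, $1\le q<\infty$, and let $\phi>0$ be a continuous increasing function on $(0,1]$. If the function $x\mapsto\phi(x)/x^\alpha$ increases on $(0,1]$ for some $\alpha>0$, then $$\Lambda^{p,q}_{n,\phi}(\mathbb B_N)\subset\mathrm{Lip}^{p,q}_{n,\phi}(\mathbb B_N).$$
   Context: $\mathbb B_N$ is the unit ball of $\mathbb C^N$, $\mathbb S_N=\partial\mathbb B_N$, $\sigma$ is the normalized Lebesgue measure on $\mathbb S_N$, and $H(\mathbb B_N)$ is the space of holomorphic functions on $\mathbb B_N$. For $0<r<1$, $M_p(r,g)=\left(\int_{\mathbb S_N}|g(r\zeta)|^p\,d\sigma(\zeta)\right)^{1/p}$ for $p<\infty$ and $M_\infty(r,g)=\operatorname{ess\,sup}_{\zeta\in\mathbb S_N}|g(r\zeta)|$. $H^p(\mathbb B_N)$ is the space of $f\in H(\mathbb B_N)$ with $\|f\|_p:=\sup_{0<r<1}M_p(r,f)<\infty$. If $f=\sum_{k\ge0}f_k$ is the homogeneous expansion of $f$, then $\mathcal R^nf=\sum_{k\ge1}k^nf_k$. For $t\in\mathbb R$, $\Delta^1_tf(z)=f(e^{it}z)-f(z)$ and $\Delta^n_tf=\Delta^1_t(\Delta^{n-1}_tf)$ for $n\ge2$. $\Lambda^{p,q}_{n,\phi}(\mathbb B_N)$ is the set of $f\in H(\mathbb B_N)$ with $\int_0^1\Big(M_p(r,\mathcal R^nf)\frac{(1-r)^n}{\phi(1-r)}\Big)^q\frac{dr}{1-r}<\infty$.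 $\mathrm{Lip}^{p,q}_{n,\phi}(\mathbb B_N)$ is the set of $f\in H^p(\mathbb B_N)$ with $\int_0^1\Big(\frac{\|\Delta^n_tf\|_p}{\phi(t)}\Big)^q\frac{dt}{t}<\infty$. *)

theory Defs
  imports "HOL-Probability.Probability"
begin

text \<open>
  The space of \<open>N\<close> complex variables is \<^typ>\<open>complex ^ 'N\<close> with its Hermitian norm, so
  \<^term>\<open>ball 0 1\<close> and \<^term>\<open>sphere 0 1\<close> are the unit ball and the unit sphere.
  Functions on the ball are total functions whose values off the ball are never used.
\<close>

definition holomorphic_cn :: "(complex ^ 'N \<Rightarrow> complex) \<Rightarrow> (complex ^ 'N) set \<Rightarrow> bool" where
  "holomorphic_cn f S \<longleftrightarrow>
     (\<forall>z\<in>S. \<exists>D. (f has_derivative D) (at z) \<and> (\<forall>c v. D (c *s v) = c * D v))"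

definition hol_ball :: "(complex ^ 'N \<Rightarrow> complex) set" where
  "hol_ball = {f. holomorphic_cn f (ball 0 1)}"

text \<open>
  Normalized Lebesgue measure on the sphere, as the image of the normalized volume of the ball
  under radial projection: the measure of \<open>A\<close> is the proportion of the ball occupied by the
  cone over \<open>A\<close>. The underlying space of the measure is the sphere. The origin, which is not
  projected into the sphere, is a null set, so the total mass is 1.
\<close>

definition sphere_measure :: "(complex ^ 'N) measure" where
  "sphere_measure =
     restrict_space (distr (uniform_measure lborel (ball 0 1)) borel (\<lambda>x. x /\<^sub>R norm x)) (sphere 0 1)"

text \<open>Real power on \<open>[0, \<infinity>]\<close>, only used for exponents \<open>a > 0\<close>.\<close>

definition ennpow :: "ennreal \<Rightarrow> real \<Rightarrow> ennreal" where
  "ennpow x a = (if x = \<infinity> then \<infinity> else ennreal (enn2real x powr a))"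

definition int_mean :: "ennreal \<Rightarrow> real \<Rightarrow> (complex ^ 'N \<Rightarrow> complex) \<Rightarrow> ennreal" where
  "int_mean p r g =
     (if p = \<infinity> then esssup sphere_measure (\<lambda>\<zeta>. ennreal (norm (g (r *\<^sub>R \<zeta>))))
      else ennpow (\<integral>\<^sup>+ \<zeta>. ennreal (norm (g (r *\<^sub>R \<zeta>)) powr enn2real p) \<partial>sphere_measure)
             (1 / enn2real p))"

definition hardy_norm :: "ennreal \<Rightarrow> (complex ^ 'N \<Rightarrow> complex) \<Rightarrow> ennreal" where
  "hardy_norm p f = (SUP r\<in>{0<..<1}. int_mean p r f)"

definition hardy_space :: "ennreal \<Rightarrow> (complex ^ 'N \<Rightarrow> complex) set" where
  "hardy_space p = {f \<in> hol_ball. hardy_norm p f < \<infinity>}"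

definition homogeneous_poly :: "nat \<Rightarrow> (complex ^ 'N \<Rightarrow> complex) \<Rightarrow> bool" where
  "homogeneous_poly k P \<longleftrightarrow>
     (\<exists>c :: ('N \<Rightarrow> nat) \<Rightarrow> complex.
        P = (\<lambda>z. \<Sum>\<alpha> | (\<Sum>i\<in>UNIV. \<alpha> i) = k. c \<alpha> * (\<Prod>i\<in>UNIV. (z $ i) ^ \<alpha> i)))"

text \<open>
  For \<open>f\<close> holomorphic on the unit ball there is exactly one sequence of homogeneous polynomials
  as below.
\<close>

definition homogeneous_expansion ::
    "(complex ^ 'N \<Rightarrow> complex) \<Rightarrow> nat \<Rightarrow> complex ^ 'N \<Rightarrow> complex" where
  "homogeneous_expansion f =
     (THE F. (\<forall>k. homogeneous_poly k (F k)) \<and> (\<forall>z\<in>ball 0 1. (\<lambda>k. F k z) sums f z))"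

text \<open>The summation index is shifted: the sum runs over the degrees \<open>k \<ge> 1\<close>.\<close>

definition radial_deriv ::
    "nat \<Rightarrow> (complex ^ 'N \<Rightarrow> complex) \<Rightarrow> complex ^ 'N \<Rightarrow> complex" where
  "radial_deriv n f z = (\<Sum>k. of_nat (Suc k) ^ n * homogeneous_expansion f (Suc k) z)"

definition rot_diff :: "real \<Rightarrow> (complex ^ 'N \<Rightarrow> complex) \<Rightarrow> complex ^ 'N \<Rightarrow> complex" where
  "rot_diff t f = (\<lambda>z. f (exp (\<i> * complex_of_real t) *s z) - f z)"

definition rot_diff_iter ::
    "nat \<Rightarrow> real \<Rightarrow> (complex ^ 'N \<Rightarrow> complex) \<Rightarrow> complex ^ 'N \<Rightarrow> complex" where
  "rot_diff_iter n t = rot_diff t ^^ n"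

definition Lambda_space ::
    "ennreal \<Rightarrow> real \<Rightarrow> nat \<Rightarrow> (real \<Rightarrow> real) \<Rightarrow> (complex ^ 'N \<Rightarrow> complex) set" where
  "Lambda_space p q n \<phi> =
     {f \<in> hol_ball.
        (\<integral>\<^sup>+ r\<in>{0<..<1}.
           (ennpow (int_mean p r (radial_deriv n f) * ennreal ((1 - r) ^ n / \<phi> (1 - r))) q
            * ennreal (1 / (1 - r))) \<partial>lborel) < \<infinity>}"

definition Lip_space ::
    "ennreal \<Rightarrow> real \<Rightarrow> nat \<Rightarrow> (real \<Rightarrow> real) \<Rightarrow> (complex ^ 'N \<Rightarrow> complex) set" where
  "Lip_space p q n \<phi> =
     {f \<in> hardy_space p.
        (\<integral>\<^sup>+ t\<in>{0<..<1}.
           (ennpow (hardy_norm p (rot_diff_iter n t f) * ennreal (1 / \<phi> t)) q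
            * ennreal (1 / t)) \<partial>lborel) < \<infinity>}"

end

theory Submission
  imports Defs "HOL-Complex_Analysis.Complex_Analysis"
begin

text \<open>
  Let \<open>R\<close> be the Euler derivative, \<open>R f z\<close> being the derivative of \<open>c \<mapsto> f (c z)\<close> at \<open>c = 1\<close>; it
  multiplies the homogeneous part of degree \<open>k\<close> by \<open>k\<close>, so that its powers are the radial
  derivatives. In the variable \<open>w\<close> with \<open>c = exp w\<close>, the operator \<open>R\<close> is \<open>d/dw\<close>, a dilation is a
  real translation and a rotation by \<open>exp (i t)\<close> is an imaginary translation. Write \<open>M s g\<close> for the
  mean of order \<open>p\<close> of \<open>g\<close> on the sphere of radius \<open>exp (- s)\<close>. It decreases in \<open>s\<close>, by Poisson's
  formula on the discs \<open>c \<mapsto> c z\<close>, and this monotonicity is used throughout.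

  To compare \<open>f\<close> at \<open>exp (i t) z\<close> and at \<open>z\<close>, go inwards along a ray by the factor \<open>exp (- t)\<close>, turn
  by the angle \<open>t\<close>, and come back outwards. Integrating \<open>R f\<close> along this path, Minkowski's inequality
  and the rotation invariance of the measure bound the first difference on the sphere of radius
  \<open>exp (- a)\<close> by \<open>3 \<integral>\<^sub>0\<^sup>t M (a + s) (R f) ds\<close>; the arc costs no more than a ray because of
  monotonicity. Since \<open>R\<close> commutes with differences, the estimate can be iterated, and monotonicity
  collapses the resulting multiple integral to a single one
  (\<open>nn_integral_antimono_convolution_le\<close>). The outcome, \<open>log_mean_rot_diff_iter_le\<close>, is that the
  difference of order \<open>n\<close> with step \<open>t\<close> has norm at most \<open>C \<integral>\<^sub>0\<^sup>t s\<^sup>n\<^sup>-\<^sup>1 M s (R\<^sup>n f) ds\<close>. The same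
  argument along rays alone bounds the norm of \<open>f\<close> by a constant plus a multiple of the integral for
  \<open>t = 1\<close> (\<open>log_mean_le_iterated\<close>).

  The rest is a Hardy inequality. As \<open>s \<ge> - ln (1 - s / 2)\<close> for \<open>s\<close> in \<open>[0, 1]\<close>, the mean at radius \<open>exp (- s)\<close> may be
  replaced by the mean at radius \<open>1 - s / 2\<close>. Let \<open>b s\<close> be the mean of \<open>R\<^sup>n f\<close> at radius \<open>1 - s\<close>, times
  \<open>s\<^sup>n / \<phi> s\<close>; the hypothesis on \<open>f\<close> says that \<open>b\<^sup>q\<close> is integrable for \<open>ds / s\<close>. Growth of
  \<open>\<phi> x / x\<^sup>\<alpha>\<close> means \<open>\<phi> s \<le> \<phi> t (s / t)\<^sup>\<alpha>\<close> for \<open>s \<le> t\<close>, so the norm of the difference divided by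
  \<open>\<phi> t\<close> is at most a multiple of the average \<open>\<integral>\<^sub>0\<^sup>t (s / t)\<^sup>\<alpha> b s ds / s\<close>, and Jensen's inequality with
  Fubini's theorem (\<open>hardy_inequality\<close>) bounds the integral of the \<open>q\<close>-th power of these averages.

  Two facts lie outside this argument. The radial derivative is defined through the
  homogeneous expansion, which is described only as the unique one; its terms are the Taylor
  coefficients of \<open>c \<mapsto> f (c z)\<close>, and these are homogeneous polynomials in \<open>z\<close> because they are
  entire of polynomial growth on every complex line. The rotation invariance of the measure on the
  sphere is inherited from Lebesgue measure, where it follows from the uniqueness of
  translation-invariant measures.
\<close>


section \<open>Rotation invariance of the measure on the sphere\<close>

lemma nn_integral_lborel_translate:
  fixes f :: "'a::euclidean_space \<Rightarrow> ennreal"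
  assumes [measurable]: "f \<in> borel_measurable borel"
  shows "(\<integral>\<^sup>+x. f (c + x) \<partial>lborel) = (\<integral>\<^sup>+x. f x \<partial>lborel)"
proof -
  have "(\<integral>\<^sup>+x. f x \<partial>lborel) = (\<integral>\<^sup>+x. f x \<partial>distr lborel borel ((+) c))"
    by (simp add: lborel_distr_plus)
  also have "\<dots> = (\<integral>\<^sup>+x. f (c + x) \<partial>lborel)"
    by (simp add: nn_integral_distr)
  finally show ?thesis by simp
qed

lemma nn_integral_lborel_uminus:
  fixes f :: "'a::euclidean_space \<Rightarrow> ennreal"
  assumes [measurable]: "f \<in> borel_measurable borel"
  shows "(\<integral>\<^sup>+x. f (- x) \<partial>lborel) = (\<integral>\<^sup>+x. f x \<partial>lborel)"
proof -
  have "lborel = density (distr lborel borel (\<lambda>x::'a. 0 + (-1) *\<^sub>R x)) (\<lambda>_. ennreal (\<bar>-1::real\<bar>^DIM('a)))"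
    by (rule lborel_affine) simp
  then have *: "lborel = distr lborel borel (\<lambda>x::'a. - x)"
    by (simp add: density_1)
  have "(\<integral>\<^sup>+x. f x \<partial>lborel) = (\<integral>\<^sup>+x. f x \<partial>distr lborel borel (\<lambda>x::'a. - x))"
    using * by simp
  also have "\<dots> = (\<integral>\<^sup>+x. f (- x) \<partial>lborel)"
    by (simp add: nn_integral_distr)
  finally show ?thesis by simp
qed

text \<open>
  The map pushes Lebesgue measure forward to a translation-invariant measure, so this is the
  uniqueness of such measures. Writing \<open>\<mu>\<close> and \<open>\<nu>\<close> for the two measures and \<open>B\<close> for the unit ball,
  Fubini's theorem gives \<open>\<mu> A * \<nu> B = \<mu> B * \<nu> (- A)\<close>; an isometry fixes \<open>B\<close>, so \<open>\<nu> B = \<mu> B\<close> cancels,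
  and the reflection is removed in the end by linearity.
\<close>

lemma nn_integral_lborel_linear_isometry:
  fixes T :: "'a::euclidean_space \<Rightarrow> 'a"
  assumes T: "linear T" and iso: "\<And>x. norm (T x) = norm x"
    and [measurable]: "f \<in> borel_measurable borel"
  shows "(\<integral>\<^sup>+x. f (T x) \<partial>lborel) = (\<integral>\<^sup>+x. f x \<partial>lborel)"
proof -
  interpret T: linear T by (fact T)
  have Tm [measurable]: "T \<in> borel_measurable borel"
    using T by (simp add: borel_measurable_continuous_onI linear_continuous_on linear_conv_bounded_linear)
  have "surj T"
    using T iso by (metis linear_injective_0 linear_injective_imp_surjective norm_eq_zero)
  then have surjD: "\<exists>x. T x = y" for y by (metis surjD)
  have inv: "(\<integral>\<^sup>+x. g (y + T x) \<partial>lborel) = (\<integral>\<^sup>+x. g (T x) \<partial>lborel)"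
    if [measurable]: "g \<in> borel_measurable borel" for g :: "'a \<Rightarrow> ennreal" and y
  proof -
    obtain c where "T c = y" using surjD by blast
    then show ?thesis
      using nn_integral_lborel_translate[of "\<lambda>x. g (T x)" c] by (simp add: T.add)
  qed
  let ?B = "indicator (ball 0 1) :: 'a \<Rightarrow> ennreal"
  have [measurable]: "?B \<in> borel_measurable borel"
    by (intro borel_measurable_indicator borel_open open_ball)
  let ?f = "\<lambda>x. f (- x)"
  \<comment> \<open>Both substitutions are translations: by \<open>- x\<close> for the image measure, by \<open>T y\<close> for Lebesgue measure.\<close>
  have "(\<integral>\<^sup>+y. ?f (T y) \<partial>lborel) * (\<integral>\<^sup>+x. ?B x \<partial>lborel)
      = (\<integral>\<^sup>+x. (\<integral>\<^sup>+y. ?B x * ?f (- x + T y) \<partial>lborel) \<partial>lborel)"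
  proof -
    have "(\<integral>\<^sup>+y. ?B x * ?f (- x + T y) \<partial>lborel) = (\<integral>\<^sup>+y. ?f (T y) \<partial>lborel) * ?B x" for x
      using inv[of ?f "- x"] by (subst nn_integral_cmult) (simp_all add: mult.commute)
    then show ?thesis by (simp only:) (rule nn_integral_cmult[symmetric], simp)
  qed
  also have "\<dots> = (\<integral>\<^sup>+y. (\<integral>\<^sup>+x. ?B x * ?f (- x + T y) \<partial>lborel) \<partial>lborel)"
    by (rule lborel_pair.Fubini') measurable
  also have "\<dots> = (\<integral>\<^sup>+y. (\<integral>\<^sup>+x. ?B (T y + x) * f x \<partial>lborel) \<partial>lborel)"
  proof (rule nn_integral_cong)
    fix y :: 'a
    show "(\<integral>\<^sup>+x. ?B x * ?f (- x + T y) \<partial>lborel) = (\<integral>\<^sup>+x. ?B (T y + x) * f x \<partial>lborel)"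
      using nn_integral_lborel_translate[of "\<lambda>x. ?B x * ?f (- x + T y)" "T y"] by simp
  qed
  also have "\<dots> = (\<integral>\<^sup>+x. (\<integral>\<^sup>+y. ?B (T y + x) * f x \<partial>lborel) \<partial>lborel)"
    by (rule lborel_pair.Fubini'[symmetric]) measurable
  also have "\<dots> = (\<integral>\<^sup>+x. f x * (\<integral>\<^sup>+y. ?B (T y) \<partial>lborel) \<partial>lborel)"
  proof (rule nn_integral_cong)
    fix x
    have "(\<integral>\<^sup>+y. ?B (T y + x) * f x \<partial>lborel) = (\<integral>\<^sup>+y. ?B (x + T y) \<partial>lborel) * f x"
      by (simp add: nn_integral_multc add.commute)
    then show "(\<integral>\<^sup>+y. ?B (T y + x) * f x \<partial>lborel) = f x * (\<integral>\<^sup>+y. ?B (T y) \<partial>lborel)"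
      by (simp only: inv[OF \<open>?B \<in> borel_measurable borel\<close>] mult.commute)
  qed
  also have "(\<lambda>y. ?B (T y)) = ?B" by (auto simp: fun_eq_iff indicator_def iso)
  also have "(\<integral>\<^sup>+x. f x * (\<integral>\<^sup>+y. ?B y \<partial>lborel) \<partial>lborel) = (\<integral>\<^sup>+x. f x \<partial>lborel) * (\<integral>\<^sup>+y. ?B y \<partial>lborel)"
    by (simp add: nn_integral_multc)
  finally have "(\<integral>\<^sup>+y. f (- T y) \<partial>lborel) * emeasure lborel (ball 0 (1::real) :: 'a set)
      = (\<integral>\<^sup>+x. f x \<partial>lborel) * emeasure lborel (ball 0 (1::real) :: 'a set)" by simp
  moreover have "emeasure lborel (ball 0 (1::real) :: 'a set) \<noteq> 0"
    using unit_ball_vol_pos[of "real DIM('a)"] by (simp add: emeasure_ball del: unit_ball_vol_pos)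
  moreover have "emeasure lborel (ball 0 (1::real) :: 'a set) \<noteq> \<infinity>"
    using emeasure_lborel_ball_finite[of "0::'a" 1] by simp
  ultimately have "(\<integral>\<^sup>+y. f (- T y) \<partial>lborel) = (\<integral>\<^sup>+x. f x \<partial>lborel)"
    by (simp add: mult.commute[of _ "emeasure _ _"] ennreal_mult_cancel_left)
  moreover have "(\<integral>\<^sup>+y. f (- T y) \<partial>lborel) = (\<integral>\<^sup>+y. f (T y) \<partial>lborel)"
    using nn_integral_lborel_uminus[of "\<lambda>y. f (T y)"] by (simp add: T.neg)
  ultimately show ?thesis by simp
qed

lemma norm_vector_scalar_mult_complex:
  "norm (c *s (z :: complex ^ 'N)) = norm c * norm z"
  unfolding norm_vec_def L2_set_def
  by (simp add: norm_mult power_mult_distrib flip: sum_distrib_left) (simp add: real_sqrt_mult)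

lemma continuous_on_vector_scalar_mult [continuous_intros]:
  fixes g :: "'b::topological_space \<Rightarrow> complex ^ 'N"
  assumes "continuous_on A f" "continuous_on A g"
  shows "continuous_on A (\<lambda>x. f x *s g x)"
  unfolding vector_scalar_mult_def
  by (intro continuous_on_vec_lambda continuous_intros assms)

lemma measurable_vector_scalar_mult [measurable]:
  fixes g :: "'b \<Rightarrow> complex ^ 'N"
  assumes [measurable]: "f \<in> borel_measurable M" "g \<in> borel_measurable M"
  shows "(\<lambda>x. f x *s g x) \<in> borel_measurable M"
proof -
  have "(\<lambda>p. fst p *s snd p :: complex ^ 'N) \<in> measurable (borel :: (complex \<times> (complex ^ 'N)) measure) borel"
    by (intro borel_measurable_continuous_onI continuous_intros)
  then have "(\<lambda>p. fst p *s snd p :: complex ^ 'N) \<in> borel_measurable (borel \<Otimes>\<^sub>M borel)"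
    by (simp add: borel_prod)
  from measurable_compose[OF _ this, of "\<lambda>x. (f x, g x)" M] show ?thesis by simp
qed

lemma scaleR_eq_vector_scalar_mult: "r *\<^sub>R (z :: complex ^ 'N) = complex_of_real r *s z"
  unfolding vec_eq_iff vector_scaleR_component vector_smult_component
  by (simp add: scaleR_conv_of_real)

lemma space_sphere_measure [simp]: "space (sphere_measure :: (complex ^ 'N) measure) = sphere 0 1"
  by (simp add: sphere_measure_def space_restrict_space)

lemma sets_sphere_measure [measurable_cong]:
  "sets (sphere_measure :: (complex ^ 'N) measure) = sets (restrict_space borel (sphere 0 1))"
  unfolding sphere_measure_def by (intro sets_restrict_space_cong) simp

lemma borel_measurable_on_sphere:
  "f \<in> measurable borel M \<Longrightarrow> f \<in> measurable (sphere_measure :: (complex ^ 'N) measure) M"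
  by (simp add: measurable_cong_sets[OF sets_sphere_measure refl] measurable_restrict_space1)

lemma finite_measure_sphere_measure: "finite_measure (sphere_measure :: (complex ^ 'N) measure)"
proof
  let ?B = "ball 0 1 :: (complex ^ 'N) set"
  have "prob_space (uniform_measure lborel ?B)"
    using emeasure_lborel_ball_finite[of "0 :: complex ^ 'N" 1]
    by (intro prob_space_uniform_measure) (auto simp: emeasure_ball order.strict_implies_not_eq[OF unit_ball_vol_pos, symmetric])
  then interpret prob_space "distr (uniform_measure lborel ?B) borel (\<lambda>x. x /\<^sub>R norm x)"
    by (rule prob_space.prob_space_distr) simp
  show "emeasure sphere_measure (space sphere_measure :: (complex ^ 'N) set) \<noteq> \<infinity>"
    unfolding sphere_measure_def
    by (subst emeasure_restrict_space) (auto simp: space_restrict_space)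
qed

lemma sigma_finite_sphere_measure: "sigma_finite_measure (sphere_measure :: (complex ^ 'N) measure)"
  using finite_measure_sphere_measure by (rule finite_measure.axioms)

lemma sets_borel_ball_sphere [measurable]:
  fixes a :: "'a::euclidean_space"
  shows "ball a r \<in> sets borel" "sphere a r \<in> sets borel"
proof -
  show "ball a r \<in> sets borel" by (intro borel_open open_ball)
  show "sphere a r \<in> sets borel" by (intro borel_closed closed_sphere)
qed

lemma nn_integral_sphere_measure:
  fixes f :: "complex ^ 'N \<Rightarrow> ennreal"
  assumes [measurable]: "f \<in> borel_measurable borel"
  shows "(\<integral>\<^sup>+\<zeta>. f \<zeta> \<partial>sphere_measure)
    = (\<integral>\<^sup>+x. f (x /\<^sub>R norm x) * indicator (sphere 0 1) (x /\<^sub>R norm x) * indicator (ball 0 1) x \<partial>lborel)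
      / emeasure lborel (ball 0 1 :: (complex ^ 'N) set)"
proof -
  let ?P = "\<lambda>x::complex ^ 'N. x /\<^sub>R norm x"
  have [measurable]: "?P \<in> borel_measurable borel" by simp
  have "(\<integral>\<^sup>+\<zeta>. f \<zeta> \<partial>sphere_measure) = (\<integral>\<^sup>+y. f y * indicator (sphere 0 1) y
      \<partial>distr (uniform_measure lborel (ball 0 1)) borel ?P)"
    unfolding sphere_measure_def by (subst nn_integral_restrict_space) simp_all
  also have "\<dots> = (\<integral>\<^sup>+x. f (?P x) * indicator (sphere 0 1) (?P x) \<partial>uniform_measure lborel (ball 0 1))"
    by (rule nn_integral_distr) measurable
  finally show ?thesis
    by (simp add: nn_integral_uniform_measure del: mem_sphere_0)
qed

text \<open>
  Multiplication by a unimodular scalar is a linear isometry that commutes with the radial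
  projection and maps the ball to itself.
\<close>

lemma nn_integral_sphere_measure_rotate:
  fixes f :: "complex ^ 'N \<Rightarrow> ennreal"
  assumes [measurable]: "f \<in> borel_measurable borel" and c: "norm c = 1"
  shows "(\<integral>\<^sup>+\<zeta>. f (c *s \<zeta>) \<partial>sphere_measure) = (\<integral>\<^sup>+\<zeta>. f \<zeta> \<partial>sphere_measure)"
proof -
  let ?h = "\<lambda>x. f (x /\<^sub>R norm x) * indicator (sphere 0 1) (x /\<^sub>R norm x) * indicator (ball 0 1) x"
  have hm: "?h \<in> borel_measurable borel"
    by measurable
  have iso: "norm (c *s z) = norm z" for z :: "complex ^ 'N"
    using c by (simp add: norm_vector_scalar_mult_complex)
  have "linear ((*s) c :: complex ^ 'N \<Rightarrow> _)"
    by (rule linearI) (simp_all add: vec_eq_iff algebra_simps)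
  from nn_integral_lborel_linear_isometry[OF this iso hm]
  have "(\<integral>\<^sup>+x. ?h (c *s x) \<partial>lborel) = (\<integral>\<^sup>+x. ?h x \<partial>lborel)" .
  moreover have "?h (c *s x) = f (c *s (x /\<^sub>R norm x)) * indicator (sphere 0 1) (x /\<^sub>R norm x) * indicator (ball 0 1) x"
    for x :: "complex ^ 'N"
  proof -
    have "c *s x /\<^sub>R norm (c *s x) = c *s (x /\<^sub>R norm x)"
      unfolding iso by (simp add: vec_eq_iff)
    moreover have "indicator (sphere 0 1) (c *s (x /\<^sub>R norm x)) = (indicator (sphere 0 1) (x /\<^sub>R norm x) :: ennreal)"
      by (simp only: indicator_def mem_sphere_0 iso)
    moreover have "indicator (ball 0 1) (c *s x) = (indicator (ball 0 1) x :: ennreal)"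
      by (simp only: indicator_def mem_ball_0 iso)
    ultimately show ?thesis by (simp only:)
  qed
  ultimately show ?thesis
    by (simp add: nn_integral_sphere_measure del: mem_sphere_0 mem_ball_0)
qed

lemma distr_sphere_measure_rotate:
  assumes c: "norm c = 1"
  shows "distr sphere_measure sphere_measure ((*s) c :: complex ^ 'N \<Rightarrow> _) = sphere_measure"
proof (rule measure_eqI)
  have m [measurable]: "((*s) c :: complex ^ 'N \<Rightarrow> _) \<in> measurable sphere_measure sphere_measure"
    unfolding measurable_cong_sets[OF sets_sphere_measure sets_sphere_measure]
    by (rule measurable_restrict_space3) (auto simp: c norm_vector_scalar_mult_complex)
  fix A :: "(complex ^ 'N) set"
  assume "A \<in> sets (distr sphere_measure sphere_measure ((*s) c))"
  then have A: "A \<in> sets sphere_measure" by simp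
  then have [measurable]: "A \<in> sets borel"
    by (auto simp: sets_sphere_measure sets_restrict_space)
  have "emeasure (distr sphere_measure sphere_measure ((*s) c)) A
      = (\<integral>\<^sup>+\<zeta>. indicator A \<zeta> \<partial>distr sphere_measure sphere_measure ((*s) c))"
    using A by simp
  also have "\<dots> = (\<integral>\<^sup>+\<zeta>. indicator A (c *s \<zeta>) \<partial>sphere_measure)"
    using A by (intro nn_integral_distr) auto
  also have "\<dots> = (\<integral>\<^sup>+\<zeta>. indicator A \<zeta> \<partial>sphere_measure)"
    by (rule nn_integral_sphere_measure_rotate[OF _ c]) simp
  finally show "emeasure (distr sphere_measure sphere_measure ((*s) c)) A = emeasure sphere_measure A"
    using A by simp
qed simp

section \<open>Jensen's and Minkowski's inequalities for integrals\<close>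

lemma ennpow_top [simp]: "ennpow \<top> a = \<top>"
  by (simp add: ennpow_def)

lemma ennpow_0 [simp]: "ennpow 0 a = 0"
  by (simp add: ennpow_def)

lemma ennpow_ennreal: "0 \<le> x \<Longrightarrow> ennpow (ennreal x) a = ennreal (x powr a)"
  by (simp add: ennpow_def)

lemma ennpow_1 [simp]: "ennpow x 1 = x"
  by (cases x) (simp_all add: ennpow_ennreal)

lemma ennpow_mono: "x \<le> y \<Longrightarrow> 0 < a \<Longrightarrow> ennpow x a \<le> ennpow y a"
  by (cases x; cases y) (auto simp: ennpow_ennreal top_unique intro!: ennreal_leI powr_mono2)

lemma ennpow_mult: "0 < a \<Longrightarrow> ennpow (x * y) a = ennpow x a * ennpow y a"
  by (cases x; cases y)
    (auto simp: ennpow_ennreal powr_mult ennreal_mult_top ennreal_top_mult ennreal_mult[symmetric])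

lemma ennpow_ennpow: "0 < a \<Longrightarrow> 0 < b \<Longrightarrow> ennpow (ennpow x a) b = ennpow x (a * b)"
  by (cases x) (auto simp: ennpow_ennreal powr_powr)

lemma ennpow_le_iff:
  assumes "0 < a" shows "ennpow x (1 / a) \<le> y \<longleftrightarrow> x \<le> ennpow y a"
proof
  assume "ennpow x (1 / a) \<le> y"
  from ennpow_mono[OF this assms] show "x \<le> ennpow y a"
    using assms by (simp add: ennpow_ennpow)
next
  assume "x \<le> ennpow y a"
  from ennpow_mono[OF this, of "1 / a"] show "ennpow x (1 / a) \<le> y"
    using assms by (simp add: ennpow_ennpow)
qed

lemma measurable_ennpow [measurable]:
  assumes [measurable]: "f \<in> borel_measurable M"
  shows "(\<lambda>x. ennpow (f x) a) \<in> borel_measurable M"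
  unfolding ennpow_def by measurable

text \<open>
  The graph of \<open>x \<mapsto> x powr q\<close> lies above its tangent at \<open>a\<close>. All terms are kept nonnegative
  so that the inequality makes sense, and can be integrated, in the extended half-line.
\<close>

lemma young_ennpow:
  assumes q: "1 \<le> q" and a: "0 < a"
  shows "ennreal (q * a powr (q - 1)) * x \<le> ennpow x q + ennreal ((q - 1) * a powr q)"
proof (cases x)
  case (real r)
  have "q * a powr (q - 1) * r \<le> r powr q + (q - 1) * a powr q"
  proof (cases "q = 1")
    case True
    then show ?thesis using a real by simp
  next
    case False
    then have q1: "q > 1" using q by simp
    have "r * a powr (q - 1) \<le> r powr q / q + (a powr (q - 1)) powr (q / (q - 1)) / (q / (q - 1))"
      using q1 a real by (intro Youngs_inequality) (auto simp: field_simps)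
    also have "(a powr (q - 1)) powr (q / (q - 1)) = a powr q"
      using q1 by (simp add: powr_powr)
    finally have "q * (r * a powr (q - 1)) \<le> q * (r powr q / q + a powr q / (q / (q - 1)))"
      using q1 by (intro mult_left_mono) auto
    also have "q * (r powr q / q + a powr q / (q / (q - 1))) = r powr q + (q - 1) * a powr q"
      using q1 by (simp add: field_simps)
    finally show ?thesis by (simp add: mult_ac)
  qed
  then show ?thesis using real q a
    by (simp add: ennpow_ennreal ennreal_mult[symmetric] ennreal_plus[symmetric] del: ennreal_plus)
qed simp

text \<open>
  Jensen's inequality for the probability density \<open>w\<close>: integrate the tangent inequality at the
  mean value of \<open>x\<close>. When that mean is infinite, the tangent at \<open>1\<close> shows that the right-hand side
  is infinite too.
\<close>

lemma ennpow_nn_integral_le: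
  assumes [measurable]: "x \<in> borel_measurable M" "w \<in> borel_measurable M"
    and w: "(\<integral>\<^sup>+y. w y \<partial>M) = 1" and q: "1 \<le> q"
  shows "ennpow (\<integral>\<^sup>+y. x y * w y \<partial>M) q \<le> (\<integral>\<^sup>+y. ennpow (x y) q * w y \<partial>M)"
proof -
  let ?I = "\<integral>\<^sup>+y. ennpow (x y) q * w y \<partial>M"
  have E: "ennreal (q * a powr (q - 1)) * (\<integral>\<^sup>+y. x y * w y \<partial>M) \<le> ?I + ennreal ((q - 1) * a powr q)"
    if a: "0 < a" for a
  proof -
    have "ennreal (q * a powr (q - 1)) * (\<integral>\<^sup>+y. x y * w y \<partial>M)
        = (\<integral>\<^sup>+y. (ennreal (q * a powr (q - 1)) * x y) * w y \<partial>M)"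
      by (simp add: nn_integral_cmult[symmetric] mult.assoc)
    also have "\<dots> \<le> (\<integral>\<^sup>+y. (ennpow (x y) q + ennreal ((q - 1) * a powr q)) * w y \<partial>M)"
      by (intro nn_integral_mono mult_right_mono young_ennpow q a) simp
    also have "\<dots> = ?I + ennreal ((q - 1) * a powr q)"
      by (simp add: distrib_right nn_integral_add nn_integral_cmult w)
    finally show ?thesis .
  qed
  show ?thesis
  proof (cases "\<integral>\<^sup>+y. x y * w y \<partial>M")
    case (real a)
    show ?thesis
    proof (cases "a = 0")
      case True then show ?thesis using real by simp
    next
      case False
      then have a: "0 < a" using real by simp
      have "a powr (q - 1) * a = a powr q"
        using a by (simp add: powr_diff)
      then have "ennreal (q * a powr q) \<le> ?I + ennreal ((q - 1) * a powr q)"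
        using E[OF a] real a q by (simp add: ennreal_mult[symmetric] mult.assoc)
      then have "ennreal (a powr q) \<le> ?I"
      proof (cases ?I)
        case (real r)
        have "0 \<le> (q - 1) * a powr q" using q by simp
        then have "q * a powr q \<le> r + (q - 1) * a powr q"
          using \<open>ennreal (q * a powr q) \<le> ?I + ennreal ((q - 1) * a powr q)\<close> real
          by (simp add: ennreal_plus[symmetric] del: ennreal_plus)
        then show ?thesis using real by (simp add: algebra_simps ennreal_leI)
      qed simp
      then show ?thesis using real a by (simp add: ennpow_ennreal)
    qed
  next
    case top
    then show ?thesis using E[of 1] q by (simp add: ennreal_mult_top top_unique)
  qed
qed

text \<open>
  With \<open>A\<close> the integral of \<open>m\<close>, Jensen's inequality is applied to \<open>u (x, y) * A / m y\<close> and the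
  probability density \<open>m / A\<close>. Measuring \<open>u\<close> in units of its own norm bound is what makes the
  constant come out as \<open>1\<close>.
\<close>

lemma nn_integral_ennpow_integral_le:
  fixes u :: "'a \<times> 'b \<Rightarrow> ennreal" and m :: "'b \<Rightarrow> real"
  assumes "sigma_finite_measure M" "sigma_finite_measure \<mu>"
    and u [measurable]: "u \<in> borel_measurable (M \<Otimes>\<^sub>M \<mu>)" and m [measurable]: "m \<in> borel_measurable \<mu>"
    and pos: "\<And>y. y \<in> space \<mu> \<Longrightarrow> 0 < m y" and p: "1 \<le> p"
    and fin: "(\<integral>\<^sup>+y. ennreal (m y) \<partial>\<mu>) < \<infinity>"
    and le: "\<And>y. y \<in> space \<mu> \<Longrightarrow> (\<integral>\<^sup>+x. ennpow (u (x, y)) p \<partial>M) \<le> ennreal (m y powr p)"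
  shows "(\<integral>\<^sup>+x. ennpow (\<integral>\<^sup>+y. u (x, y) \<partial>\<mu>) p \<partial>M) \<le> ennpow (\<integral>\<^sup>+y. ennreal (m y) \<partial>\<mu>) p"
proof -
  interpret M: sigma_finite_measure M by fact
  interpret \<mu>: sigma_finite_measure \<mu> by fact
  interpret pair_sigma_finite M \<mu> ..
  obtain A where A: "(\<integral>\<^sup>+y. ennreal (m y) \<partial>\<mu>) = ennreal A" "0 \<le> A"
    using fin by (cases "\<integral>\<^sup>+y. ennreal (m y) \<partial>\<mu>") auto
  show ?thesis
  proof (cases "A = 0")
    case True
    then have "AE y in \<mu>. ennreal (m y) = 0" using A by (simp add: nn_integral_0_iff_AE)
    then have "AE y in \<mu>. False" using pos by (auto elim!: AE_mp intro!: AE_I2 simp: ennreal_eq_0_iff not_le[symmetric])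
    then have "(\<integral>\<^sup>+y. u (x, y) \<partial>\<mu>) = (\<integral>\<^sup>+y. 0 \<partial>\<mu>)" for x
      by (intro nn_integral_cong_AE) auto
    then show ?thesis by simp
  next
    case False
    then have Ap: "A > 0" using A by simp
    define k where "k y = ennreal ((A / m y) powr p * (m y / A))" for y
    have [measurable]: "k \<in> borel_measurable \<mu>" unfolding k_def by measurable
    have w1: "(\<integral>\<^sup>+y. ennreal (m y / A) \<partial>\<mu>) = 1"
    proof -
      have "(\<integral>\<^sup>+y. ennreal (m y / A) \<partial>\<mu>) = (\<integral>\<^sup>+y. ennreal (1 / A) * ennreal (m y) \<partial>\<mu>)"
        using Ap pos by (intro nn_integral_cong) (simp add: ennreal_mult[symmetric] less_imp_le)
      also have "\<dots> = ennreal (1 / A) * ennreal A" using A by (simp add: nn_integral_cmult)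
      also have "\<dots> = 1" using Ap by (simp add: ennreal_mult[symmetric])
      finally show ?thesis .
    qed
    have J: "ennpow (\<integral>\<^sup>+y. u (x, y) \<partial>\<mu>) p \<le> (\<integral>\<^sup>+y. ennpow (u (x, y)) p * k y \<partial>\<mu>)" if "x \<in> space M" for x
    proof -
      have [measurable]: "(\<lambda>y. u (x, y)) \<in> borel_measurable \<mu>" using that by measurable
      have c: "ennreal (A / m y) * ennreal (m y / A) = 1" if "y \<in> space \<mu>" for y
        using pos[OF that] Ap by (simp add: ennreal_mult[symmetric])
      have "(\<integral>\<^sup>+y. u (x, y) \<partial>\<mu>) = (\<integral>\<^sup>+y. (u (x, y) * ennreal (A / m y)) * ennreal (m y / A) \<partial>\<mu>)"
        by (intro nn_integral_cong) (simp add: c mult.assoc)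
      then have "ennpow (\<integral>\<^sup>+y. u (x, y) \<partial>\<mu>) p
          \<le> (\<integral>\<^sup>+y. ennpow (u (x, y) * ennreal (A / m y)) p * ennreal (m y / A) \<partial>\<mu>)"
        using ennpow_nn_integral_le[OF _ _ w1 p, of "\<lambda>y. u (x, y) * ennreal (A / m y)"] by simp
      also have "\<dots> = (\<integral>\<^sup>+y. ennpow (u (x, y)) p * k y \<partial>\<mu>)"
        using p Ap pos by (intro nn_integral_cong)
          (simp add: k_def ennpow_mult ennpow_ennreal mult.assoc ennreal_mult[symmetric] less_imp_le)
      finally show ?thesis .
    qed
    have "(\<integral>\<^sup>+x. ennpow (\<integral>\<^sup>+y. u (x, y) \<partial>\<mu>) p \<partial>M) \<le> (\<integral>\<^sup>+x. (\<integral>\<^sup>+y. ennpow (u (x, y)) p * k y \<partial>\<mu>) \<partial>M)"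
      by (intro nn_integral_mono J)
    also have "\<dots> = (\<integral>\<^sup>+y. (\<integral>\<^sup>+x. ennpow (u (x, y)) p * k y \<partial>M) \<partial>\<mu>)"
      by (rule Fubini'[symmetric]) measurable
    also have "\<dots> = (\<integral>\<^sup>+y. (\<integral>\<^sup>+x. ennpow (u (x, y)) p \<partial>M) * k y \<partial>\<mu>)"
      by (intro nn_integral_cong nn_integral_multc) measurable
    also have "\<dots> \<le> (\<integral>\<^sup>+y. ennreal (m y powr p) * k y \<partial>\<mu>)"
      by (intro nn_integral_mono mult_right_mono le) simp_all
    also have "\<dots> = (\<integral>\<^sup>+y. ennreal (A powr p) * ennreal (m y / A) \<partial>\<mu>)"
      using Ap pos by (intro nn_integral_cong)
        (simp add: k_def ennreal_mult[symmetric] powr_divide less_imp_le order.strict_implies_not_eq[symmetric])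
    also have "\<dots> = ennpow (ennreal A) p"
      using A by (simp add: nn_integral_cmult w1 ennpow_ennreal)
    finally show ?thesis by (simp add: A)
  qed
qed

text \<open>
  The norm is that of a nonnegative function, with values in the extended half-line, so that it can
  be taken of integrals that may diverge.
\<close>

definition lp_norm :: "'a measure \<Rightarrow> ennreal \<Rightarrow> ('a \<Rightarrow> ennreal) \<Rightarrow> ennreal" where
  "lp_norm M p u = (if p = \<infinity> then esssup M u
     else ennpow (\<integral>\<^sup>+x. ennpow (u x) (enn2real p) \<partial>M) (1 / enn2real p))"

lemma one_le_enn2real: "1 \<le> p \<Longrightarrow> p \<noteq> \<infinity> \<Longrightarrow> 1 \<le> enn2real p"
  by (cases p) auto

lemma lp_norm_le_iff:
  assumes "1 \<le> p" "p \<noteq> \<infinity>"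
  shows "lp_norm M p u \<le> c \<longleftrightarrow> (\<integral>\<^sup>+x. ennpow (u x) (enn2real p) \<partial>M) \<le> ennpow c (enn2real p)"
  using one_le_enn2real[OF assms] assms by (simp add: lp_norm_def ennpow_le_iff)

lemma lp_norm_infty_le_iff:
  assumes "u \<in> borel_measurable M"
  shows "lp_norm M \<infinity> u \<le> c \<longleftrightarrow> (AE x in M. u x \<le> c)"
proof
  assume "lp_norm M \<infinity> u \<le> c"
  then show "AE x in M. u x \<le> c"
    using esssup_AE[of u M] by (auto simp: lp_norm_def elim!: AE_mp)
qed (use assms in \<open>auto simp: lp_norm_def\<close>)

lemma lp_norm_mono:
  assumes "1 \<le> p" "\<And>x. x \<in> space M \<Longrightarrow> u x \<le> v x" "u \<in> borel_measurable M"
  shows "lp_norm M p u \<le> lp_norm M p v"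
proof (cases "p = \<infinity>")
  case True
  then show ?thesis using assms by (auto simp: lp_norm_def intro!: esssup_AE_mono)
next
  case False
  have "(\<integral>\<^sup>+x. ennpow (u x) (enn2real p) \<partial>M) \<le> (\<integral>\<^sup>+x. ennpow (v x) (enn2real p) \<partial>M)"
    using one_le_enn2real[OF assms(1) False] assms(2) by (intro nn_integral_mono ennpow_mono) auto
  then show ?thesis using False one_le_enn2real[OF assms(1) False]
    by (auto simp: lp_norm_def intro!: ennpow_mono)
qed

lemma lp_norm_cong:
  assumes "\<And>x. x \<in> space M \<Longrightarrow> u x = v x"
  shows "lp_norm M p u = lp_norm M p v"
proof -
  have "u \<in> borel_measurable M \<longleftrightarrow> v \<in> borel_measurable M"
    using assms by (rule measurable_cong)
  then have "esssup M u = esssup M v"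
    using assms by (cases "u \<in> borel_measurable M") (auto intro!: esssup_AE_cong simp: esssup_non_measurable)
  moreover have "(\<integral>\<^sup>+x. ennpow (u x) (enn2real p) \<partial>M) = (\<integral>\<^sup>+x. ennpow (v x) (enn2real p) \<partial>M)"
    by (intro nn_integral_cong) (simp add: assms)
  ultimately show ?thesis by (simp add: lp_norm_def)
qed

lemma lp_norm_const_finite:
  assumes "finite_measure M" "1 \<le> p" "c < \<infinity>"
  shows "lp_norm M p (\<lambda>x. c) < \<infinity>"
proof (cases "p = \<infinity>")
  case True
  have "lp_norm M \<infinity> (\<lambda>x. c) \<le> c" by (subst lp_norm_infty_le_iff) auto
  then show ?thesis using True assms by (auto simp: le_less_trans)
next
  case False
  interpret finite_measure M by fact
  have p: "1 \<le> enn2real p" by (rule one_le_enn2real[OF assms(2) False])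
  have "emeasure M (space M) < \<top>" by (simp add: less_top[symmetric])
  then have "ennpow c (enn2real p) * emeasure M (space M) < \<infinity>"
    using assms(3)
    by (cases c) (auto simp: ennpow_ennreal ennreal_mult_less_top less_top)
  then show ?thesis using False
    by (cases "ennpow c (enn2real p) * emeasure M (space M)") (auto simp: lp_norm_def ennpow_ennreal)
qed

text \<open>
  Minkowski's inequality for integrals, in terms of a measurable majorant \<open>m\<close> of the norms of the
  sections: these norms need not depend measurably on \<open>y\<close> when \<open>p\<close> is infinite. In that case the
  claim is Fubini's theorem for null sets; otherwise \<open>m\<close> is first made positive by adding a small
  constant, whose integral is small because \<open>\<mu>\<close> is finite.
\<close>

lemma lp_norm_integral_le:
  fixes u :: "'a \<times> 'b \<Rightarrow> ennreal" and m :: "'b \<Rightarrow> real"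
  assumes M: "sigma_finite_measure M" and \<mu>: "finite_measure \<mu>" and p: "1 \<le> p"
    and u [measurable]: "u \<in> borel_measurable (M \<Otimes>\<^sub>M \<mu>)" and m [measurable]: "m \<in> borel_measurable \<mu>"
    and m0: "\<And>y. y \<in> space \<mu> \<Longrightarrow> 0 \<le> m y"
    and le: "\<And>y. y \<in> space \<mu> \<Longrightarrow> lp_norm M p (\<lambda>x. u (x, y)) \<le> ennreal (m y)"
  shows "lp_norm M p (\<lambda>x. \<integral>\<^sup>+y. u (x, y) \<partial>\<mu>) \<le> (\<integral>\<^sup>+y. ennreal (m y) \<partial>\<mu>)"
proof -
  interpret M: sigma_finite_measure M by fact
  interpret \<mu>: finite_measure \<mu> by fact
  interpret pair_sigma_finite M \<mu> ..
  show ?thesis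
  proof (cases "p = \<infinity>")
    case True
    have "AE x in M. u (x, y) \<le> ennreal (m y)" if "y \<in> space \<mu>" for y
    proof -
      have "(\<lambda>x. u (x, y)) \<in> borel_measurable M" using that by measurable
      from lp_norm_infty_le_iff[OF this] show ?thesis using le[OF that] True by simp
    qed
    then have "AE y in \<mu>. AE x in M. u (x, y) \<le> ennreal (m y)" by (rule AE_I2)
    then have "AE x in M. AE y in \<mu>. u (x, y) \<le> ennreal (m y)"
      by (subst AE_commute) simp_all
    then have "AE x in M. (\<integral>\<^sup>+y. u (x, y) \<partial>\<mu>) \<le> (\<integral>\<^sup>+y. ennreal (m y) \<partial>\<mu>)"
      by (rule AE_mp) (auto intro!: AE_I2 nn_integral_mono_AE)
    then show ?thesis unfolding True by (subst lp_norm_infty_le_iff) simp_all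
  next
    case False
    have p1: "1 \<le> enn2real p" by (rule one_le_enn2real[OF p False])
    show ?thesis
    proof (rule ennreal_le_epsilon)
      fix e :: real assume e: "0 < e" and fin: "(\<integral>\<^sup>+y. ennreal (m y) \<partial>\<mu>) < \<top>"
      \<comment> \<open>Chosen so that the constant \<open>d\<close> has integral at most \<open>e\<close>.\<close>
      define d where "d = e / (measure \<mu> (space \<mu>) + 1)"
      have d: "0 < d" using e by (simp add: d_def add_nonneg_pos)
      have D: "0 < measure \<mu> (space \<mu>) + 1" by (simp add: add_nonneg_pos)
      have "d * measure \<mu> (space \<mu>) \<le> d * (measure \<mu> (space \<mu>) + 1)"
        using d by simp
      also have "\<dots> = e" using D by (simp add: d_def)
      finally have "d * measure \<mu> (space \<mu>) \<le> e" .
      then have de: "(\<integral>\<^sup>+y. ennreal d \<partial>\<mu>) \<le> ennreal e"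
        using d by (simp add: \<mu>.emeasure_eq_measure ennreal_mult[symmetric] ennreal_leI)
      have eq: "(\<integral>\<^sup>+y. ennreal (m y + d) \<partial>\<mu>) = (\<integral>\<^sup>+y. ennreal (m y) \<partial>\<mu>) + (\<integral>\<^sup>+y. ennreal d \<partial>\<mu>)"
        using m0 d by (subst nn_integral_add[symmetric]) (auto intro!: nn_integral_cong)
      have "(\<integral>\<^sup>+x. ennpow (u (x, y)) (enn2real p) \<partial>M) \<le> ennreal ((m y + d) powr enn2real p)"
        if y: "y \<in> space \<mu>" for y
      proof -
        have "lp_norm M p (\<lambda>x. u (x, y)) \<le> ennreal (m y + d)"
          using d by (intro order_trans[OF le[OF y]] ennreal_leI) simp
        then show ?thesis using m0[OF y] d by (simp add: lp_norm_le_iff[OF p False] ennpow_ennreal del: ennreal_plus)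
      qed
      moreover have "(\<integral>\<^sup>+y. ennreal (m y + d) \<partial>\<mu>) < \<infinity>"
        unfolding eq using fin le_less_trans[OF de ennreal_less_top] by simp
      ultimately have "(\<integral>\<^sup>+x. ennpow (\<integral>\<^sup>+y. u (x, y) \<partial>\<mu>) (enn2real p) \<partial>M)
          \<le> ennpow (\<integral>\<^sup>+y. ennreal (m y + d) \<partial>\<mu>) (enn2real p)"
        using m0 d by (intro nn_integral_ennpow_integral_le M \<mu>.sigma_finite_measure_axioms u p1)
          (auto simp: add_nonneg_pos)
      then have "lp_norm M p (\<lambda>x. \<integral>\<^sup>+y. u (x, y) \<partial>\<mu>) \<le> (\<integral>\<^sup>+y. ennreal (m y + d) \<partial>\<mu>)"
        by (simp add: lp_norm_le_iff[OF p False])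
      also have "\<dots> \<le> (\<integral>\<^sup>+y. ennreal (m y) \<partial>\<mu>) + ennreal e"
        unfolding eq using de by (rule add_left_mono)
      finally show "lp_norm M p (\<lambda>x. \<integral>\<^sup>+y. u (x, y) \<partial>\<mu>) \<le> (\<integral>\<^sup>+y. ennreal (m y) \<partial>\<mu>) + ennreal e" .
    qed
  qed
qed

text \<open>
  The triangle inequality is Minkowski's inequality for counting measure on two points.
\<close>

lemma lp_norm_add_le:
  assumes M: "sigma_finite_measure M" and p: "1 \<le> p"
    and [measurable]: "u \<in> borel_measurable M" "v \<in> borel_measurable M"
  shows "lp_norm M p (\<lambda>x. u x + v x) \<le> lp_norm M p u + lp_norm M p v"
proof (cases "lp_norm M p u = \<top> \<or> lp_norm M p v = \<top>")
  case False
  then obtain a b where ab: "lp_norm M p u = ennreal a" "lp_norm M p v = ennreal b" "0 \<le> a" "0 \<le> b"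
    by (metis ennreal_cases)
  let ?\<mu> = "count_space (UNIV :: bool set)"
  let ?u = "\<lambda>(x, y). if y then u x else v x"
  let ?m = "\<lambda>y. if y then a else b"
  have "lp_norm M p (\<lambda>x. \<integral>\<^sup>+y. ?u (x, y) \<partial>?\<mu>) \<le> (\<integral>\<^sup>+y. ennreal (?m y) \<partial>?\<mu>)"
  proof (rule lp_norm_integral_le[OF M _ p])
    show "finite_measure ?\<mu>" by (rule finite_measure_count_space) simp
    show "lp_norm M p (\<lambda>x. ?u (x, y)) \<le> ennreal (?m y)" for y
      using ab by (cases y) simp_all
  qed (use ab in auto)
  then show ?thesis using ab by (simp add: nn_integral_count_space_finite UNIV_bool add.commute)
qed auto

section \<open>Functions holomorphic on slices and the Euler derivative\<close>

text \<open>
  Of a holomorphic function only its restrictions to complex lines through the origin matter for the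
  estimates, together with continuity, which provides measurability. Unlike
  \<open>hol_ball\<close>, this class is visibly closed under the Euler derivative.
\<close>

definition slice_holomorphic :: "(complex ^ 'N \<Rightarrow> complex) \<Rightarrow> bool" where
  "slice_holomorphic g \<longleftrightarrow> continuous_on (ball 0 1) g \<and>
     (\<forall>z. (\<lambda>c. g (c *s z)) holomorphic_on {c. c *s z \<in> ball 0 1})"

definition euler_deriv :: "(complex ^ 'N \<Rightarrow> complex) \<Rightarrow> complex ^ 'N \<Rightarrow> complex" where
  "euler_deriv g z = deriv (\<lambda>c. g (c *s z)) 1"

lemma vector_smult_left_commute: "a *s (b *s z) = b *s (a *s (z :: complex ^ 'N))"
  by (metis vector_smult_assoc mult.commute)

lemma open_slice_domain: "open {c. c *s (z :: complex ^ 'N) \<in> ball 0 1}"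
  using open_vimage[of "ball 0 1" "\<lambda>c. c *s z"]
  by (simp add: vimage_def continuous_on_vector_scalar_mult)

lemma slice_has_field_derivative:
  fixes g :: "complex ^ 'N \<Rightarrow> complex"
  assumes "slice_holomorphic g" "c *s z \<in> ball 0 1"
  shows "((\<lambda>c. g (c *s z)) has_field_derivative deriv (\<lambda>c. g (c *s z)) c) (at c)"
  using assms open_slice_domain[of z]
  by (intro holomorphic_derivI[of _ "{c. c *s z \<in> ball 0 1}"]) (auto simp: slice_holomorphic_def)

lemma euler_deriv_scale:
  fixes g :: "complex ^ 'N \<Rightarrow> complex"
  assumes "slice_holomorphic g" "c *s z \<in> ball 0 1"
  shows "euler_deriv g (c *s z) = c * deriv (\<lambda>b. g (b *s z)) c"
proof -
  have "((\<lambda>b. g ((b * c) *s z)) has_field_derivative deriv (\<lambda>b. g (b *s z)) c * c) (at 1)"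
  proof (rule DERIV_chain2[where f = "\<lambda>c. g (c *s z)"])
    show "((\<lambda>c. g (c *s z)) has_field_derivative deriv (\<lambda>b. g (b *s z)) c) (at (1 * c))"
      using slice_has_field_derivative[OF assms] by simp
    show "((\<lambda>b. b * c) has_field_derivative c) (at 1)"
      by (auto intro!: derivative_eq_intros)
  qed
  then show ?thesis
    by (simp add: euler_deriv_def DERIV_imp_deriv vector_smult_assoc)
qed

text \<open>
  In logarithmic coordinates the Euler derivative is the ordinary derivative.
\<close>

lemma euler_deriv_exp:
  fixes g :: "complex ^ 'N \<Rightarrow> complex"
  assumes "slice_holomorphic g" "exp w *s z \<in> ball 0 1"
  shows "((\<lambda>w. g (exp w *s z)) has_field_derivative euler_deriv g (exp w *s z)) (at w)"
proof -
  have "((\<lambda>w. g (exp w *s z)) has_field_derivative deriv (\<lambda>b. g (b *s z)) (exp w) * exp w) (at w)"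
    by (rule DERIV_chain2[where f = "\<lambda>c. g (c *s z)", OF slice_has_field_derivative[OF assms] DERIV_exp])
  then show ?thesis using euler_deriv_scale[OF assms] by (simp add: mult.commute)
qed

lemma euler_deriv_cong_ball:
  fixes g :: "complex ^ 'N \<Rightarrow> complex"
  assumes "\<And>z. z \<in> ball 0 1 \<Longrightarrow> g z = h z" "z \<in> ball 0 1"
  shows "euler_deriv g z = euler_deriv h z"
  unfolding euler_deriv_def
proof (rule deriv_cong_ev)
  have "\<forall>\<^sub>F c in nhds 1. c \<in> {c. c *s z \<in> ball 0 1}"
    using assms(2) by (intro eventually_nhds_in_open open_slice_domain) simp
  then show "\<forall>\<^sub>F c in nhds 1. g (c *s z) = h (c *s z)"
    by eventually_elim (simp add: assms(1))
qed simp

text \<open>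
  Cauchy's inequality on a small circle around \<open>1\<close> bounds the difference of the derivatives at two
  points by the largest difference of the values of \<open>g\<close> on the corresponding circles, which is
  small by uniform continuity of \<open>g\<close> on a compact ball.
\<close>

lemma continuous_on_euler_deriv:
  fixes g :: "complex ^ 'N \<Rightarrow> complex"
  assumes g: "slice_holomorphic g"
  shows "continuous_on (ball 0 1) (euler_deriv g)"
proof (intro continuous_at_imp_continuous_on ballI)
  fix a :: "complex ^ 'N" assume a: "a \<in> ball 0 1"
  \<comment> \<open>The circle of radius \<open>\<delta>\<close> around \<open>1\<close> keeps every \<open>z\<close> with \<open>norm z < r\<close> inside a compact ball.\<close>
  define r where "r = (1 + norm a) / 2"
  have r: "norm a < r" "r < 1" "0 < r" using a norm_ge_zero[of a] by (auto simp: r_def simp del: norm_ge_zero)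
  define \<delta> where "\<delta> = (1 - r) / 2"
  have \<delta>: "0 < \<delta>" using r by (simp add: \<delta>_def)
  have \<delta>r: "(1 + \<delta>) * r < 1"
  proof -
    have "(1 + \<delta>) * r = r + \<delta> * r" by (simp add: algebra_simps)
    also have "\<dots> < r + \<delta> * 1" using r \<delta> by (intro add_strict_left_mono mult_strict_left_mono) auto
    also have "\<dots> < 1" using r by (simp add: \<delta>_def field_simps)
    finally show ?thesis .
  qed
  let ?K = "cball 0 ((1 + \<delta>) * r) :: (complex ^ 'N) set"
  have K: "?K \<subseteq> ball 0 1" using \<delta>r by (auto simp: dist_norm)
  have "uniformly_continuous_on ?K g"
    using g K by (intro compact_uniformly_continuous)
      (auto simp: slice_holomorphic_def intro: continuous_on_subset)
  show "isCont (euler_deriv g) a"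
    unfolding continuous_at_eps_delta
  proof (intro allI impI)
    fix e :: real assume e: "0 < e"
    then have "0 < e * \<delta> / 2" using \<delta> by simp
    then obtain d where d: "0 < d"
      and ud': "\<forall>x\<in>?K. \<forall>y\<in>?K. dist y x < d \<longrightarrow> dist (g y) (g x) < e * \<delta> / 2"
      using \<open>uniformly_continuous_on ?K g\<close> unfolding uniformly_continuous_on_def by blast
    then have ud: "dist (g y) (g x) < e * \<delta> / 2" if "x \<in> ?K" "y \<in> ?K" "dist y x < d" for x y
      using that by blast
    define d' where "d' = min (r - norm a) (d / (1 + \<delta>))"
    have d': "0 < d'" using r d \<delta> by (simp add: d'_def)
    show "\<exists>d>0. \<forall>z. dist z a < d \<longrightarrow> dist (euler_deriv g z) (euler_deriv g a) < e"
    proof (intro exI[of _ d'] conjI allI impI)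
      show "0 < d'" by (rule d')
    next
      fix z assume z: "dist z a < d'"
      have "norm z \<le> norm a + norm (z - a)" by norm
      then have zr: "norm z < r" using z by (simp add: d'_def dist_norm)
      have inK: "c *s x \<in> ?K" if "norm (c - 1) \<le> \<delta>" "norm x < r" for c and x :: "complex ^ 'N"
      proof -
        have "norm c \<le> 1 + norm (c - 1)" using norm_triangle_ineq[of 1 "c - 1"] by simp
        then have "norm c * norm x \<le> (1 + \<delta>) * r"
          using that r \<delta> by (intro mult_mono) auto
        then show ?thesis by (simp add: norm_vector_scalar_mult_complex)
      qed
      have sub: "ball 1 \<delta> \<subseteq> {c. c *s x \<in> ball 0 1}" "cball 1 \<delta> \<subseteq> {c. c *s x \<in> ball 0 1}"
        if "norm x < r" for x :: "complex ^ 'N"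
        using inK[OF _ that] K by (auto simp: dist_norm norm_minus_commute subset_iff)
      have hol: "(\<lambda>c. g (c *s x)) holomorphic_on {c. c *s x \<in> ball 0 1}" for x
        using g by (simp add: slice_holomorphic_def)
      let ?h = "\<lambda>c. g (c *s z) - g (c *s a)"
      have "norm ((deriv ^^ 1) ?h 1) \<le> fact 1 * (e * \<delta> / 2) / \<delta> ^ 1"
      proof (rule Cauchy_inequality[OF _ _ \<delta>])
        show "?h holomorphic_on ball 1 \<delta>"
          using sub(1) zr r(1) hol by (intro holomorphic_intros) (auto intro: holomorphic_on_subset)
        show "continuous_on (cball 1 \<delta>) ?h"
          using sub(2) zr r(1) hol
          by (intro continuous_intros holomorphic_on_imp_continuous_on) (auto intro: holomorphic_on_subset)
        fix c :: complex assume "norm (1 - c) = \<delta>"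
        then have c: "norm (c - 1) \<le> \<delta>" by (simp add: norm_minus_commute)
        have "norm c \<le> 1 + norm (c - 1)" using norm_triangle_ineq[of 1 "c - 1"] by simp
        then have nc: "norm c \<le> 1 + \<delta>" using c by linarith
        have "dist (c *s z) (c *s a) = norm (c *s (z - a))"
          by (simp only: dist_norm vector_ssub_ldistrib)
        also have "\<dots> \<le> (1 + \<delta>) * dist z a"
          unfolding norm_vector_scalar_mult_complex dist_norm using nc by (rule mult_right_mono) simp
        also have "\<dots> < d" using z \<delta> by (simp add: d'_def field_simps)
        finally show "norm (?h c) \<le> e * \<delta> / 2"
          using ud[OF inK[OF c r(1)] inK[OF c zr]] by (simp add: dist_norm)
      qed
      moreover have "deriv ?h 1 = euler_deriv g z - euler_deriv g a"
        unfolding euler_deriv_def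
        using zr r by (intro DERIV_imp_deriv DERIV_diff slice_has_field_derivative g) auto
      ultimately have "norm (euler_deriv g z - euler_deriv g a) \<le> e / 2"
        using \<delta> by simp
      then show "dist (euler_deriv g z) (euler_deriv g a) < e"
        using e by (simp add: dist_norm)
    qed
  qed
qed

lemma slice_holomorphic_euler_deriv:
  fixes g :: "complex ^ 'N \<Rightarrow> complex"
  assumes g: "slice_holomorphic g"
  shows "slice_holomorphic (euler_deriv g)"
  unfolding slice_holomorphic_def
proof (intro conjI allI continuous_on_euler_deriv g)
  fix z :: "complex ^ 'N"
  have "(\<lambda>c. c * deriv (\<lambda>b. g (b *s z)) c) holomorphic_on {c. c *s z \<in> ball 0 1}"
    using g by (intro holomorphic_intros open_slice_domain) (simp add: slice_holomorphic_def)
  then show "(\<lambda>c. euler_deriv g (c *s z)) holomorphic_on {c. c *s z \<in> ball 0 1}"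
    by (rule holomorphic_transform) (simp add: euler_deriv_scale[OF g])
qed

lemma rotate_in_ball: "exp (\<i> * complex_of_real t) *s z \<in> ball 0 1 \<longleftrightarrow> z \<in> ball 0 1"
  by (simp add: norm_vector_scalar_mult_complex)

lemma slice_holomorphic_rotate:
  fixes g :: "complex ^ 'N \<Rightarrow> complex"
  assumes g: "slice_holomorphic g"
  shows "slice_holomorphic (\<lambda>z. g (exp (\<i> * complex_of_real t) *s z))"
  unfolding slice_holomorphic_def
proof (intro conjI allI)
  let ?e = "exp (\<i> * complex_of_real t)"
  show "continuous_on (ball 0 1) (\<lambda>z. g (?e *s z))"
  proof (rule continuous_on_compose2[of "ball 0 1" g])
    show "continuous_on (ball 0 1) g" using g by (simp add: slice_holomorphic_def)
    show "continuous_on (ball 0 1) (\<lambda>z :: complex ^ 'N. ?e *s z)" by (intro continuous_intros)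
    show "(*s) ?e ` ball 0 1 \<subseteq> (ball 0 1 :: (complex ^ 'N) set)"
      by (auto simp: norm_vector_scalar_mult_complex)
  qed
  fix z :: "complex ^ 'N"
  have "(\<lambda>c. g (c *s (?e *s z))) holomorphic_on {c. c *s (?e *s z) \<in> ball 0 1}"
    by (rule spec[OF conjunct2[OF g[unfolded slice_holomorphic_def]]])
  moreover have "(\<lambda>c. g (c *s (?e *s z))) = (\<lambda>c. g (?e *s (c *s z)))"
    by (intro ext arg_cong[where f = g] vector_smult_left_commute)
  moreover have "{c. c *s (?e *s z) \<in> ball 0 1} = {c. c *s z \<in> ball 0 1}"
    by (simp add: norm_vector_scalar_mult_complex norm_mult)
  ultimately show "(\<lambda>c. g (?e *s (c *s z))) holomorphic_on {c. c *s z \<in> ball 0 1}"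
    by metis
qed

lemma slice_holomorphic_diff:
  "slice_holomorphic g \<Longrightarrow> slice_holomorphic h \<Longrightarrow> slice_holomorphic (\<lambda>z. g z - h z)"
  by (simp add: slice_holomorphic_def continuous_on_diff holomorphic_on_diff)

lemma slice_holomorphic_rot_diff:
  "slice_holomorphic g \<Longrightarrow> slice_holomorphic (rot_diff t g)"
  unfolding rot_diff_def by (intro slice_holomorphic_diff slice_holomorphic_rotate)

lemma euler_deriv_rot_diff:
  fixes g :: "complex ^ 'N \<Rightarrow> complex"
  assumes g: "slice_holomorphic g" and z: "z \<in> ball 0 1"
  shows "euler_deriv (rot_diff t g) z = rot_diff t (euler_deriv g) z"
proof -
  let ?e = "exp (\<i> * complex_of_real t)"
  have "((\<lambda>c. g (c *s (?e *s z)) - g (c *s z)) has_field_derivative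
      euler_deriv g (?e *s z) - euler_deriv g z) (at 1)"
    unfolding euler_deriv_def using z rotate_in_ball[of t z]
    by (intro DERIV_diff slice_has_field_derivative g) auto
  moreover have "(\<lambda>c. g (c *s (?e *s z)) - g (c *s z)) = (\<lambda>c. rot_diff t g (c *s z))"
    unfolding rot_diff_def
    by (intro ext arg_cong2[where f = "(-)"] arg_cong[where f = g] refl vector_smult_left_commute)
  ultimately have "((\<lambda>c. rot_diff t g (c *s z)) has_field_derivative
      euler_deriv g (?e *s z) - euler_deriv g z) (at 1)"
    by metis
  from DERIV_imp_deriv[OF this] show ?thesis
    unfolding euler_deriv_def[of "rot_diff t g"] by (simp only: rot_diff_def)
qed

lemma line_has_derivative:
  "((\<lambda>c. z + c *s (w :: complex ^ 'N)) has_derivative (\<lambda>h. h *s w)) (at c)"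
proof -
  have "bounded_linear (\<lambda>c. c *s w)"
    by (rule linear_conv_bounded_linear[THEN iffD1], rule linearI)
      (simp_all add: vec_eq_iff algebra_simps)
  then have "((\<lambda>c. c *s w) has_derivative (\<lambda>h. h *s w)) (at c)"
    by (rule bounded_linear_imp_has_derivative)
  from has_derivative_add[OF has_derivative_const this] show ?thesis by simp
qed

lemma open_line_domain: "open {c. z + c *s (w :: complex ^ 'N) \<in> ball 0 1}"
  using open_vimage[of "ball 0 1" "\<lambda>c. z + c *s w"]
  by (simp add: vimage_def continuous_on_vector_scalar_mult continuous_on_add)

lemma hol_ball_line:
  fixes f :: "complex ^ 'N \<Rightarrow> complex"
  assumes f: "f \<in> hol_ball"
  shows "(\<lambda>c. f (z + c *s w)) holomorphic_on {c. z + c *s w \<in> ball 0 1}"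
proof (rule holomorphic_onI)
  fix c assume "c \<in> {c. z + c *s w \<in> ball 0 1}"
  then have c: "z + c *s w \<in> ball 0 1" by simp
  have "\<forall>z\<in>ball 0 1. \<exists>D. (f has_derivative D) (at z) \<and> (\<forall>c v. D (c *s v) = c * D v)"
    using f by (simp add: hol_ball_def holomorphic_cn_def)
  from bspec[OF this c] obtain D
    where D: "(f has_derivative D) (at (z + c *s w))" "\<And>c v. D (c *s v) = c * D v"
    by blast
  from has_derivative_compose[OF line_has_derivative D(1)]
  have "((\<lambda>c. f (z + c *s w)) has_field_derivative D w) (at c)"
    by (simp add: D(2) has_field_derivative_def mult_commute_abs)
  then show "(\<lambda>c. f (z + c *s w)) field_differentiable at c within {c. z + c *s w \<in> ball 0 1}"
    by (metis field_differentiable_at_within field_differentiable_def)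
qed

lemma slice_holomorphic_if_hol_ball:
  fixes f :: "complex ^ 'N \<Rightarrow> complex"
  assumes f: "f \<in> hol_ball" shows "slice_holomorphic f"
  unfolding slice_holomorphic_def
proof (intro conjI allI)
  have "\<exists>D. (f has_derivative D) (at z)" if "z \<in> ball 0 1" for z
    using f that by (auto simp: hol_ball_def holomorphic_cn_def)
  then show "continuous_on (ball 0 1) f"
    by (intro continuous_at_imp_continuous_on ballI) (metis has_derivative_continuous)
  show "(\<lambda>c. f (c *s z)) holomorphic_on {c. c *s z \<in> ball 0 1}" for z
    using hol_ball_line[OF f, of 0 z] by simp
qed

section \<open>Integral means increase with the radius\<close>

lemma norm_le_nn_integral_if_has_integral:
  fixes f :: "real \<Rightarrow> 'a::euclidean_space"
  assumes f: "continuous_on {a..b} f" and I: "(f has_integral I) {a..b}"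
  shows "ennreal (norm I) \<le> (\<integral>\<^sup>+x. ennreal (norm (f x)) \<partial>restrict_space lborel {a..b})"
proof -
  have si: "set_integrable lborel {a..b} f"
    by (rule borel_integrable_atLeastAtMost'[OF f])
  have "I = integral\<^sup>L lborel (\<lambda>x. indicator {a..b} x *\<^sub>R f x)"
    using set_borel_integral_eq_integral(2)[OF si] I
    by (simp add: set_lebesgue_integral_def integral_unique)
  also have "ennreal (norm \<dots>) \<le> (\<integral>\<^sup>+x. ennreal (norm (indicator {a..b} x *\<^sub>R f x)) \<partial>lborel)"
    using si unfolding set_integrable_def by (rule integral_norm_bound_ennreal)
  also have "\<dots> = (\<integral>\<^sup>+x. ennreal (norm (f x)) \<partial>restrict_space lborel {a..b})"
    by (subst nn_integral_restrict_space) (auto intro!: nn_integral_cong simp: indicator_def)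
  finally show ?thesis .
qed

definition circle_point :: "real \<Rightarrow> complex" where
  "circle_point x = exp (2 * of_real pi * \<i> * of_real x)"

lemma norm_circle_point [simp]: "norm (circle_point x) = 1"
  by (simp add: circle_point_def)

lemma continuous_on_circle_point [continuous_intros]: "continuous_on A circle_point"
  unfolding circle_point_def by (intro continuous_intros)

definition poisson_kernel :: "real \<Rightarrow> real \<Rightarrow> real" where
  "poisson_kernel \<rho> x = (1 - \<rho>\<^sup>2) / (norm (circle_point x - of_real \<rho>))\<^sup>2"

lemma circle_point_neq: "\<bar>\<rho>\<bar> < 1 \<Longrightarrow> circle_point x \<noteq> of_real \<rho>"
  by (metis norm_circle_point norm_of_real less_irrefl)

lemma poisson_kernel_nonneg: "\<bar>\<rho>\<bar> < 1 \<Longrightarrow> 0 \<le> poisson_kernel \<rho> x"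
  by (simp add: poisson_kernel_def abs_square_le_1 less_imp_le)

lemma continuous_on_poisson_kernel: "\<bar>\<rho>\<bar> < 1 \<Longrightarrow> continuous_on A (poisson_kernel \<rho>)"
  unfolding poisson_kernel_def
  by (intro continuous_intros) (auto simp: circle_point_neq)

text \<open>
  Cauchy's formula at \<open>\<rho>\<close> for the function \<open>G u * (1 - \<rho>\<^sup>2) / (1 - \<rho> * u)\<close>, which agrees with \<open>G\<close> at
  \<open>\<rho>\<close>: on the unit circle the extra factor turns the Cauchy kernel into the Poisson kernel.
\<close>

lemma poisson_integral:
  assumes G: "G holomorphic_on S" "cball 0 1 \<subseteq> S" and \<rho>: "0 \<le> \<rho>" "\<rho> < 1"
  shows "((\<lambda>x. G (circle_point x) * of_real (poisson_kernel \<rho> x)) has_integral G (of_real \<rho>)) {0..1}"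
proof -
  let ?\<rho> = "complex_of_real \<rho>"
  let ?f = "\<lambda>u. G u * (1 - ?\<rho>\<^sup>2) / (1 - ?\<rho> * u)"
  have nz: "1 - ?\<rho> * u \<noteq> 0" if "norm u \<le> 1" for u
  proof
    assume "1 - ?\<rho> * u = 0"
    then have "norm (?\<rho> * u) = 1" by simp
    moreover have "norm (?\<rho> * u) \<le> \<rho> * 1"
      unfolding norm_mult using \<rho> that by (intro mult_mono) auto
    ultimately show False using \<rho> by simp
  qed
  have hol: "?f holomorphic_on cball 0 1"
    using G nz by (intro holomorphic_intros) (auto intro: holomorphic_on_subset)
  have \<rho>2: "1 - ?\<rho>\<^sup>2 \<noteq> 0"
    using nz[of ?\<rho>] \<rho> by (simp add: power2_eq_square)
  have "((\<lambda>u. ?f u / (u - ?\<rho>)) has_contour_integral 2 * of_real pi * \<i> * ?f ?\<rho>) (circlepath 0 1)"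
    using hol \<rho> by (intro Cauchy_integral_circlepath holomorphic_on_imp_continuous_on)
      (auto intro: holomorphic_on_subset)
  moreover have "?f ?\<rho> = G ?\<rho>" using \<rho>2 by (simp add: power2_eq_square)
  ultimately have ci: "((\<lambda>u. ?f u / (u - ?\<rho>)) has_contour_integral 2 * of_real pi * \<i> * G ?\<rho>)
      (circlepath 0 1)" by simp
  have cp: "circlepath 0 1 x = circle_point x" for x
    by (simp add: circlepath circle_point_def)
  have vd: "vector_derivative (circlepath 0 1) (at x within {0..1}) = 2 * of_real pi * \<i> * circle_point x"
    if "x \<in> {0..1}" for x
    using that vector_derivative_circlepath01[of x 0 1] by (simp add: circle_point_def)
  have "((\<lambda>x. ?f (circle_point x) / (circle_point x - ?\<rho>)
      * (2 * of_real pi * \<i> * circle_point x)) has_integral 2 * of_real pi * \<i> * G ?\<rho>) {0..1}"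
    using ci unfolding has_contour_integral_def
    by (rule has_integral_eq[rotated]) (simp only: cp vd)
  then have "((\<lambda>x. 1 / (2 * of_real pi * \<i>) * (?f (circle_point x) / (circle_point x - ?\<rho>)
      * (2 * of_real pi * \<i> * circle_point x))) has_integral
      1 / (2 * of_real pi * \<i>) * (2 * of_real pi * \<i> * G ?\<rho>)) {0..1}"
    by (rule has_integral_mult_right)
  moreover have "1 / (2 * of_real pi * \<i>) * (?f (circle_point x) / (circle_point x - ?\<rho>)
      * (2 * of_real pi * \<i> * circle_point x)) = G (circle_point x) * of_real (poisson_kernel \<rho> x)" for x
  proof -
    let ?u = "circle_point x"
    have u: "?u * cnj ?u = 1" "?u \<noteq> 0"
      using complex_norm_square[of ?u] norm_circle_point[of x] by auto
    have n: "?u - ?\<rho> \<noteq> 0" using circle_point_neq[of \<rho> x] \<rho> by simp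
    have c: "of_real ((norm (?u - ?\<rho>))\<^sup>2) = (?u - ?\<rho>) * (cnj ?u - ?\<rho>)"
      by (simp only: complex_norm_square complex_cnj_diff complex_cnj_complex_of_real)
    have "?u * of_real ((norm (?u - ?\<rho>))\<^sup>2) = (?u - ?\<rho>) * (?u * cnj ?u - ?\<rho> * ?u)"
      unfolding c by (simp add: algebra_simps)
    then have e: "?u * of_real ((norm (?u - ?\<rho>))\<^sup>2) = (1 - ?\<rho> * ?u) * (?u - ?\<rho>)"
      by (simp only: u mult.commute[of "?u - ?\<rho>"])
    have gen: "v / b = 1 / N" if "v * N = b" "v \<noteq> 0" "N \<noteq> 0" for v b N :: complex
      using that by auto
    have "of_real ((norm (?u - ?\<rho>))\<^sup>2) \<noteq> (0 :: complex)" using n by simp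
    then have "?u / ((1 - ?\<rho> * ?u) * (?u - ?\<rho>)) = 1 / of_real ((norm (?u - ?\<rho>))\<^sup>2)"
      by (rule gen[OF e u(2)])
    then have "G ?u * (1 - ?\<rho>\<^sup>2) * (?u / ((1 - ?\<rho> * ?u) * (?u - ?\<rho>)))
        = G ?u * of_real (poisson_kernel \<rho> x)"
      by (simp add: poisson_kernel_def)
    moreover have gen2: "1 / k * (v / d / e * (k * w)) = v * (w / (d * e))" if "k \<noteq> 0" for k v d e w :: complex
      using that by simp
    ultimately show ?thesis by (subst gen2) simp_all
  qed
  ultimately show ?thesis by simp
qed

lemma nn_integral_poisson_kernel:
  assumes \<rho>: "0 \<le> \<rho>" "\<rho> < 1"
  shows "(\<integral>\<^sup>+x. ennreal (poisson_kernel \<rho> x) \<partial>restrict_space lborel {0..1}) = 1"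
proof -
  have \<rho>': "\<bar>\<rho>\<bar> < 1" using \<rho> by simp
  have "((\<lambda>x. of_real (poisson_kernel \<rho> x)) has_integral (1 :: complex)) {0..1}"
    using poisson_integral[of "\<lambda>_. 1" UNIV \<rho>] \<rho> by simp
  from has_integral_linear[OF this bounded_linear_Re]
  have hi: "(poisson_kernel \<rho> has_integral 1) {0..1}" by (simp add: o_def)
  have "(\<integral>\<^sup>+x. ennreal (poisson_kernel \<rho> x) * indicator {0..1} x \<partial>lborel) = ennreal 1"
    using poisson_kernel_nonneg[OF \<rho>'] hi by (rule nn_integral_has_integral_lebesgue')
  then show ?thesis
    by (subst nn_integral_restrict_space) (simp_all add: mult.commute)
qed

lemma lp_norm_measure_preserving:
  assumes T [measurable]: "T \<in> measurable M M" and TM: "distr M M T = M"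
    and u [measurable]: "u \<in> borel_measurable M"
  shows "lp_norm M p (\<lambda>x. u (T x)) = lp_norm M p u"
proof (cases "p = \<infinity>")
  case True
  have "lp_norm M p (\<lambda>x. u (T x)) \<le> c \<longleftrightarrow> lp_norm M p u \<le> c" for c
  proof -
    have "(AE x in M. u x \<le> c) \<longleftrightarrow> (AE x in distr M M T. u x \<le> c)"
      by (rule arg_cong[OF TM[symmetric], of "\<lambda>N. AE x in N. u x \<le> c"])
    also have "\<dots> \<longleftrightarrow> (AE x in M. u (T x) \<le> c)" by (rule AE_distr_iff) measurable
    finally show ?thesis
      unfolding True lp_norm_infty_le_iff[OF u] lp_norm_infty_le_iff[OF measurable_compose[OF T u]] ..
  qed
  then show ?thesis by (meson order.antisym order.refl)
next
  case False
  have "(\<integral>\<^sup>+x. ennpow (u x) (enn2real p) \<partial>M) = (\<integral>\<^sup>+x. ennpow (u x) (enn2real p) \<partial>distr M M T)"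
    by (simp add: TM)
  also have "\<dots> = (\<integral>\<^sup>+x. ennpow (u (T x)) (enn2real p) \<partial>M)"
    by (rule nn_integral_distr) measurable
  finally show ?thesis using False by (simp add: lp_norm_def)
qed

lemma int_mean_eq_lp_norm:
  "int_mean p r g = lp_norm sphere_measure p (\<lambda>\<zeta>. ennreal (norm (g (r *\<^sub>R \<zeta>))))"
  by (simp add: int_mean_def lp_norm_def ennpow_ennreal)

lemma borel_measurable_continuous_on_compose:
  assumes g: "continuous_on A g" and A: "A \<in> sets borel"
    and h: "h \<in> borel_measurable M" "\<And>x. x \<in> space M \<Longrightarrow> h x \<in> A"
  shows "(\<lambda>x. g (h x)) \<in> borel_measurable M"
proof -
  have "h \<in> measurable M (restrict_space borel A)"
    using h by (intro measurable_restrict_space2) auto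
  from measurable_compose[OF this borel_measurable_continuous_on_restrict[OF g]] show ?thesis .
qed

lemma borel_measurable_sphere_dilate:
  fixes g :: "complex ^ 'N \<Rightarrow> complex"
  assumes "continuous_on (ball 0 1) g" "norm c < 1"
  shows "(\<lambda>\<zeta>. g (c *s \<zeta>)) \<in> borel_measurable sphere_measure"
  using assms
  by (intro borel_measurable_continuous_on_compose[OF assms(1)] borel_measurable_on_sphere
      measurable_vector_scalar_mult) (auto simp: norm_vector_scalar_mult_complex)

lemma borel_measurable_sphere_path:
  fixes g :: "complex ^ 'N \<Rightarrow> complex"
  assumes "continuous_on (ball 0 1) g" and [measurable]: "\<gamma> \<in> borel_measurable \<mu>"
    and "\<And>x. x \<in> space \<mu> \<Longrightarrow> norm (\<gamma> x) < 1"
  shows "(\<lambda>(\<zeta>, x). g (\<gamma> x *s \<zeta>)) \<in> borel_measurable (sphere_measure \<Otimes>\<^sub>M \<mu>)"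
proof -
  have [measurable]: "(\<lambda>x. x) \<in> measurable (sphere_measure :: (complex ^ 'N) measure) borel"
    by (rule borel_measurable_on_sphere) simp
  have "(\<lambda>y. g (\<gamma> (snd y) *s fst y)) \<in> borel_measurable (sphere_measure \<Otimes>\<^sub>M \<mu>)"
    using assms(3)
    by (intro borel_measurable_continuous_on_compose[OF assms(1)])
      (auto simp: norm_vector_scalar_mult_complex space_pair_measure)
  then show ?thesis by (simp add: case_prod_beta)
qed

text \<open>
  By rotation invariance only the modulus of the scalar matters.
\<close>

lemma lp_norm_sphere_dilate:
  fixes g :: "complex ^ 'N \<Rightarrow> complex"
  assumes g: "continuous_on (ball 0 1) g" and c: "norm c < 1"
  shows "lp_norm sphere_measure p (\<lambda>\<zeta>. ennreal (norm (g (c *s \<zeta>)))) = int_mean p (norm c) g"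
proof -
  define b where "b = (if c = 0 then 1 else c / of_real (norm c))"
  have b: "norm b = 1" "c = of_real (norm c) * b"
    by (auto simp: b_def norm_divide)
  let ?T = "(*s) b :: complex ^ 'N \<Rightarrow> _"
  let ?u = "\<lambda>\<zeta>. ennreal (norm (g (of_real (norm c) *s \<zeta>)))"
  have "?T \<in> measurable sphere_measure sphere_measure"
    unfolding measurable_cong_sets[OF sets_sphere_measure sets_sphere_measure]
    by (rule measurable_restrict_space3) (auto simp: b norm_vector_scalar_mult_complex)
  then have "lp_norm sphere_measure p (\<lambda>\<zeta>. ?u (?T \<zeta>)) = lp_norm sphere_measure p ?u"
    using c by (intro lp_norm_measure_preserving distr_sphere_measure_rotate b measurable_compose[OF borel_measurable_sphere_dilate[OF g]])
      simp_all
  moreover have "?u (?T \<zeta>) = ennreal (norm (g (c *s \<zeta>)))" for \<zeta>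
    by (metis b(2) vector_smult_assoc)
  ultimately show ?thesis
    by (simp add: int_mean_eq_lp_norm scaleR_eq_vector_scalar_mult)
qed

lemma int_mean_finite:
  fixes g :: "complex ^ 'N \<Rightarrow> complex"
  assumes p: "1 \<le> p" and g: "continuous_on (ball 0 1) g" and r: "0 \<le> r" "r < 1"
  shows "int_mean p r g < \<infinity>"
proof -
  have "compact (g ` cball 0 r)"
    using r by (intro compact_continuous_image continuous_on_subset[OF g]) auto
  from compact_imp_bounded[OF this] obtain B where "\<forall>y\<in>g ` cball 0 r. norm y \<le> B"
    unfolding bounded_iff ..
  then have B: "norm (g z) \<le> B" if "z \<in> cball 0 r" for z using that by blast
  have "int_mean p r g \<le> lp_norm (sphere_measure :: (complex ^ 'N) measure) p (\<lambda>\<zeta>. ennreal B)"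
    unfolding int_mean_eq_lp_norm scaleR_eq_vector_scalar_mult
    using borel_measurable_sphere_dilate[OF g, of "of_real r"] r
    by (intro lp_norm_mono[OF p]) (auto intro!: ennreal_leI B simp: norm_vector_scalar_mult_complex)
  also have "\<dots> < \<infinity>"
    by (intro lp_norm_const_finite finite_measure_sphere_measure p) simp
  finally show ?thesis .
qed

text \<open>
  On each slice, Poisson's formula represents the value at the smaller radius as an average, for one
  and the same probability measure, of values on the circle of the larger radius. Minkowski's
  inequality then compares the means, as they do not change when \<open>g\<close> is composed with a rotation.
\<close>

lemma int_mean_mono:
  fixes g :: "complex ^ 'N \<Rightarrow> complex"
  assumes p: "1 \<le> p" and g: "slice_holomorphic g" and r: "0 < r'" "r' \<le> r" "r < 1"
  shows "int_mean p r' g \<le> int_mean p r g"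
proof (cases "r' = r")
  case False
  define \<rho> where "\<rho> = r' / r"
  have \<rho>: "0 \<le> \<rho>" "\<rho> < 1" "\<bar>\<rho>\<bar> < 1" "\<rho> * r = r'" using r False by (auto simp: \<rho>_def)
  have gc: "continuous_on (ball 0 1) g" using g by (simp add: slice_holomorphic_def)
  let ?L = "restrict_space lborel {0..1} :: real measure"
  let ?k = "\<lambda>x. ennreal (poisson_kernel \<rho> x)"
  define \<mu> where "\<mu> = density ?L ?k"
  have km [measurable]: "?k \<in> borel_measurable ?L"
    using continuous_on_poisson_kernel[OF \<rho>(3), of UNIV]
    by (intro measurable_restrict_space1 measurable_compose[OF _ measurable_ennreal])
      (simp add: borel_measurable_continuous_onI)
  have \<mu>1: "emeasure \<mu> (space \<mu>) = 1"
  proof -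
    have "emeasure \<mu> (space \<mu>) = (\<integral>\<^sup>+x. ?k x * indicator (space ?L) x \<partial>?L)"
      unfolding \<mu>_def space_density by (rule emeasure_density[OF km sets.top])
    also have "\<dots> = (\<integral>\<^sup>+x. ?k x \<partial>?L)" by (intro nn_integral_cong) simp
    finally show ?thesis by (simp add: nn_integral_poisson_kernel[OF \<rho>(1,2)])
  qed
  have fin: "finite_measure \<mu>" by standard (simp add: \<mu>1)
  obtain C where C: "int_mean p r g = ennreal C" "0 \<le> C"
    using int_mean_finite[OF p gc, of r] r by (cases "int_mean p r g") auto
  let ?u = "\<lambda>(\<zeta>, x). ennreal (norm (g ((of_real r * circle_point x) *s \<zeta>)))"
  have sets\<mu>: "sets \<mu> = sets ?L" by (simp add: \<mu>_def)
  have cm: "circle_point \<in> borel_measurable \<mu>"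
    unfolding measurable_cong_sets[OF sets\<mu> refl]
    by (intro measurable_restrict_space1) (simp add: borel_measurable_continuous_onI continuous_on_circle_point)
  have "(\<lambda>(\<zeta>, x). g ((of_real r * circle_point x) *s \<zeta>)) \<in> borel_measurable (sphere_measure \<Otimes>\<^sub>M \<mu>)"
    using r cm by (intro borel_measurable_sphere_path gc) (auto simp: norm_mult)
  then have um [measurable]: "?u \<in> borel_measurable (sphere_measure \<Otimes>\<^sub>M \<mu>)"
    by (simp add: case_prod_beta)
  have "int_mean p r' g \<le> lp_norm sphere_measure p (\<lambda>\<zeta>. \<integral>\<^sup>+x. ?u (\<zeta>, x) \<partial>\<mu>)"
    unfolding int_mean_eq_lp_norm scaleR_eq_vector_scalar_mult
  proof (rule lp_norm_mono[OF p])
    show "(\<lambda>\<zeta>. ennreal (norm (g (complex_of_real r' *s \<zeta>)))) \<in> borel_measurable sphere_measure"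
      using borel_measurable_sphere_dilate[OF gc, of "of_real r'"] r by simp
    fix \<zeta> :: "complex ^ 'N" assume "\<zeta> \<in> space sphere_measure"
    then have \<zeta>: "norm \<zeta> = 1" by simp
    let ?z = "complex_of_real r *s \<zeta>"
    have sub: "cball 0 1 \<subseteq> {c. c *s ?z \<in> ball 0 1}"
    proof safe
      fix c :: complex assume "c \<in> cball 0 1"
      then have "norm c * r \<le> 1 * r" using r by (intro mult_right_mono) auto
      then have "norm c * r < 1" using r by linarith
      then show "c *s ?z \<in> ball 0 1" using r \<zeta>
        by (simp add: norm_vector_scalar_mult_complex norm_mult)
    qed
    have hol: "(\<lambda>c. g (c *s ?z)) holomorphic_on {c. c *s ?z \<in> ball 0 1}"
      using g unfolding slice_holomorphic_def by blast
    from poisson_integral[OF hol sub \<rho>(1,2)]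
    have hi: "((\<lambda>x. g (circle_point x *s ?z) * of_real (poisson_kernel \<rho> x)) has_integral
        g (of_real \<rho> *s ?z)) {0..1}" .
    have "continuous_on {0..1} (\<lambda>x. g (circle_point x *s ?z))"
    proof (rule continuous_on_compose2[OF holomorphic_on_imp_continuous_on[OF hol]
          continuous_on_circle_point])
      show "circle_point ` {0..1} \<subseteq> {c. c *s ?z \<in> ball 0 1}"
        using sub by (rule order_trans[rotated]) auto
    qed
    then have "ennreal (norm (g (of_real \<rho> *s ?z)))
        \<le> (\<integral>\<^sup>+x. ennreal (norm (g (circle_point x *s ?z) * of_real (poisson_kernel \<rho> x))) \<partial>?L)"
      using \<rho>(3) by (intro norm_le_nn_integral_if_has_integral[OF _ hi] continuous_intros continuous_on_poisson_kernel)
    also have "\<dots> = (\<integral>\<^sup>+x. ?k x * ?u (\<zeta>, x) \<partial>?L)"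
      using poisson_kernel_nonneg[OF \<rho>(3)]
      by (intro nn_integral_cong) (simp add: norm_mult ennreal_mult vector_smult_assoc mult.commute)
    also have "\<dots> = (\<integral>\<^sup>+x. ?u (\<zeta>, x) \<partial>\<mu>)"
    proof -
      have "(\<lambda>x. ?u (\<zeta>, x)) \<in> borel_measurable \<mu>"
        using \<open>\<zeta> \<in> space sphere_measure\<close> by (intro measurable_compose[OF _ um]) simp
      then have "(\<lambda>x. ?u (\<zeta>, x)) \<in> borel_measurable ?L"
        by (simp only: measurable_cong_sets[OF sets\<mu> refl])
      then show ?thesis unfolding \<mu>_def by (intro nn_integral_density[symmetric] km)
    qed
    finally show "ennreal (norm (g (complex_of_real r' *s \<zeta>))) \<le> (\<integral>\<^sup>+x. ?u (\<zeta>, x) \<partial>\<mu>)"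
      using \<rho>(4) by (simp add: vector_smult_assoc of_real_mult[symmetric] del: of_real_mult)
  qed
  also have "\<dots> \<le> (\<integral>\<^sup>+x. ennreal C \<partial>\<mu>)"
  proof (rule lp_norm_integral_le[OF sigma_finite_sphere_measure fin p um])
    show "lp_norm sphere_measure p (\<lambda>\<zeta>. ?u (\<zeta>, x)) \<le> ennreal C" for x
      using lp_norm_sphere_dilate[OF gc, of "of_real r * circle_point x" p] r
      by (simp add: norm_mult C)
  qed (use C in auto)
  also have "\<dots> = int_mean p r g" by (simp add: \<mu>1 C)
  finally show ?thesis .
qed simp

section \<open>Radial and angular increments\<close>

text \<open>
  The mean over the sphere of radius \<open>exp (- x)\<close>. The value \<open>0\<close> for \<open>x \<le> 0\<close> makes the function
  measurable on the whole line without any assumption on \<open>g\<close> outside the open ball.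
\<close>

definition log_mean :: "ennreal \<Rightarrow> (complex ^ 'N \<Rightarrow> complex) \<Rightarrow> real \<Rightarrow> ennreal" where
  "log_mean p g x = (if 0 < x then int_mean p (exp (- x)) g else 0)"

lemma log_mean_finite:
  assumes "1 \<le> p" "slice_holomorphic g"
  shows "log_mean p g x < \<infinity>"
  using int_mean_finite[OF assms(1), of g "exp (- x)"] assms(2)
  by (simp add: log_mean_def slice_holomorphic_def)

lemma log_mean_antimono:
  assumes "1 \<le> p" "slice_holomorphic g" "0 < x" "x \<le> y"
  shows "log_mean p g y \<le> log_mean p g x"
  using int_mean_mono[OF assms(1,2), of "exp (- y)" "exp (- x)"] assms(3,4)
  by (simp add: log_mean_def)

lemma borel_measurable_log_mean:
  assumes "1 \<le> p" "slice_holomorphic g"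
  shows "log_mean p g \<in> borel_measurable borel"
proof -
  let ?f = "\<lambda>x. - enn2real (log_mean p g x)"
  have "mono_on {0<..} ?f"
    using log_mean_antimono[OF assms] log_mean_finite[OF assms]
    by (auto intro!: mono_onI enn2real_mono)
  then have "?f \<in> borel_measurable (restrict_space borel {0<..})"
    by (rule borel_measurable_mono_on_fnc)
  then have "(\<lambda>x. indicator {0<..} x *\<^sub>R ?f x) \<in> borel_measurable borel"
    by (subst (asm) borel_measurable_restrict_space_iff) simp_all
  then have "(\<lambda>x. ennreal (- (indicator {0<..} x *\<^sub>R ?f x))) \<in> borel_measurable borel"
    by measurable
  moreover have "log_mean p g = (\<lambda>x. ennreal (- (indicator {0<..} x *\<^sub>R ?f x)))"
  proof
    show "log_mean p g x = ennreal (- (indicator {0<..} x *\<^sub>R ?f x))" for x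
      using log_mean_finite[OF assms, of x] by (auto simp: indicator_def log_mean_def)
  qed
  ultimately show ?thesis by (simp only:)
qed

lemma finite_measure_restrict_lborel: "finite_measure (restrict_space lborel {a..b :: real})"
  by standard (simp add: emeasure_restrict_space space_restrict_space emeasure_lborel_Icc_eq)

text \<open>
  Integrate the Euler derivative along the segment from \<open>w\<close> in the direction \<open>d\<close>, in logarithmic
  coordinates. The direction \<open>- 1\<close> gives increments along a ray, the direction \<open>\<i>\<close> increments along a
  circle.
\<close>

lemma int_mean_increment_le:
  fixes g :: "complex ^ 'N \<Rightarrow> complex"
  assumes p: "1 \<le> p" and g: "slice_holomorphic g" and d: "norm d = 1" and t: "0 \<le> t"
    and neg: "\<And>s. s \<in> {0..t} \<Longrightarrow> Re (w + d * of_real s) < 0"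
  shows "lp_norm sphere_measure p
      (\<lambda>\<zeta>. ennreal (norm (g (exp (w + d * of_real t) *s \<zeta>) - g (exp w *s \<zeta>))))
    \<le> (\<integral>\<^sup>+s\<in>{0..t}. log_mean p (euler_deriv g) (- Re (w + d * of_real s)) \<partial>lborel)"
proof -
  let ?L = "restrict_space lborel {0..t} :: real measure"
  let ?\<gamma> = "\<lambda>s. exp (w + d * complex_of_real s)"
  let ?u = "\<lambda>(\<zeta>, s). ennreal (norm (euler_deriv g (?\<gamma> s *s \<zeta>)))"
  let ?m = "\<lambda>s. log_mean p (euler_deriv g) (- Re (w + d * of_real s))"
  have gc: "continuous_on (ball 0 1) g" and g': "slice_holomorphic (euler_deriv g)"
    and gc': "continuous_on (ball 0 1) (euler_deriv g)"
    using g slice_holomorphic_euler_deriv[OF g] by (simp_all add: slice_holomorphic_def)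
  have \<gamma>1: "norm (?\<gamma> s) < 1" if "s \<in> {0..t}" for s
    using neg[OF that] by simp
  have \<gamma>m: "?\<gamma> \<in> borel_measurable ?L"
    by (intro measurable_restrict_space1) (simp add: borel_measurable_continuous_onI continuous_intros)
  have mm: "?m \<in> borel_measurable borel"
    by (intro measurable_compose[OF _ borel_measurable_log_mean[OF p g']]
        borel_measurable_continuous_onI continuous_intros)
  have "(\<lambda>(\<zeta>, s). euler_deriv g (?\<gamma> s *s \<zeta>)) \<in> borel_measurable (sphere_measure \<Otimes>\<^sub>M ?L)"
    using \<gamma>1 by (intro borel_measurable_sphere_path gc' \<gamma>m) (simp add: space_restrict_space)
  then have um: "?u \<in> borel_measurable (sphere_measure \<Otimes>\<^sub>M ?L)"
    by (simp add: case_prod_beta)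
  have "lp_norm sphere_measure p (\<lambda>\<zeta>. ennreal (norm (g (?\<gamma> t *s \<zeta>) - g (exp w *s \<zeta>))))
      \<le> lp_norm sphere_measure p (\<lambda>\<zeta>. \<integral>\<^sup>+s. ?u (\<zeta>, s) \<partial>?L)"
  proof (rule lp_norm_mono[OF p])
    have "norm (exp w) < 1" using \<gamma>1[of 0] t by simp
    then show "(\<lambda>\<zeta>. ennreal (norm (g (?\<gamma> t *s \<zeta>) - g (exp w *s \<zeta>)))) \<in> borel_measurable sphere_measure"
      using borel_measurable_sphere_dilate[OF gc, of "?\<gamma> t"] borel_measurable_sphere_dilate[OF gc, of "exp w"] \<gamma>1[of t] t
      by simp
    fix \<zeta> :: "complex ^ 'N" assume "\<zeta> \<in> space sphere_measure"
    then have \<zeta>: "norm \<zeta> = 1" by simp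
    have inb: "?\<gamma> s *s \<zeta> \<in> ball 0 1" if "s \<in> {0..t}" for s
      using \<gamma>1[OF that] \<zeta> by (simp add: norm_vector_scalar_mult_complex)
    have der: "((\<lambda>s. g (?\<gamma> s *s \<zeta>)) has_vector_derivative d * euler_deriv g (?\<gamma> s *s \<zeta>)) (at s within {0..t})"
      if "s \<in> {0..t}" for s
    proof -
      have "((\<lambda>s. w + d * complex_of_real s) has_vector_derivative d) (at s within {0..t})"
        by (auto intro!: derivative_eq_intros simp: has_vector_derivative_def scaleR_conv_of_real mult.commute)
      from field_vector_diff_chain_within[OF this has_field_derivative_at_within[OF euler_deriv_exp[OF g inb[OF that]]]]
      show ?thesis by (simp add: o_def)
    qed
    have "((\<lambda>s. d * euler_deriv g (?\<gamma> s *s \<zeta>)) has_integral g (?\<gamma> t *s \<zeta>) - g (?\<gamma> 0 *s \<zeta>)) {0..t}"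
      using t der by (rule fundamental_theorem_of_calculus)
    moreover have "continuous_on {0..t} (\<lambda>s. d * euler_deriv g (?\<gamma> s *s \<zeta>))"
      using inb by (intro continuous_on_mult continuous_on_const continuous_on_compose2[OF gc'] continuous_on_vector_scalar_mult
          continuous_on_exp continuous_on_add continuous_on_of_real continuous_on_id) blast
    ultimately have "ennreal (norm (g (?\<gamma> t *s \<zeta>) - g (?\<gamma> 0 *s \<zeta>)))
        \<le> (\<integral>\<^sup>+s. ennreal (norm (d * euler_deriv g (?\<gamma> s *s \<zeta>))) \<partial>?L)"
      by (intro norm_le_nn_integral_if_has_integral)
    then show "ennreal (norm (g (?\<gamma> t *s \<zeta>) - g (exp w *s \<zeta>))) \<le> (\<integral>\<^sup>+s. ?u (\<zeta>, s) \<partial>?L)"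
      by (simp add: norm_mult d)
  qed
  also have "\<dots> \<le> (\<integral>\<^sup>+s. ennreal (enn2real (?m s)) \<partial>?L)"
  proof (rule lp_norm_integral_le[OF sigma_finite_sphere_measure finite_measure_restrict_lborel p um])
    show "(\<lambda>s. enn2real (?m s)) \<in> borel_measurable ?L"
      using mm by (intro measurable_restrict_space1) measurable
    show "lp_norm sphere_measure p (\<lambda>\<zeta>. ?u (\<zeta>, s)) \<le> ennreal (enn2real (?m s))" if "s \<in> space ?L" for s
    proof -
      have s: "s \<in> {0..t}" using that by (simp add: space_restrict_space)
      have "lp_norm sphere_measure p (\<lambda>\<zeta>. ?u (\<zeta>, s)) = int_mean p (norm (?\<gamma> s)) (euler_deriv g)"
        using lp_norm_sphere_dilate[OF gc' \<gamma>1[OF s]] by simp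
      also have "\<dots> = ?m s" using neg[OF s] by (simp add: log_mean_def add.commute)
      finally show ?thesis using log_mean_finite[OF p g'] by simp
    qed
  qed simp
  also have "\<dots> = (\<integral>\<^sup>+s. ?m s \<partial>?L)"
    using log_mean_finite[OF p g'] by simp
  also have "\<dots> = (\<integral>\<^sup>+s\<in>{0..t}. ?m s \<partial>lborel)"
    by (rule nn_integral_restrict_space) simp
  finally show ?thesis .
qed

lemma log_mean_eq_lp_norm:
  fixes g :: "complex ^ 'N \<Rightarrow> complex"
  assumes "0 < a"
  shows "log_mean p g a = lp_norm sphere_measure p (\<lambda>\<zeta>. ennreal (norm (g (exp (- of_real a) *s \<zeta>))))"
  using assms by (simp add: log_mean_def int_mean_eq_lp_norm scaleR_eq_vector_scalar_mult exp_of_real[symmetric])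

lemma log_mean_radial_increment_le:
  fixes g :: "complex ^ 'N \<Rightarrow> complex"
  assumes p: "1 \<le> p" and g: "slice_holomorphic g" and a: "0 < a" and t: "0 \<le> t"
  shows "lp_norm sphere_measure p (\<lambda>\<zeta>. ennreal (norm
      (g (exp (\<i> * of_real b - of_real (a + t)) *s \<zeta>) - g (exp (\<i> * of_real b - of_real a) *s \<zeta>))))
    \<le> (\<integral>\<^sup>+s\<in>{0..t}. log_mean p (euler_deriv g) (a + s) \<partial>lborel)"
proof -
  let ?w = "\<i> * complex_of_real b - of_real a"
  have *: "\<i> * of_real b - of_real (a + t) = ?w + (- 1) * of_real t"
    by (simp add: algebra_simps)
  show ?thesis unfolding * using int_mean_increment_le[OF p g _ t, of "- 1" ?w] a by (simp add: add.commute)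
qed

lemma log_mean_le_dilate_plus:
  fixes g :: "complex ^ 'N \<Rightarrow> complex"
  assumes p: "1 \<le> p" and g: "slice_holomorphic g" and a: "0 < a" and t: "0 \<le> t"
  shows "log_mean p g a \<le> log_mean p g (a + t)
      + (\<integral>\<^sup>+s\<in>{0..t}. log_mean p (euler_deriv g) (a + s) \<partial>lborel)"
proof -
  let ?e = "\<lambda>x. exp (- complex_of_real x)"
  have gc: "continuous_on (ball 0 1) g" using g by (simp add: slice_holomorphic_def)
  have m: "(\<lambda>\<zeta>. g (?e x *s \<zeta>)) \<in> borel_measurable sphere_measure" if "0 < x" for x
    using that by (intro borel_measurable_sphere_dilate gc) simp
  have at: "0 < a + t" using a t by simp
  note [measurable] = m[OF a] m[OF at]
  have "log_mean p g a \<le> lp_norm sphere_measure p (\<lambda>\<zeta>. ennreal (norm (g (?e (a + t) *s \<zeta>)))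
      + ennreal (norm (g (?e (a + t) *s \<zeta>) - g (?e a *s \<zeta>))))"
    unfolding log_mean_eq_lp_norm[OF a]
  proof (rule lp_norm_mono[OF p])
    fix \<zeta> :: "complex ^ 'N"
    show "ennreal (norm (g (?e a *s \<zeta>))) \<le> ennreal (norm (g (?e (a + t) *s \<zeta>)))
      + ennreal (norm (g (?e (a + t) *s \<zeta>) - g (?e a *s \<zeta>)))"
      using norm_triangle_ineq2[of "g (?e a *s \<zeta>)" "g (?e (a + t) *s \<zeta>)"]
      by (simp add: ennreal_plus[symmetric] norm_minus_commute ennreal_leI del: ennreal_plus)
  qed measurable
  also have "\<dots> \<le> lp_norm sphere_measure p (\<lambda>\<zeta>. ennreal (norm (g (?e (a + t) *s \<zeta>))))
      + lp_norm sphere_measure p (\<lambda>\<zeta>. ennreal (norm (g (?e (a + t) *s \<zeta>) - g (?e a *s \<zeta>))))"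
    by (intro lp_norm_add_le[OF sigma_finite_sphere_measure p]) measurable
  also have "\<dots> \<le> log_mean p g (a + t) + (\<integral>\<^sup>+s\<in>{0..t}. log_mean p (euler_deriv g) (a + s) \<partial>lborel)"
    unfolding log_mean_eq_lp_norm[OF at]
    using log_mean_radial_increment_le[OF p g a t, of 0] by (intro add_left_mono) simp
  finally show ?thesis .
qed

text \<open>
  The path goes inwards by \<open>t\<close>, turns by the angle \<open>t\<close> and comes back, all in logarithmic
  coordinates. Each of its three pieces contributes at most the integral on the right: for the arc,
  which lies at depth \<open>a + t\<close>, this is the monotonicity of the means.
\<close>

lemma log_mean_rot_diff_le:
  fixes g :: "complex ^ 'N \<Rightarrow> complex"
  assumes p: "1 \<le> p" and g: "slice_holomorphic g" and a: "0 < a" and t: "0 \<le> t"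
  shows "log_mean p (rot_diff t g) a \<le> 3 * (\<integral>\<^sup>+s\<in>{0..t}. log_mean p (euler_deriv g) (a + s) \<partial>lborel)"
proof -
  let ?I = "\<integral>\<^sup>+s\<in>{0..t}. log_mean p (euler_deriv g) (a + s) \<partial>lborel"
  let ?e = "\<lambda>b x. exp (\<i> * complex_of_real b - of_real x)"
  have gc: "continuous_on (ball 0 1) g" and g': "slice_holomorphic (euler_deriv g)"
    using g slice_holomorphic_euler_deriv[OF g] by (simp_all add: slice_holomorphic_def)
  have m: "(\<lambda>\<zeta>. g (?e b x *s \<zeta>)) \<in> borel_measurable sphere_measure" if "0 < x" for b x
    using that by (intro borel_measurable_sphere_dilate gc) simp
  have at: "0 < a + t" using a t by simp
  note [measurable] = m[OF a] m[OF at]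
  let ?D1 = "\<lambda>\<zeta>. ennreal (norm (g (?e t (a + t) *s \<zeta>) - g (?e t a *s \<zeta>)))"
  let ?D2 = "\<lambda>\<zeta>. ennreal (norm (g (?e t (a + t) *s \<zeta>) - g (?e 0 (a + t) *s \<zeta>)))"
  let ?D3 = "\<lambda>\<zeta>. ennreal (norm (g (?e 0 (a + t) *s \<zeta>) - g (?e 0 a *s \<zeta>)))"
  have "log_mean p (rot_diff t g) a \<le> lp_norm sphere_measure p (\<lambda>\<zeta>. ?D1 \<zeta> + (?D2 \<zeta> + ?D3 \<zeta>))"
    unfolding log_mean_eq_lp_norm[OF a]
  proof (rule lp_norm_mono[OF p])
    have eq: "rot_diff t g (exp (- of_real a) *s \<zeta>) = g (?e t a *s \<zeta>) - g (?e 0 a *s \<zeta>)" for \<zeta>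
      by (simp add: rot_diff_def vector_smult_assoc exp_diff exp_minus divide_inverse)
    show "(\<lambda>\<zeta>. ennreal (norm (rot_diff t g (exp (- of_real a) *s \<zeta>)))) \<in> borel_measurable sphere_measure"
      unfolding eq by measurable
    fix \<zeta> :: "complex ^ 'N"
    have "norm (x - y) \<le> norm (x' - x) + (norm (x' - y') + norm (y' - y))" for x y x' y' :: complex
      using norm_triangle_ineq[of "x - x'" "x' - y"] norm_triangle_ineq[of "x' - y'" "y' - y"]
      by (simp add: norm_minus_commute)
    then show "ennreal (norm (rot_diff t g (exp (- of_real a) *s \<zeta>))) \<le> ?D1 \<zeta> + (?D2 \<zeta> + ?D3 \<zeta>)"
      unfolding eq by (simp add: ennreal_plus[symmetric] ennreal_leI del: ennreal_plus)
  qed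
  also have "\<dots> \<le> lp_norm sphere_measure p ?D1 + lp_norm sphere_measure p (\<lambda>\<zeta>. ?D2 \<zeta> + ?D3 \<zeta>)"
    by (intro lp_norm_add_le[OF sigma_finite_sphere_measure p]) measurable
  also have "\<dots> \<le> lp_norm sphere_measure p ?D1 + (lp_norm sphere_measure p ?D2 + lp_norm sphere_measure p ?D3)"
    by (intro add_left_mono lp_norm_add_le[OF sigma_finite_sphere_measure p]) measurable
  also have "\<dots> \<le> ?I + (?I + ?I)"
  proof (intro add_mono)
    show "lp_norm sphere_measure p ?D1 \<le> ?I" "lp_norm sphere_measure p ?D3 \<le> ?I"
      by (rule log_mean_radial_increment_le[OF p g a t])+
    have "lp_norm sphere_measure p ?D2 \<le> (\<integral>\<^sup>+s\<in>{0..t}. log_mean p (euler_deriv g) (a + t) \<partial>lborel)"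
      using int_mean_increment_le[OF p g _ t, of \<i> "- of_real (a + t)"] at
      by (simp add: algebra_simps)
    also have "\<dots> \<le> ?I"
      using a t by (intro nn_integral_mono) (auto simp: indicator_def intro!: log_mean_antimono[OF p g'])
    finally show "lp_norm sphere_measure p ?D2 \<le> ?I" .
  qed
  also have "\<dots> = (1 + (1 + 1)) * ?I" by (simp only: distrib_right mult_1_left)
  also have "(1 + (1 + 1) :: ennreal) = 3" by simp
  finally show ?thesis .
qed

section \<open>Two integral inequalities on an interval\<close>

text \<open>
  Since \<open>H\<close> decreases, \<open>H (s + u)\<close> is at most the value of \<open>H\<close> at the larger of \<open>s\<close> and \<open>u\<close>. Integrating
  out the smaller variable costs a factor \<open>s\<close> where \<open>u \<le> s\<close>, and at most \<open>u ^ Suc k\<close> where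
  \<open>s \<le> u\<close>.
\<close>

lemma nn_integral_antimono_convolution_le:
  fixes H :: "real \<Rightarrow> ennreal"
  assumes [measurable]: "H \<in> borel_measurable borel"
    and anti: "\<And>x y. 0 \<le> x \<Longrightarrow> x \<le> y \<Longrightarrow> H y \<le> H x"
  shows "(\<integral>\<^sup>+s\<in>{0..t}. ennreal (s ^ k) * (\<integral>\<^sup>+u\<in>{0..t}. H (s + u) \<partial>lborel) \<partial>lborel)
    \<le> 2 * (\<integral>\<^sup>+s\<in>{0..t}. ennreal (s ^ Suc k) * H s \<partial>lborel)"
proof -
  let ?A = "\<lambda>s u. (ennreal (s ^ k) * H s * indicator {0..t} s) * indicator {0..s} u"
  let ?B = "\<lambda>s u. (H u * indicator {0..t} u) * (ennreal (s ^ k) * indicator {0..u} s)"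
  let ?I = "\<integral>\<^sup>+s\<in>{0..t}. ennreal (s ^ Suc k) * H s \<partial>lborel"
  have pw: "ennreal (s ^ k) * (H (s + u) * indicator {0..t} u) * indicator {0..t} s \<le> ?A s u + ?B s u" for s u
  proof (cases "s \<in> {0..t} \<and> u \<in> {0..t}")
    case True
    show ?thesis
    proof (cases "u \<le> s")
      case True
      then have "ennreal (s ^ k) * H (s + u) \<le> ?A s u"
        using \<open>s \<in> {0..t} \<and> u \<in> {0..t}\<close> by (auto intro!: mult_left_mono anti)
      then show ?thesis using \<open>s \<in> {0..t} \<and> u \<in> {0..t}\<close> by (auto intro: order_trans add_increasing2)
    next
      case False
      have "ennreal (s ^ k) * H (s + u) \<le> ennreal (s ^ k) * H u"
        using \<open>s \<in> {0..t} \<and> u \<in> {0..t}\<close> by (intro mult_left_mono anti) auto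
      also have "\<dots> = ?B s u"
        using False \<open>s \<in> {0..t} \<and> u \<in> {0..t}\<close> by (simp add: mult.commute)
      finally have "ennreal (s ^ k) * H (s + u) \<le> ?B s u" .
      then show ?thesis using \<open>s \<in> {0..t} \<and> u \<in> {0..t}\<close> by (auto intro: order_trans add_increasing)
    qed
  qed (auto simp: indicator_def)
  have [measurable]: "Measurable.pred (borel \<Otimes>\<^sub>M borel) (\<lambda>x::real \<times> real. snd x \<in> {0..fst x})"
    "Measurable.pred (borel \<Otimes>\<^sub>M borel) (\<lambda>x::real \<times> real. fst x \<in> {0..snd x})"
    by (simp_all only: atLeastAtMost_iff) measurable
  have A: "(\<integral>\<^sup>+s. (\<integral>\<^sup>+u. ?A s u \<partial>lborel) \<partial>lborel) = ?I"
  proof (rule nn_integral_cong)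
    fix s :: real
    show "(\<integral>\<^sup>+u. ?A s u \<partial>lborel) = ennreal (s ^ Suc k) * H s * indicator {0..t} s"
    proof -
      have "(\<integral>\<^sup>+u. ?A s u \<partial>lborel) = ennreal (s ^ k) * H s * indicator {0..t} s * emeasure lborel {0..s}"
        by (rule nn_integral_cmult_indicator) simp
      then show ?thesis by (cases "s \<in> {0..t}") (simp_all add: ennreal_mult mult_ac)
    qed
  qed
  have "(\<integral>\<^sup>+s. (\<integral>\<^sup>+u. ?B s u \<partial>lborel) \<partial>lborel) = (\<integral>\<^sup>+u. (\<integral>\<^sup>+s. ?B s u \<partial>lborel) \<partial>lborel)"
    by (rule lborel_pair.Fubini'[symmetric]) (unfold indicator_def, measurable)
  also have "\<dots> \<le> ?I"
  proof (rule nn_integral_mono)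
    fix u :: real
    have "(\<integral>\<^sup>+s. ennreal (s ^ k) * indicator {0..u} s \<partial>lborel) \<le> (\<integral>\<^sup>+s. ennreal (u ^ k) * indicator {0..u} s \<partial>lborel)"
      by (intro nn_integral_mono) (auto simp: indicator_def intro!: ennreal_leI power_mono)
    also have "\<dots> = ennreal (u ^ k) * ennreal (max 0 u)"
      by (simp add: nn_integral_cmult_indicator max_def)
    finally have "(H u * indicator {0..t} u) * (\<integral>\<^sup>+s. ennreal (s ^ k) * indicator {0..u} s \<partial>lborel)
        \<le> (H u * indicator {0..t} u) * (ennreal (u ^ k) * ennreal (max 0 u))"
      by (intro mult_left_mono) simp_all
    also have "\<dots> = ennreal (u ^ Suc k) * H u * indicator {0..t} u"
      by (auto simp: indicator_def ennreal_mult mult_ac)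
    finally show "(\<integral>\<^sup>+s. ?B s u \<partial>lborel) \<le> ennreal (u ^ Suc k) * H u * indicator {0..t} u"
      by (subst nn_integral_cmult) simp_all
  qed
  finally have B: "(\<integral>\<^sup>+s. (\<integral>\<^sup>+u. ?B s u \<partial>lborel) \<partial>lborel) \<le> ?I" .
  have "(\<integral>\<^sup>+s\<in>{0..t}. ennreal (s ^ k) * (\<integral>\<^sup>+u\<in>{0..t}. H (s + u) \<partial>lborel) \<partial>lborel)
      = (\<integral>\<^sup>+s. (\<integral>\<^sup>+u. ennreal (s ^ k) * (H (s + u) * indicator {0..t} u) * indicator {0..t} s \<partial>lborel) \<partial>lborel)"
    by (intro nn_integral_cong) (simp add: nn_integral_cmult nn_integral_multc)
  also have "\<dots> \<le> (\<integral>\<^sup>+s. (\<integral>\<^sup>+u. ?A s u + ?B s u \<partial>lborel) \<partial>lborel)"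
    by (intro nn_integral_mono pw)
  also have "\<dots> = (\<integral>\<^sup>+s. (\<integral>\<^sup>+u. ?A s u \<partial>lborel) \<partial>lborel) + (\<integral>\<^sup>+s. (\<integral>\<^sup>+u. ?B s u \<partial>lborel) \<partial>lborel)"
  proof -
    have [measurable]: "(\<lambda>(s, u). ?A s u) \<in> borel_measurable (borel \<Otimes>\<^sub>M borel)"
      "(\<lambda>(s, u). ?B s u) \<in> borel_measurable (borel \<Otimes>\<^sub>M borel)"
      by (unfold indicator_def, measurable)
    show ?thesis
      by (subst nn_integral_add[symmetric]) (auto intro!: nn_integral_cong nn_integral_add)
  qed
  also have "\<dots> \<le> ?I + ?I" using A B by (intro add_mono) auto
  finally show ?thesis by (simp add: mult_2)
qed

text \<open>
  Jensen's inequality for the weight \<open>\<alpha> (s / t)\<^sup>\<alpha> / s\<close>, whose integral over \<open>(0, t)\<close> is \<open>1\<close>.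
\<close>

lemma ennpow_hardy_average_le:
  fixes b :: "real \<Rightarrow> ennreal"
  assumes b [measurable]: "b \<in> borel_measurable borel" and q: "1 \<le> q" and \<alpha>: "0 < \<alpha>" and t: "0 < t"
  shows "ennpow (\<integral>\<^sup>+s\<in>{0..t}. ennreal ((s / t) powr \<alpha> / s) * b s \<partial>lborel) q
    \<le> (\<integral>\<^sup>+s\<in>{0..t}. ennpow (b s * ennreal (1 / \<alpha>)) q * ennreal (\<alpha> * (s / t) powr \<alpha> / s) \<partial>lborel)"
proof -
  let ?w = "\<lambda>s. ennreal (\<alpha> * (s / t) powr \<alpha> / s) * indicator {0..t} s"
  have eq: "\<alpha> / t powr \<alpha> * s powr (\<alpha> - 1) = \<alpha> * (s / t) powr \<alpha> / s" if "s \<in> {0..t}" for s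
    using that t by (cases "s = 0") (auto simp: powr_divide powr_diff field_simps)
  have "((\<lambda>s. s powr (\<alpha> - 1)) has_integral (t powr (\<alpha> - 1 + 1) / (\<alpha> - 1 + 1))) {0..t}"
    using \<alpha> t by (intro has_integral_powr_from_0) auto
  from has_integral_mult_right[OF this, of "\<alpha> / t powr \<alpha>"]
  have X: "((\<lambda>s. \<alpha> / t powr \<alpha> * s powr (\<alpha> - 1)) has_integral
      \<alpha> / t powr \<alpha> * (t powr (\<alpha> - 1 + 1) / (\<alpha> - 1 + 1))) {0..t}" .
  have "\<alpha> / t powr \<alpha> * (t powr (\<alpha> - 1 + 1) / (\<alpha> - 1 + 1)) = 1" using \<alpha> t by simp
  from has_integral_eq[OF eq X[unfolded this]]
  have "((\<lambda>s. \<alpha> * (s / t) powr \<alpha> / s) has_integral 1) {0..t}" .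
  then have w1: "(\<integral>\<^sup>+s. ?w s \<partial>lborel) = 1"
    using \<alpha> t nn_integral_has_integral_lebesgue'[of "{0..t}" "\<lambda>s. \<alpha> * (s / t) powr \<alpha> / s" 1] by simp
  have "(\<integral>\<^sup>+s\<in>{0..t}. ennreal ((s / t) powr \<alpha> / s) * b s \<partial>lborel) = (\<integral>\<^sup>+s. (b s * ennreal (1 / \<alpha>)) * ?w s \<partial>lborel)"
  proof (intro nn_integral_cong)
    fix s :: real
    have "ennreal (1 / \<alpha>) * ennreal (\<alpha> * (s / t) powr \<alpha> / s) = ennreal ((s / t) powr \<alpha> / s)" if "0 \<le> s"
      using that \<alpha> by (subst ennreal_mult[symmetric]) auto
    then show "ennreal ((s / t) powr \<alpha> / s) * b s * indicator {0..t} s = (b s * ennreal (1 / \<alpha>)) * ?w s"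
      by (cases "s \<in> {0..t}") (auto simp: mult_ac)
  qed
  then have "ennpow (\<integral>\<^sup>+s\<in>{0..t}. ennreal ((s / t) powr \<alpha> / s) * b s \<partial>lborel) q
      \<le> (\<integral>\<^sup>+s. ennpow (b s * ennreal (1 / \<alpha>)) q * ?w s \<partial>lborel)"
    using ennpow_nn_integral_le[OF _ _ w1 q, of "\<lambda>s. b s * ennreal (1 / \<alpha>)"] by simp
  then show ?thesis by (simp add: mult.assoc)
qed

text \<open>
  After Jensen's inequality, Fubini's theorem leaves for each \<open>s\<close> the integral of
  \<open>\<alpha> (s / t)\<^sup>\<alpha> / t\<close> over \<open>s \<le> t \<le> 1\<close>, which is \<open>1 - s\<^sup>\<alpha>\<close>.
\<close>

lemma hardy_inequality:
  fixes b :: "real \<Rightarrow> ennreal"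
  assumes b [measurable]: "b \<in> borel_measurable borel" and q: "1 \<le> q" and \<alpha>: "0 < \<alpha>"
  shows "(\<integral>\<^sup>+t\<in>{0<..<1}. ennpow (\<integral>\<^sup>+s\<in>{0..t}. ennreal ((s / t) powr \<alpha> / s) * b s \<partial>lborel) q
      * ennreal (1 / t) \<partial>lborel)
    \<le> ennreal ((1 / \<alpha>) powr q) * (\<integral>\<^sup>+s\<in>{0<..<1}. ennpow (b s) q * ennreal (1 / s) \<partial>lborel)"
proof -
  let ?B = "\<lambda>s. ennpow (b s * ennreal (1 / \<alpha>)) q"
  let ?K = "\<lambda>s t. ennreal (\<alpha> * (s / t) powr \<alpha> / s) * ennreal (1 / t) * indicator {0<..<1} t * (if 0 \<le> s \<and> s \<le> t then 1 else 0)"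
  have inner: "(\<integral>\<^sup>+t. ?K s t \<partial>lborel) \<le> ennreal (1 / s) * indicator {0<..<1} s" for s
  proof (cases "s \<in> {0<..<1}")
    case True
    have "(\<integral>\<^sup>+t. ?K s t \<partial>lborel) \<le> (\<integral>\<^sup>+t. ennreal (1 / s) * (ennreal (\<alpha> * (s / t) powr \<alpha> / t) * indicator {s..1} t) \<partial>lborel)"
      using True \<alpha> by (intro nn_integral_mono) (auto simp: indicator_def ennreal_mult[symmetric] mult_ac)
    also have "\<dots> = ennreal (1 / s) * (\<integral>\<^sup>+t. ennreal (\<alpha> * (s / t) powr \<alpha> / t) * indicator {s..1} t \<partial>lborel)"
      by (rule nn_integral_cmult) measurable
    also have "(\<integral>\<^sup>+t. ennreal (\<alpha> * (s / t) powr \<alpha> / t) * indicator {s..1} t \<partial>lborel)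
        = ennreal (- ((s / 1) powr \<alpha>) - - ((s / s) powr \<alpha>))"
    proof (rule nn_integral_FTC_Icc[where F = "\<lambda>t. - ((s / t) powr \<alpha>)"])
      fix t :: real assume "t \<in> {s..1}"
      then have t: "s \<le> t" "t \<le> 1" by simp_all
      have st: "0 < s / t" using True t by auto
      have "((\<lambda>t. s / t) has_real_derivative (- s / (t * t))) (at t)"
        using True t by (auto intro!: derivative_eq_intros)
      from DERIV_minus[OF DERIV_chain2[OF has_real_derivative_powr[OF st] this]]
      have "((\<lambda>t. - ((s / t) powr \<alpha>)) has_real_derivative - (\<alpha> * (s / t) powr (\<alpha> - 1) * (- s / (t * t)))) (at t)" .
      also have "- (\<alpha> * (s / t) powr (\<alpha> - 1) * (- s / (t * t))) = \<alpha> * (s / t) powr \<alpha> / t"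
      proof -
        have "s / t * (s / t) powr (\<alpha> - 1) = (s / t) powr \<alpha>"
          using powr_mult_base[of "s / t" "\<alpha> - 1"] st by simp
        then have "\<alpha> * (s / t) powr \<alpha> / t = \<alpha> * (s / t * (s / t) powr (\<alpha> - 1)) / t" by (simp only:)
        then show ?thesis by simp
      qed
      finally have "((\<lambda>t. - ((s / t) powr \<alpha>)) has_real_derivative \<alpha> * (s / t) powr \<alpha> / t) (at t)" .
      then show "((\<lambda>t. - ((s / t) powr \<alpha>)) has_real_derivative \<alpha> * (s / t) powr \<alpha> / t) (at t)" .
    qed (use True \<alpha> in auto)
    also have "\<dots> \<le> 1" using True by (intro ennreal_le_1[THEN iffD2]) simp
    finally show ?thesis using True by (simp add: mult_left_mono)
  next
    case False
    then have "?K s t = 0" for t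
      by (cases "s = 0") (auto simp: indicator_def)
    then show ?thesis by (simp only:) simp
  qed
  have Km [measurable]: "(\<lambda>(t, s). ?B s * ?K s t) \<in> borel_measurable (borel \<Otimes>\<^sub>M borel)"
    "(\<lambda>t. ?K s t) \<in> borel_measurable borel" for s
    by measurable
  have "(\<integral>\<^sup>+t\<in>{0<..<1}. ennpow (\<integral>\<^sup>+s\<in>{0..t}. ennreal ((s / t) powr \<alpha> / s) * b s \<partial>lborel) q
      * ennreal (1 / t) \<partial>lborel) \<le> (\<integral>\<^sup>+t. (\<integral>\<^sup>+s. ?B s * ?K s t \<partial>lborel) \<partial>lborel)"
  proof (rule nn_integral_mono)
    fix t :: real
    show "ennpow (\<integral>\<^sup>+s\<in>{0..t}. ennreal ((s / t) powr \<alpha> / s) * b s \<partial>lborel) q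
      * ennreal (1 / t) * indicator {0<..<1} t \<le> (\<integral>\<^sup>+s. ?B s * ?K s t \<partial>lborel)"
    proof (cases "t \<in> {0<..<1}")
      case True
      then have "ennpow (\<integral>\<^sup>+s\<in>{0..t}. ennreal ((s / t) powr \<alpha> / s) * b s \<partial>lborel) q * ennreal (1 / t)
        \<le> (\<integral>\<^sup>+s\<in>{0..t}. ?B s * ennreal (\<alpha> * (s / t) powr \<alpha> / s) \<partial>lborel) * ennreal (1 / t)"
        by (intro mult_right_mono ennpow_hardy_average_le b q \<alpha>) auto
      also have "\<dots> = (\<integral>\<^sup>+s. ?B s * ennreal (\<alpha> * (s / t) powr \<alpha> / s) * indicator {0..t} s * ennreal (1 / t) \<partial>lborel)"
        by (rule nn_integral_multc[symmetric]) measurable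
      also have "\<dots> = (\<integral>\<^sup>+s. ?B s * ?K s t \<partial>lborel)"
        using True by (intro nn_integral_cong) (auto simp: indicator_def mult_ac)
      finally show ?thesis using True by simp
    qed simp
  qed
  also have "\<dots> = (\<integral>\<^sup>+s. (\<integral>\<^sup>+t. ?B s * ?K s t \<partial>lborel) \<partial>lborel)"
    by (rule lborel_pair.Fubini'[symmetric]) simp
  also have "\<dots> = (\<integral>\<^sup>+s. ?B s * (\<integral>\<^sup>+t. ?K s t \<partial>lborel) \<partial>lborel)"
    by (intro nn_integral_cong nn_integral_cmult) simp
  also have "\<dots> \<le> (\<integral>\<^sup>+s. ?B s * (ennreal (1 / s) * indicator {0<..<1} s) \<partial>lborel)"
    by (intro nn_integral_mono mult_left_mono inner) simp
  also have "\<dots> = (\<integral>\<^sup>+s. ennreal ((1 / \<alpha>) powr q) * (ennpow (b s) q * ennreal (1 / s) * indicator {0<..<1} s) \<partial>lborel)"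
    using q \<alpha> by (intro nn_integral_cong) (simp add: ennpow_mult ennpow_ennreal mult_ac)
  also have "\<dots> = ennreal ((1 / \<alpha>) powr q) * (\<integral>\<^sup>+s\<in>{0<..<1}. ennpow (b s) q * ennreal (1 / s) \<partial>lborel)"
    by (rule nn_integral_cmult) measurable
  finally show ?thesis .
qed

section \<open>Iterated increments\<close>

lemma rot_diff_iter_Suc: "rot_diff_iter (Suc k) t g = rot_diff_iter k t (rot_diff t g)"
  by (simp add: rot_diff_iter_def funpow_Suc_right del: funpow.simps)

lemma slice_holomorphic_funpow_euler_deriv:
  "slice_holomorphic g \<Longrightarrow> slice_holomorphic ((euler_deriv ^^ k) g)"
  by (induction k) (simp_all add: slice_holomorphic_euler_deriv)

lemma funpow_euler_deriv_rot_diff: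
  fixes g :: "complex ^ 'N \<Rightarrow> complex"
  assumes g: "slice_holomorphic g" and z: "z \<in> ball 0 1"
  shows "(euler_deriv ^^ k) (rot_diff t g) z = rot_diff t ((euler_deriv ^^ k) g) z"
  using z
proof (induction k arbitrary: z)
  case (Suc k)
  have "(euler_deriv ^^ Suc k) (rot_diff t g) z = euler_deriv (rot_diff t ((euler_deriv ^^ k) g)) z"
    using euler_deriv_cong_ball[OF Suc.IH Suc.prems] by simp
  also have "\<dots> = rot_diff t ((euler_deriv ^^ Suc k) g) z"
    using euler_deriv_rot_diff[OF slice_holomorphic_funpow_euler_deriv[OF g] Suc.prems] by simp
  finally show ?case .
qed simp

lemma int_mean_cong_ball:
  fixes g h :: "complex ^ 'N \<Rightarrow> complex"
  assumes "\<And>z. z \<in> ball 0 1 \<Longrightarrow> g z = h z" "0 \<le> r" "r < 1"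
  shows "int_mean p r g = int_mean p r h"
  unfolding int_mean_eq_lp_norm using assms by (intro lp_norm_cong) simp

lemma log_mean_cong_ball:
  fixes g h :: "complex ^ 'N \<Rightarrow> complex"
  assumes "\<And>z. z \<in> ball 0 1 \<Longrightarrow> g z = h z"
  shows "log_mean p g x = log_mean p h x"
  using int_mean_cong_ball[of g h "exp (- x)" p] assms by (simp add: log_mean_def)

lemma nn_integral_log_mean_convolution_le:
  fixes g :: "complex ^ 'N \<Rightarrow> complex"
  assumes p: "1 \<le> p" and g: "slice_holomorphic g" and a: "0 < a"
  shows "(\<integral>\<^sup>+s\<in>{0..t}. ennreal (s ^ k) * (\<integral>\<^sup>+u\<in>{0..t}. log_mean p g (a + s + u) \<partial>lborel) \<partial>lborel)
    \<le> 2 * (\<integral>\<^sup>+s\<in>{0..t}. ennreal (s ^ Suc k) * log_mean p g (a + s) \<partial>lborel)"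
  using nn_integral_antimono_convolution_le[of "\<lambda>x. log_mean p g (a + x)" k t]
    borel_measurable_log_mean[OF p g] log_mean_antimono[OF p g] a
  by (simp add: add.assoc)

text \<open>
  Induction on the order of the difference. Peel off one difference, apply the induction hypothesis
  to it, move the Euler derivatives past it, and use the estimate for a single
  difference inside the integral. The double integral is then reduced to a single one, at the
  cost of a factor \<open>2\<close>; with the constant \<open>3\<close> of a single difference this makes \<open>6\<close> per step.
\<close>

lemma log_mean_rot_diff_iter_le:
  fixes g :: "complex ^ 'N \<Rightarrow> complex"
  assumes p: "1 \<le> p" and t: "0 \<le> t" and a: "0 < a" and g: "slice_holomorphic g"
  shows "log_mean p (rot_diff_iter (Suc k) t g) a
    \<le> 3 * 6 ^ k * (\<integral>\<^sup>+s\<in>{0..t}. ennreal (s ^ k) * log_mean p ((euler_deriv ^^ Suc k) g) (a + s) \<partial>lborel)"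
  using g
proof (induction k arbitrary: g)
  case 0
  then show ?case using log_mean_rot_diff_le[OF p 0 a t] by (simp add: rot_diff_iter_def)
next
  case (Suc k)
  define G where "G = (euler_deriv ^^ Suc k) g"
  have G: "slice_holomorphic G" unfolding G_def by (rule slice_holomorphic_funpow_euler_deriv[OF Suc.prems])
  have G': "slice_holomorphic (euler_deriv G)" by (rule slice_holomorphic_euler_deriv[OF G])
  note [measurable] = borel_measurable_log_mean[OF p G']
  have Jm: "(\<lambda>s. \<integral>\<^sup>+u\<in>{0..t}. log_mean p (euler_deriv G) (a + s + u) \<partial>lborel) \<in> borel_measurable borel"
  proof -
    have "(\<lambda>(s, u). log_mean p (euler_deriv G) (a + s + u) * indicator {0..t} u) \<in> borel_measurable (borel \<Otimes>\<^sub>M lborel)"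
      by measurable
    from lborel.borel_measurable_nn_integral[OF this] show ?thesis .
  qed
  have Km: "(\<lambda>s. ennreal (s ^ k) * (\<integral>\<^sup>+u\<in>{0..t}. log_mean p (euler_deriv G) (a + s + u) \<partial>lborel) * indicator {0..t} s) \<in> borel_measurable borel"
    by (intro borel_measurable_times_ennreal Jm) simp_all
  have "log_mean p (rot_diff_iter (Suc (Suc k)) t g) a
      \<le> 3 * 6 ^ k * (\<integral>\<^sup>+s\<in>{0..t}. ennreal (s ^ k) * log_mean p ((euler_deriv ^^ Suc k) (rot_diff t g)) (a + s) \<partial>lborel)"
    unfolding rot_diff_iter_Suc[of "Suc k"] by (rule Suc.IH[OF slice_holomorphic_rot_diff[OF Suc.prems]])
  also have "\<dots> \<le> 3 * 6 ^ k * (\<integral>\<^sup>+s. 3 * (ennreal (s ^ k) * (\<integral>\<^sup>+u\<in>{0..t}. log_mean p (euler_deriv G) (a + s + u) \<partial>lborel) * indicator {0..t} s) \<partial>lborel)"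
  proof (intro mult_left_mono nn_integral_mono)
    fix s :: real
    show "ennreal (s ^ k) * log_mean p ((euler_deriv ^^ Suc k) (rot_diff t g)) (a + s) * indicator {0..t} s
      \<le> 3 * (ennreal (s ^ k) * (\<integral>\<^sup>+u\<in>{0..t}. log_mean p (euler_deriv G) (a + s + u) \<partial>lborel) * indicator {0..t} s)"
    proof (cases "s \<in> {0..t}")
      case True
      have "log_mean p ((euler_deriv ^^ Suc k) (rot_diff t g)) (a + s) = log_mean p (rot_diff t G) (a + s)"
        unfolding G_def by (intro log_mean_cong_ball funpow_euler_deriv_rot_diff Suc.prems)
      also have "\<dots> \<le> 3 * (\<integral>\<^sup>+u\<in>{0..t}. log_mean p (euler_deriv G) (a + s + u) \<partial>lborel)"
        using True a by (intro log_mean_rot_diff_le p G t) simp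
      finally have "ennreal (s ^ k) * log_mean p ((euler_deriv ^^ Suc k) (rot_diff t g)) (a + s)
        \<le> ennreal (s ^ k) * (3 * (\<integral>\<^sup>+u\<in>{0..t}. log_mean p (euler_deriv G) (a + s + u) \<partial>lborel))"
        by (rule mult_left_mono) simp
      then show ?thesis using True by (simp add: mult.left_commute)
    qed simp
  qed simp_all
  also have "\<dots> = 3 * 6 ^ k * (3 * (\<integral>\<^sup>+s\<in>{0..t}. ennreal (s ^ k) * (\<integral>\<^sup>+u\<in>{0..t}. log_mean p (euler_deriv G) (a + s + u) \<partial>lborel) \<partial>lborel))"
    by (subst nn_integral_cmult, simp add: Km, rule refl)
  also have "\<dots> \<le> 3 * 6 ^ k * (3 * (2 * (\<integral>\<^sup>+s\<in>{0..t}. ennreal (s ^ Suc k) * log_mean p (euler_deriv G) (a + s) \<partial>lborel)))"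
    by (intro mult_left_mono nn_integral_log_mean_convolution_le p G' a) simp_all
  also have "\<dots> = 3 * 6 ^ k * (6 * (\<integral>\<^sup>+s\<in>{0..t}. ennreal (s ^ Suc k) * log_mean p (euler_deriv G) (a + s) \<partial>lborel))"
    by (simp add: mult.assoc[symmetric, of 3 2])
  finally show ?case by (simp add: mult_ac G_def)
qed

text \<open>
  The same iteration along rays. Each step compares a function with its dilation by \<open>exp (- 1)\<close>, whose
  mean is bounded independently of \<open>a\<close>.
\<close>

lemma log_mean_le_iterated:
  fixes g :: "complex ^ 'N \<Rightarrow> complex"
  assumes p: "1 \<le> p" and g: "slice_holomorphic g"
  shows "\<exists>K D. K < \<infinity> \<and> D < \<infinity> \<and> (\<forall>a>0. log_mean p g a
    \<le> K + D * (\<integral>\<^sup>+s\<in>{0..1}. ennreal (s ^ k) * log_mean p ((euler_deriv ^^ Suc k) g) (a + s) \<partial>lborel))"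
proof (induction k)
  case 0
  have "log_mean p g a \<le> log_mean p g 1
      + 1 * (\<integral>\<^sup>+s\<in>{0..1}. ennreal (s ^ 0) * log_mean p ((euler_deriv ^^ Suc 0) g) (a + s) \<partial>lborel)"
    if a: "0 < a" for a
    using log_mean_le_dilate_plus[OF p g a, of 1] log_mean_antimono[OF p g, of 1 "a + 1"] a
    by (simp add: order_trans[OF _ add_right_mono])
  then show ?case
    by (intro exI[of _ "log_mean p g 1"] exI[of _ 1] conjI allI impI log_mean_finite[OF p g]) simp_all
next
  case (Suc k)
  then obtain K D where KD: "K < \<infinity>" "D < \<infinity>" and le: "\<And>a. 0 < a \<Longrightarrow> log_mean p g a
    \<le> K + D * (\<integral>\<^sup>+s\<in>{0..1}. ennreal (s ^ k) * log_mean p ((euler_deriv ^^ Suc k) g) (a + s) \<partial>lborel)"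
    by blast
  define G where "G = (euler_deriv ^^ Suc k) g"
  have G: "slice_holomorphic G" unfolding G_def by (rule slice_holomorphic_funpow_euler_deriv[OF g])
  have G': "slice_holomorphic (euler_deriv G)" by (rule slice_holomorphic_euler_deriv[OF G])
  note [measurable] = borel_measurable_log_mean[OF p G']
  have Jm: "(\<lambda>s. \<integral>\<^sup>+u\<in>{0..1}. log_mean p (euler_deriv G) (a + s + u) \<partial>lborel) \<in> borel_measurable borel" for a
  proof -
    have "(\<lambda>(s, u). log_mean p (euler_deriv G) (a + s + u) * indicator {0..1} u) \<in> borel_measurable (borel \<Otimes>\<^sub>M lborel)"
      by measurable
    from lborel.borel_measurable_nn_integral[OF this] show ?thesis .
  qed
  have Km: "(\<lambda>s. ennreal (s ^ k) * (\<integral>\<^sup>+u\<in>{0..1}. log_mean p (euler_deriv G) (a + s + u) \<partial>lborel) * indicator {0..1} s) \<in> borel_measurable borel" for a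
    by (intro borel_measurable_times_ennreal Jm) simp_all
  let ?K1 = "log_mean p G 1"
  have K1: "?K1 < \<infinity>" by (rule log_mean_finite[OF p G])
  have bound: "log_mean p g a \<le> (K + D * ?K1) + (D * 2) *
      (\<integral>\<^sup>+s\<in>{0..1}. ennreal (s ^ Suc k) * log_mean p (euler_deriv G) (a + s) \<partial>lborel)"
    if a: "0 < a" for a
  proof -
    let ?J = "\<lambda>s. (\<integral>\<^sup>+u\<in>{0..1}. log_mean p (euler_deriv G) (a + s + u) \<partial>lborel)"
    have "(\<integral>\<^sup>+s\<in>{0..1}. ennreal (s ^ k) * log_mean p G (a + s) \<partial>lborel)
        \<le> (\<integral>\<^sup>+s. ?K1 * indicator {0..1} s + ennreal (s ^ k) * ?J s * indicator {0..1} s \<partial>lborel)"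
    proof (rule nn_integral_mono)
      fix s :: real
      show "ennreal (s ^ k) * log_mean p G (a + s) * indicator {0..1} s
        \<le> ?K1 * indicator {0..1} s + ennreal (s ^ k) * ?J s * indicator {0..1} s"
      proof (cases "s \<in> {0..1}")
        case True
        have "log_mean p G (a + s) \<le> log_mean p G (a + s + 1) + ?J s"
          using True a by (intro log_mean_le_dilate_plus p G) auto
        also have "\<dots> \<le> ?K1 + ?J s"
          using True a by (intro add_right_mono log_mean_antimono p G) auto
        finally have "ennreal (s ^ k) * log_mean p G (a + s) \<le> ennreal (s ^ k) * (?K1 + ?J s)"
          by (rule mult_left_mono) simp
        also have "\<dots> = ennreal (s ^ k) * ?K1 + ennreal (s ^ k) * ?J s" by (rule distrib_left)
        also have "ennreal (s ^ k) * ?K1 \<le> 1 * ?K1"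
          using True by (intro mult_right_mono) (simp_all add: power_le_one)
        finally show ?thesis using True by (simp add: add_right_mono)
      qed simp
    qed
    also have "\<dots> = ?K1 + (\<integral>\<^sup>+s\<in>{0..1}. ennreal (s ^ k) * ?J s \<partial>lborel)"
      by (subst nn_integral_add) (simp_all add: nn_integral_cmult_indicator Km)
    also have "\<dots> \<le> ?K1 + 2 * (\<integral>\<^sup>+s\<in>{0..1}. ennreal (s ^ Suc k) * log_mean p (euler_deriv G) (a + s) \<partial>lborel)"
      by (intro add_left_mono nn_integral_log_mean_convolution_le p G' a)
    finally have "K + D * (\<integral>\<^sup>+s\<in>{0..1}. ennreal (s ^ k) * log_mean p G (a + s) \<partial>lborel)
      \<le> K + D * (?K1 + 2 * (\<integral>\<^sup>+s\<in>{0..1}. ennreal (s ^ Suc k) * log_mean p (euler_deriv G) (a + s) \<partial>lborel))"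
      by (intro add_left_mono mult_left_mono) simp_all
    with le[OF a] show ?thesis unfolding G_def[symmetric]
      by (simp only: distrib_left mult.assoc add.assoc)
  qed
  have "K + D * ?K1 < \<infinity>" "D * 2 < \<infinity>"
    using KD K1 by (simp_all add: ennreal_mult_less_top)
  moreover have "(euler_deriv ^^ Suc (Suc k)) g = euler_deriv G" by (simp add: G_def)
  ultimately show ?case
    using bound by (intro exI[of _ "K + D * ?K1"] exI[of _ "D * 2"]) simp
qed

section \<open>The homogeneous expansion\<close>

text \<open>
  The Taylor coefficients of a slice at its centre, as functions of the point \<open>z\<close> that spans it. They turn
  out to be the terms of the homogeneous expansion.
\<close>

definition slice_coeff :: "(complex ^ 'N \<Rightarrow> complex) \<Rightarrow> nat \<Rightarrow> complex ^ 'N \<Rightarrow> complex" where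
  "slice_coeff f k z = (deriv ^^ k) (\<lambda>c. f (c *s z)) 0 / fact k"

text \<open>
  The slice of the ball is itself a disc, or the whole plane when \<open>z = 0\<close>.
\<close>

lemma slice_domain_ball:
  fixes z :: "complex ^ 'N"
  assumes c: "c *s z \<in> ball 0 1"
  shows "\<exists>r. c \<in> ball 0 r \<and> ball 0 r \<subseteq> {c. c *s z \<in> ball 0 1}"
proof -
  let ?r = "if z = 0 then norm c + 1 else 1 / norm z"
  have "c \<in> ball 0 ?r"
    using c by (auto simp: norm_vector_scalar_mult_complex field_simps)
  moreover have "ball 0 ?r \<subseteq> {c. c *s z \<in> ball 0 1}"
    by (auto simp: norm_vector_scalar_mult_complex field_simps)
  ultimately show ?thesis by (intro exI[of _ ?r] conjI)
qed

lemma slice_coeff_sums: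
  fixes f :: "complex ^ 'N \<Rightarrow> complex"
  assumes f: "slice_holomorphic f" and c: "c *s z \<in> ball 0 1"
  shows "(\<lambda>k. slice_coeff f k z * c ^ k) sums f (c *s z)"
proof -
  obtain r where "c \<in> ball 0 r" and sub: "ball 0 r \<subseteq> {c. c *s z \<in> ball 0 1}"
    using slice_domain_ball[OF c] by blast
  have "(\<lambda>c. f (c *s z)) holomorphic_on {c. c *s z \<in> ball 0 1}"
    using f unfolding slice_holomorphic_def by simp
  then have "(\<lambda>c. f (c *s z)) holomorphic_on ball 0 r"
    using sub by (rule holomorphic_on_subset)
  then show ?thesis
    using holomorphic_power_series[of "\<lambda>c. f (c *s z)" 0 r c] \<open>c \<in> ball 0 r\<close>
    by (simp add: slice_coeff_def)
qed

lemma slice_coeff_unique: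
  fixes f :: "complex ^ 'N \<Rightarrow> complex"
  assumes "\<And>c. c *s z \<in> ball 0 1 \<Longrightarrow> (\<lambda>k. a k * c ^ k) sums f (c *s z)"
  shows "a k = slice_coeff f k z"
proof -
  have "\<forall>\<^sub>F c in nhds 0. c \<in> {c. c *s z \<in> ball 0 1}"
    by (intro eventually_nhds_in_open open_slice_domain) simp
  then have "\<forall>\<^sub>F c in nhds 0. (\<lambda>k. fps_nth (Abs_fps a) k * c ^ k) sums f (c *s z)"
    by eventually_elim (use assms in simp)
  then have "(\<lambda>c. f (c *s z)) has_fps_expansion Abs_fps a"
    by (rule has_fps_expansionI)
  from fps_nth_fps_expansion[OF this, of k] show ?thesis
    by (simp add: slice_coeff_def)
qed

lemma slice_coeff_scale:
  fixes f :: "complex ^ 'N \<Rightarrow> complex"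
  assumes f: "slice_holomorphic f"
  shows "slice_coeff f k (b *s z) = b ^ k * slice_coeff f k z"
proof -
  have "slice_coeff f k z * b ^ k = slice_coeff f k (b *s z)"
  proof (rule slice_coeff_unique)
    fix c assume "c *s (b *s z) \<in> ball 0 1"
    then have "(\<lambda>k. slice_coeff f k z * (c * b) ^ k) sums f ((c * b) *s z)"
      by (intro slice_coeff_sums f) (simp add: vector_smult_assoc)
    then show "(\<lambda>k. slice_coeff f k z * b ^ k * c ^ k) sums f (c *s (b *s z))"
      by (simp add: power_mult_distrib vector_smult_assoc mult_ac)
  qed
  then show ?thesis by (simp add: mult.commute)
qed

text \<open>
  Cauchy's inequality on the unit circle of the slice through \<open>z\<close>.
\<close>

lemma norm_slice_coeff_le:
  fixes f :: "complex ^ 'N \<Rightarrow> complex"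
  assumes f: "slice_holomorphic f" and z: "norm z < 1"
    and B: "\<And>w. norm w = norm z \<Longrightarrow> norm (f w) \<le> B"
  shows "norm (slice_coeff f k z) \<le> B"
proof -
  let ?S = "{c. c *s z \<in> ball 0 1}"
  have hol: "(\<lambda>c. f (c *s z)) holomorphic_on ?S"
    using f unfolding slice_holomorphic_def by simp
  have sub: "cball 0 1 \<subseteq> ?S"
  proof
    fix c :: complex assume "c \<in> cball 0 1"
    then have "norm c * norm z \<le> 1 * norm z" by (intro mult_right_mono) auto
    also have "\<dots> < 1" using z by simp
    finally show "c \<in> ?S" by (simp add: norm_vector_scalar_mult_complex)
  qed
  have "norm ((deriv ^^ k) (\<lambda>c. f (c *s z)) 0) \<le> fact k * B / 1 ^ k"
  proof (rule Cauchy_inequality)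
    show "(\<lambda>c. f (c *s z)) holomorphic_on ball 0 1"
      using hol sub by (meson ball_subset_cball holomorphic_on_subset order_trans)
    show "continuous_on (cball 0 1) (\<lambda>c. f (c *s z))"
      using hol sub by (meson holomorphic_on_imp_continuous_on holomorphic_on_subset)
    show "norm (f (c *s z)) \<le> B" if "norm (0 - c) = 1" for c
      using that by (intro B) (simp add: norm_vector_scalar_mult_complex)
  qed simp
  then show ?thesis by (simp add: slice_coeff_def norm_divide field_simps)
qed

lemma slice_coeff_euler_deriv:
  fixes f :: "complex ^ 'N \<Rightarrow> complex"
  assumes f: "slice_holomorphic f"
  shows "slice_coeff (euler_deriv f) k z = of_nat k * slice_coeff f k z"
proof -
  let ?S = "{c. c *s z \<in> ball 0 1}"
  have hol: "(\<lambda>c. f (c *s z)) holomorphic_on ?S"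
    using f unfolding slice_holomorphic_def by simp
  have "of_nat k * slice_coeff f k z = slice_coeff (euler_deriv f) k z"
  proof (rule slice_coeff_unique)
    fix c assume c: "c *s z \<in> ball 0 1"
    obtain r where cr: "c \<in> ball 0 r" and sub: "ball 0 r \<subseteq> ?S"
      using slice_domain_ball[OF c] by blast
    have "(deriv (\<lambda>c. f (c *s z))) holomorphic_on ball 0 r"
      using hol sub by (intro holomorphic_deriv) (auto intro: holomorphic_on_subset)
    from holomorphic_power_series[OF this cr]
    have "(\<lambda>n. (deriv ^^ Suc n) (\<lambda>c. f (c *s z)) 0 / fact n * c ^ n) sums deriv (\<lambda>c. f (c *s z)) c"
      by (simp add: funpow_Suc_right del: funpow.simps)
    then have "(\<lambda>n. c * ((deriv ^^ Suc n) (\<lambda>c. f (c *s z)) 0 / fact n * c ^ n)) sums (c * deriv (\<lambda>c. f (c *s z)) c)"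
      by (rule sums_mult)
    moreover have "c * ((deriv ^^ Suc n) (\<lambda>c. f (c *s z)) 0 / fact n * c ^ n)
        = of_nat (Suc n) * slice_coeff f (Suc n) z * c ^ Suc n" for n
      by (simp add: slice_coeff_def del: funpow.simps of_nat_Suc)
    ultimately have "(\<lambda>n. of_nat (Suc n) * slice_coeff f (Suc n) z * c ^ Suc n) sums (c * deriv (\<lambda>c. f (c *s z)) c)"
      by (simp only:)
    from sums_Suc[OF this] show "(\<lambda>k. of_nat k * slice_coeff f k z * c ^ k) sums euler_deriv f (c *s z)"
      using euler_deriv_scale[OF f c] by simp
  qed
  then show ?thesis by simp
qed

lemma funpow_euler_deriv_sums:
  fixes f :: "complex ^ 'N \<Rightarrow> complex"
  assumes f: "slice_holomorphic f" and z: "z \<in> ball 0 1"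
  shows "(\<lambda>k. of_nat k ^ n * slice_coeff f k z) sums (euler_deriv ^^ n) f z"
proof -
  note sh = slice_holomorphic_funpow_euler_deriv[OF f]
  have "slice_coeff ((euler_deriv ^^ n) f) k z = of_nat k ^ n * slice_coeff f k z" for k
    by (induction n) (simp_all add: slice_coeff_euler_deriv[OF sh])
  then show ?thesis using slice_coeff_sums[OF sh, of 1 z n] z by simp
qed

text \<open>
  The \<open>k\<close>-th coefficient is the limit, as \<open>x\<close> tends to \<open>0\<close>, of the remainder of order \<open>k\<close> divided by
  \<open>x ^ k\<close>. The error is a tail of the power series, dominated by a geometric series, and hence is
  uniform on compact subsets of the ball.
\<close>

lemma slice_coeff_remainder_le:
  fixes f :: "complex ^ 'N \<Rightarrow> complex"
  assumes f: "slice_holomorphic f" and z: "norm z < 1"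
    and B: "\<And>w. norm w = norm z \<Longrightarrow> norm (f w) \<le> B" and x: "0 < x" "x \<le> 1 / 2"
  shows "norm ((f (of_real x *s z) - (\<Sum>j<k. slice_coeff f j z * of_real x ^ j)) / of_real x ^ k - slice_coeff f k z) \<le> 2 * B * x"
proof -
  let ?T = "\<lambda>j. slice_coeff f j z"
  let ?x = "complex_of_real x"
  have "x * norm z \<le> 1 * norm z" using x by (intro mult_right_mono) auto
  then have "x * norm z < 1" using z by simp
  then have "(\<lambda>j. ?T j * ?x ^ j) sums f (?x *s z)"
    using x by (intro slice_coeff_sums f) (simp add: norm_vector_scalar_mult_complex)
  from sums_split_initial_segment[OF this, of "Suc k"]
  have 1: "(\<lambda>i. ?T (i + Suc k) * ?x ^ (i + Suc k)) sums (f (?x *s z) - (\<Sum>j<Suc k. ?T j * ?x ^ j))" .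
  have "(\<lambda>i. B * x ^ Suc k * x ^ i) sums (B * x ^ Suc k * (1 / (1 - x)))"
    using x by (intro sums_mult geometric_sums) simp
  moreover have "norm (?T (i + Suc k) * ?x ^ (i + Suc k)) \<le> B * x ^ Suc k * x ^ i" for i
  proof -
    have "norm (?T (i + Suc k)) * x ^ (i + Suc k) \<le> B * x ^ (i + Suc k)"
      using x by (intro mult_right_mono norm_slice_coeff_le f z B) auto
    then show ?thesis using x by (simp add: norm_mult norm_power power_add mult_ac)
  qed
  ultimately have 2: "norm (f (?x *s z) - (\<Sum>j<Suc k. ?T j * ?x ^ j)) \<le> B * x ^ Suc k * (1 / (1 - x))"
    by (rule norm_sums_le[OF 1])
  have B0: "0 \<le> B" using B[of z] norm_ge_zero order_trans by blast
  have "(f (?x *s z) - (\<Sum>j<k. ?T j * ?x ^ j)) / ?x ^ k - ?T k = (f (?x *s z) - (\<Sum>j<Suc k. ?T j * ?x ^ j)) / ?x ^ k"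
    using x by (simp add: diff_divide_distrib add_divide_distrib)
  also have "norm \<dots> = norm (f (?x *s z) - (\<Sum>j<Suc k. ?T j * ?x ^ j)) / x ^ k"
    using x(1) by (simp only: norm_divide norm_power norm_of_real abs_of_pos)
  also have "\<dots> \<le> (B * x ^ Suc k * (1 / (1 - x))) / x ^ k"
    using x(1) by (intro divide_right_mono 2) simp
  also have "\<dots> = B * x * (1 / (1 - x))" using x by simp
  also have "\<dots> \<le> B * x * 2"
    using x B0 by (intro mult_left_mono) (auto simp: field_simps)
  finally show ?thesis by (simp add: mult_ac)
qed

text \<open>
  The coefficient of degree \<open>k\<close> is a locally uniform limit of functions built from \<open>f\<close> and the
  coefficients of lower degree, all holomorphic on the line by induction.
\<close>

lemma slice_coeff_line_holomorphic:
  fixes f :: "complex ^ 'N \<Rightarrow> complex"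
  assumes f: "f \<in> hol_ball"
  shows "(\<lambda>c. slice_coeff f k (z + c *s w)) holomorphic_on {c. z + c *s w \<in> ball 0 1}"
proof (induction k rule: less_induct)
  case (less k)
  let ?S = "{c. z + c *s w \<in> ball 0 1}"
  have sh: "slice_holomorphic f" by (rule slice_holomorphic_if_hol_ball[OF f])
  \<comment> \<open>Any null sequence in \<open>(0, 1/2]\<close> would do.\<close>
  define x where "x n = 1 / (real n + 2)" for n :: nat
  have x: "0 < x n" "x n \<le> 1 / 2" for n by (auto simp: x_def field_simps)
  have "x = (\<lambda>n. inverse (real (Suc (Suc n))))"
    by (simp add: x_def fun_eq_iff inverse_eq_divide)
  then have x0: "x \<longlonglongrightarrow> 0"
    using LIMSEQ_Suc[OF LIMSEQ_inverse_real_of_nat] by simp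
  define F where "F n c = (f (of_real (x n) *s (z + c *s w))
      - (\<Sum>j<k. slice_coeff f j (z + c *s w) * of_real (x n) ^ j)) / of_real (x n) ^ k" for n c
  show ?case
  proof (rule holomorphic_uniform_sequence[OF open_line_domain, where f = F])
    fix n
    let ?x = "complex_of_real (x n)"
    have "(\<lambda>c. f (?x *s z + c *s (?x *s w))) holomorphic_on {c. ?x *s z + c *s (?x *s w) \<in> ball 0 1}"
      by (rule hol_ball_line[OF f])
    moreover have eq: "?x *s z + c *s (?x *s w) = ?x *s (z + c *s w)" for c
      by (simp add: vec_eq_iff algebra_simps)
    moreover have "?S \<subseteq> {c. ?x *s (z + c *s w) \<in> ball 0 1}"
    proof
      fix c assume "c \<in> ?S"
      then have "norm (z + c *s w) < 1" by simp
      moreover have "x n * norm (z + c *s w) \<le> 1 * norm (z + c *s w)"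
        using x[of n] by (intro mult_right_mono) auto
      ultimately have "x n * norm (z + c *s w) < 1" by linarith
      then show "c \<in> {c. ?x *s (z + c *s w) \<in> ball 0 1}"
        unfolding mem_Collect_eq mem_ball_0 norm_vector_scalar_mult_complex using x(1)[of n] by simp
    qed
    ultimately have "(\<lambda>c. f (?x *s (z + c *s w))) holomorphic_on ?S"
      by (simp only: eq) (rule holomorphic_on_subset)
    then show "F n holomorphic_on ?S"
      unfolding F_def using x(1)[of n] by (intro holomorphic_intros less.IH) auto
  next
    fix a assume a: "a \<in> ?S"
    define R where "R = (norm (z + a *s w) + 1) / 2"
    have R: "norm (z + a *s w) < R" "R < 1" using a by (auto simp: R_def)
    define d where "d = (R - norm (z + a *s w)) / (norm w + 1)"
    have d: "0 < d" using R by (simp add: d_def add_nonneg_pos)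
    have inR: "norm (z + c *s w) \<le> R" if "c \<in> cball a d" for c
    proof -
      have eq: "z + c *s w = (z + a *s w) + (c - a) *s w" by (simp add: vec_eq_iff algebra_simps)
      have "norm (z + c *s w) \<le> norm (z + a *s w) + norm ((c - a) *s w)"
        unfolding eq by (rule norm_triangle_ineq)
      also have "norm ((c - a) *s w) = norm (c - a) * norm w" by (rule norm_vector_scalar_mult_complex)
      also have "norm (c - a) * norm w \<le> d * (norm w + 1)"
        using that d by (intro mult_mono) (auto simp: dist_norm norm_minus_commute)
      also have "d * (norm w + 1) = R - norm (z + a *s w)"
        using add_nonneg_pos[OF norm_ge_zero[of w] zero_less_one] by (simp add: d_def)
      finally show ?thesis by simp
    qed
    have "compact (f ` cball 0 R)"
      using sh R by (intro compact_continuous_image) (auto simp: slice_holomorphic_def intro: continuous_on_subset)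
    from compact_imp_bounded[OF this] obtain B where "\<forall>y\<in>f ` cball 0 R. norm y \<le> B"
      unfolding bounded_iff ..
    then have B: "norm (f u) \<le> B" if "norm u \<le> R" for u using that by simp
    have "uniform_limit (cball a d) F (\<lambda>c. slice_coeff f k (z + c *s w)) sequentially"
    proof (rule uniform_limitI)
      fix e :: real assume e: "0 < e"
      have "(\<lambda>n. 2 * B * x n) \<longlonglongrightarrow> 2 * B * 0" by (intro tendsto_intros x0)
      then have "(\<lambda>n. 2 * B * x n) \<longlonglongrightarrow> 0" by simp
      from order_tendstoD(2)[OF this e]
      show "\<forall>\<^sub>F n in sequentially. \<forall>c\<in>cball a d. dist (F n c) (slice_coeff f k (z + c *s w)) < e"
      proof eventually_elim
        case (elim n)
        show ?case
        proof
          fix c assume c: "c \<in> cball a d"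
          have "dist (F n c) (slice_coeff f k (z + c *s w)) \<le> 2 * B * x n"
            unfolding F_def dist_norm
            using inR[OF c] R by (intro slice_coeff_remainder_le sh x B) auto
          with elim show "dist (F n c) (slice_coeff f k (z + c *s w)) < e" by simp
        qed
      qed
    qed
    moreover have "cball a d \<subseteq> ?S" using inR R by fastforce
    ultimately show "\<exists>d>0. cball a d \<subseteq> ?S \<and> uniform_limit (cball a d) F (\<lambda>c. slice_coeff f k (z + c *s w)) sequentially"
      using d by blast
  qed
qed

text \<open>
  Homogeneity transports any point of the line into the ball.
\<close>

lemma slice_coeff_line_entire:
  fixes f :: "complex ^ 'N \<Rightarrow> complex"
  assumes f: "f \<in> hol_ball"
  shows "(\<lambda>c. slice_coeff f k (z + c *s w)) holomorphic_on UNIV"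
proof (rule holomorphic_onI)
  fix a :: complex
  have sh: "slice_holomorphic f" by (rule slice_holomorphic_if_hol_ball[OF f])
  define r where "r = 1 / (norm (z + a *s w) + 1)"
  have P: "0 < norm (z + a *s w) + 1" by (simp add: add_nonneg_pos)
  have r: "0 < r" using P by (simp add: r_def)
  let ?S = "{c. of_real r *s z + c *s (of_real r *s w) \<in> ball 0 1}"
  have eq: "of_real r *s z + c *s (of_real r *s w) = of_real r *s (z + c *s w)" for c
    by (simp add: vec_eq_iff algebra_simps)
  have "r * norm (z + a *s w) < 1" using P by (simp add: r_def field_simps)
  then have "a \<in> ?S" unfolding eq mem_Collect_eq mem_ball_0 norm_vector_scalar_mult_complex
    using r by simp
  then have "(\<lambda>c. slice_coeff f k (of_real r *s z + c *s (of_real r *s w))) field_differentiable at a"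
    using slice_coeff_line_holomorphic[OF f, of k "of_real r *s z" "of_real r *s w"] open_line_domain
    by (metis holomorphic_on_imp_differentiable_at)
  then have "(\<lambda>c. of_real r ^ k * slice_coeff f k (z + c *s w)) field_differentiable at a"
    by (simp only: eq slice_coeff_scale[OF sh])
  then have "(\<lambda>c. inverse (of_real r ^ k) * (of_real r ^ k * slice_coeff f k (z + c *s w))) field_differentiable at a"
    by (rule field_differentiable_mult[OF field_differentiable_const])
  moreover have "(\<lambda>c. inverse (of_real r ^ k) * (of_real r ^ k * slice_coeff f k (z + c *s w)))
      = (\<lambda>c. slice_coeff f k (z + c *s w))"
    using r by (simp add: fun_eq_iff)
  ultimately have "(\<lambda>c. slice_coeff f k (z + c *s w)) field_differentiable at a"
    by (simp only:)
  then show "(\<lambda>c. slice_coeff f k (z + c *s w)) field_differentiable at a within UNIV"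
    by simp
qed

text \<open>
  Homogeneity also gives growth of order \<open>k\<close>, so Liouville's theorem for functions of polynomial
  growth applies.
\<close>

lemma slice_coeff_line_poly:
  fixes f :: "complex ^ 'N \<Rightarrow> complex"
  assumes f: "f \<in> hol_ball"
  shows "\<exists>q. degree q \<le> k \<and> (\<forall>c. slice_coeff f k (z + c *s w) = poly q c)"
proof -
  have sh: "slice_holomorphic f" by (rule slice_holomorphic_if_hol_ball[OF f])
  have "compact (f ` cball 0 (1/2))"
    using sh by (intro compact_continuous_image) (auto simp: slice_holomorphic_def intro: continuous_on_subset)
  from compact_imp_bounded[OF this] obtain B where "\<forall>y\<in>f ` cball 0 (1/2). norm y \<le> B"
    unfolding bounded_iff ..
  then have B: "norm (f u) \<le> B" if "norm u \<le> 1/2" for u using that by simp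
  have B0: "0 \<le> B" using order_trans[OF norm_ge_zero B[of 0]] by simp
  have growth: "norm (slice_coeff f k u) \<le> (2 * s) ^ k * B" if "norm u \<le> s" "0 < s" for u s
  proof -
    let ?v = "complex_of_real (1 / (2 * s)) *s u"
    have v: "complex_of_real (2 * s) *s ?v = u"
      using that by (simp add: vec_eq_iff)
    have n: "norm ?v \<le> 1 / 2"
      using that unfolding norm_vector_scalar_mult_complex norm_of_real by (simp add: field_simps)
    have "slice_coeff f k u = of_real (2 * s) ^ k * slice_coeff f k ?v"
      using slice_coeff_scale[OF sh, of k "of_real (2 * s)" ?v] unfolding v .
    moreover have "norm (complex_of_real (2 * s)) = 2 * s" using that by simp
    ultimately have "norm (slice_coeff f k u) = (2 * s) ^ k * norm (slice_coeff f k ?v)"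
      by (simp only: norm_mult norm_power)
    also have "\<dots> \<le> (2 * s) ^ k * B"
      using that n by (intro mult_left_mono norm_slice_coeff_le[OF sh] B) auto
    finally show ?thesis .
  qed
  let ?h = "\<lambda>c. slice_coeff f k (z + c *s w)"
  define s where "s = norm z + norm w + 1"
  have s: "0 < s" by (simp add: s_def add_nonneg_pos)
  have "?h c = (\<Sum>j\<le>k. (deriv ^^ j) ?h 0 / fact j * c ^ j)" for c
  proof (rule Liouville_polynomial[OF slice_coeff_line_entire[OF f]])
    fix c :: complex assume c: "1 \<le> norm c"
    have "norm (z + c *s w) \<le> norm z * 1 + norm c * norm w"
      using norm_triangle_ineq[of z "c *s w"] by (simp add: norm_vector_scalar_mult_complex)
    also have "\<dots> \<le> norm z * norm c + norm c * norm w"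
      using c by (intro add_right_mono mult_left_mono) auto
    also have "\<dots> \<le> s * norm c" by (simp add: s_def algebra_simps)
    finally have "norm (?h c) \<le> (2 * (s * norm c)) ^ k * B"
      using s c by (intro growth mult_pos_pos) auto
    then show "norm (?h c) \<le> ((2 * s) ^ k * B) * norm c ^ k"
      by (simp add: power_mult_distrib mult_ac)
  qed
  then have h: "?h c = (\<Sum>j\<le>k. (deriv ^^ j) ?h 0 / fact j * c ^ j)" for c .
  define b where "b j = (deriv ^^ j) ?h 0 / fact j" for j
  define q where "q = (\<Sum>j\<le>k. monom (b j) j)"
  have "?h c = poly q c" for c
    unfolding h[of c] q_def b_def[symmetric] by (simp add: poly_sum poly_monom)
  moreover have "degree q \<le> k"
    unfolding q_def by (intro degree_sum_le) (auto intro: order_trans[OF degree_monom_le])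
  ultimately show ?thesis by (intro exI[of _ q] conjI allI)
qed

lemma finite_multi_indices: "finite {\<alpha> :: 'N::finite \<Rightarrow> nat. (\<Sum>i\<in>UNIV. \<alpha> i) = k}"
proof (rule finite_subset)
  show "finite {\<alpha> :: 'N \<Rightarrow> nat. \<forall>i. (i \<in> UNIV \<longrightarrow> \<alpha> i \<in> {..k}) \<and> (i \<notin> UNIV \<longrightarrow> \<alpha> i = 0)}"
    by (rule finite_set_of_finite_funs) simp_all
  show "{\<alpha> :: 'N \<Rightarrow> nat. (\<Sum>i\<in>UNIV. \<alpha> i) = k} \<subseteq> {\<alpha>. \<forall>i. (i \<in> UNIV \<longrightarrow> \<alpha> i \<in> {..k}) \<and> (i \<notin> UNIV \<longrightarrow> \<alpha> i = 0)}"
    by (auto intro: member_le_sum)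
qed

lemma homogeneous_poly_zero: "homogeneous_poly k (\<lambda>z :: complex ^ 'N. 0)"
  unfolding homogeneous_poly_def by (rule exI[of _ "\<lambda>_. 0"]) simp

lemma homogeneous_poly_const: "homogeneous_poly 0 (\<lambda>z :: complex ^ 'N. a)"
proof -
  have "{\<alpha> :: 'N \<Rightarrow> nat. (\<Sum>i\<in>UNIV. \<alpha> i) = 0} = {\<lambda>_. 0}" by (auto simp: fun_eq_iff)
  then show ?thesis unfolding homogeneous_poly_def by (intro exI[of _ "\<lambda>_. a"]) simp
qed

lemma homogeneous_poly_add:
  fixes P Q :: "complex ^ 'N \<Rightarrow> complex"
  assumes "homogeneous_poly k P" "homogeneous_poly k Q"
  shows "homogeneous_poly k (\<lambda>z. P z + Q z)"
proof -
  obtain c d where P: "P = (\<lambda>z. \<Sum>\<alpha> | (\<Sum>i\<in>UNIV. \<alpha> i) = k. c \<alpha> * (\<Prod>i\<in>UNIV. (z $ i) ^ \<alpha> i))"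
    and Q: "Q = (\<lambda>z. \<Sum>\<alpha> | (\<Sum>i\<in>UNIV. \<alpha> i) = k. d \<alpha> * (\<Prod>i\<in>UNIV. (z $ i) ^ \<alpha> i))"
    using assms unfolding homogeneous_poly_def by blast
  show ?thesis unfolding homogeneous_poly_def P Q
    by (rule exI[of _ "\<lambda>\<alpha>. c \<alpha> + d \<alpha>"]) (simp add: sum.distrib distrib_right)
qed

lemma homogeneous_poly_cmult:
  fixes P :: "complex ^ 'N \<Rightarrow> complex"
  assumes "homogeneous_poly k P"
  shows "homogeneous_poly k (\<lambda>z. a * P z)"
proof -
  obtain c where P: "P = (\<lambda>z. \<Sum>\<alpha> | (\<Sum>i\<in>UNIV. \<alpha> i) = k. c \<alpha> * (\<Prod>i\<in>UNIV. (z $ i) ^ \<alpha> i))"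
    using assms unfolding homogeneous_poly_def by blast
  show ?thesis unfolding homogeneous_poly_def P
    by (rule exI[of _ "\<lambda>\<alpha>. a * c \<alpha>"]) (simp add: sum_distrib_left mult.assoc)
qed

text \<open>
  Multiplication by a coordinate shifts the multi-indices in that direction; the multi-indices that
  are not reached receive the coefficient \<open>0\<close>.
\<close>

lemma homogeneous_poly_coordinate_mult:
  fixes P :: "complex ^ 'N \<Rightarrow> complex"
  assumes "homogeneous_poly k P"
  shows "homogeneous_poly (Suc k) (\<lambda>z. z $ l * P z)"
proof -
  obtain c where P: "P = (\<lambda>z. \<Sum>\<alpha> | (\<Sum>i\<in>UNIV. \<alpha> i) = k. c \<alpha> * (\<Prod>i\<in>UNIV. (z $ i) ^ \<alpha> i))"
    using assms unfolding homogeneous_poly_def by blast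
  let ?up = "\<lambda>\<alpha> :: 'N \<Rightarrow> nat. \<alpha>(l := Suc (\<alpha> l))"
  let ?down = "\<lambda>\<beta> :: 'N \<Rightarrow> nat. \<beta>(l := \<beta> l - 1)"
  let ?A = "\<lambda>k. {\<alpha> :: 'N \<Rightarrow> nat. (\<Sum>i\<in>UNIV. \<alpha> i) = k}"
  define d where "d \<beta> = (if \<beta> l = 0 then 0 else c (?down \<beta>))" for \<beta>
  have sum_split: "(\<Sum>i\<in>UNIV. \<alpha> i) = \<alpha> l + (\<Sum>i\<in>UNIV - {l}. \<alpha> i)" for \<alpha> :: "'N \<Rightarrow> nat"
    by (simp add: sum.remove)
  have prod_split: "(\<Prod>i\<in>UNIV. (z $ i) ^ \<alpha> i) = (z $ l) ^ \<alpha> l * (\<Prod>i\<in>UNIV - {l}. (z $ i) ^ \<alpha> i)"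
    for \<alpha> :: "'N \<Rightarrow> nat" and z :: "complex ^ 'N"
    by (simp add: prod.remove)
  have "z $ l * P z = (\<Sum>\<beta>\<in>?A (Suc k). d \<beta> * (\<Prod>i\<in>UNIV. (z $ i) ^ \<beta> i))" for z
  proof -
    have "z $ l * P z = (\<Sum>\<alpha>\<in>?A k. d (?up \<alpha>) * (\<Prod>i\<in>UNIV. (z $ i) ^ ?up \<alpha> i))"
      unfolding P sum_distrib_left
    proof (rule sum.cong[OF refl])
      fix \<alpha> :: "'N \<Rightarrow> nat"
      have "(\<Prod>i\<in>UNIV. (z $ i) ^ ?up \<alpha> i) = (z $ l) ^ Suc (\<alpha> l) * (\<Prod>i\<in>UNIV - {l}. (z $ i) ^ \<alpha> i)"
        by (subst prod_split) simp
      then show "z $ l * (c \<alpha> * (\<Prod>i\<in>UNIV. (z $ i) ^ \<alpha> i)) = d (?up \<alpha>) * (\<Prod>i\<in>UNIV. (z $ i) ^ ?up \<alpha> i)"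
        by (simp add: prod_split[of z \<alpha>] d_def mult_ac)
    qed
    also have "\<dots> = (\<Sum>\<beta>\<in>{\<beta> \<in> ?A (Suc k). \<beta> l \<noteq> 0}. d \<beta> * (\<Prod>i\<in>UNIV. (z $ i) ^ \<beta> i))"
      by (rule sum.reindex_bij_witness[where i = ?down and j = ?up])
        (auto simp: sum_split simp flip: fun_upd_def)
    also have "\<dots> = (\<Sum>\<beta>\<in>?A (Suc k). d \<beta> * (\<Prod>i\<in>UNIV. (z $ i) ^ \<beta> i))"
      by (rule sum.mono_neutral_left) (auto simp: d_def finite_multi_indices)
    finally show ?thesis .
  qed
  then show ?thesis unfolding homogeneous_poly_def by blast
qed

lemma homogeneous_poly_scale:
  fixes P :: "complex ^ 'N \<Rightarrow> complex"
  assumes "homogeneous_poly k P"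
  shows "P (c *s z) = c ^ k * P z"
proof -
  obtain d where P: "P = (\<lambda>z. \<Sum>\<alpha> | (\<Sum>i\<in>UNIV. \<alpha> i) = k. d \<alpha> * (\<Prod>i\<in>UNIV. (z $ i) ^ \<alpha> i))"
    using assms unfolding homogeneous_poly_def by blast
  show ?thesis unfolding P sum_distrib_left
    by (rule sum.cong) (auto simp: power_mult_distrib prod.distrib power_sum)
qed

text \<open>
  Polynomial functions, as sums of homogeneous ones. That the terms vanish beyond \<open>D\<close> lets two such
  sums be taken over the same range.
\<close>

definition graded_poly_fun :: "(complex ^ 'N \<Rightarrow> complex) \<Rightarrow> bool" where
  "graded_poly_fun F \<longleftrightarrow> (\<exists>D P. (\<forall>d. homogeneous_poly d (P d)) \<and> (\<forall>d>D. \<forall>z. P d z = 0) \<and>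
     (\<forall>z. F z = (\<Sum>d\<le>D. P d z)))"

lemma graded_poly_fun_const: "graded_poly_fun (\<lambda>z :: complex ^ 'N. a)"
  unfolding graded_poly_fun_def
  by (rule exI[of _ 0], rule exI[of _ "\<lambda>d z. if d = 0 then a else 0"])
    (auto simp: homogeneous_poly_zero homogeneous_poly_const)

lemma graded_poly_fun_add:
  fixes F G :: "complex ^ 'N \<Rightarrow> complex"
  assumes "graded_poly_fun F" "graded_poly_fun G"
  shows "graded_poly_fun (\<lambda>z. F z + G z)"
proof -
  obtain D P where P: "\<And>d. homogeneous_poly d (P d)" "\<And>d z. d > D \<Longrightarrow> P d z = 0" "\<And>z. F z = (\<Sum>d\<le>D. P d z)"
    using assms(1) unfolding graded_poly_fun_def by blast
  obtain E Q where Q: "\<And>d. homogeneous_poly d (Q d)" "\<And>d z. d > E \<Longrightarrow> Q d z = 0" "\<And>z. G z = (\<Sum>d\<le>E. Q d z)"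
    using assms(2) unfolding graded_poly_fun_def by blast
  have "F z = (\<Sum>d\<le>max D E. P d z)" "G z = (\<Sum>d\<le>max D E. Q d z)" for z
    unfolding P(3) Q(3) by (rule sum.mono_neutral_left; use P(2) Q(2) in auto)+
  then show ?thesis unfolding graded_poly_fun_def
    by (intro exI[of _ "max D E"] exI[of _ "\<lambda>d z. P d z + Q d z"])
      (simp add: homogeneous_poly_add P(1,2) Q(1,2) sum.distrib)
qed

lemma graded_poly_fun_cmult:
  fixes F :: "complex ^ 'N \<Rightarrow> complex"
  assumes "graded_poly_fun F"
  shows "graded_poly_fun (\<lambda>z. a * F z)"
proof -
  obtain D P where P: "\<And>d. homogeneous_poly d (P d)" "\<And>d z. d > D \<Longrightarrow> P d z = 0" "\<And>z. F z = (\<Sum>d\<le>D. P d z)"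
    using assms(1) unfolding graded_poly_fun_def by blast
  then show ?thesis unfolding graded_poly_fun_def
    by (intro exI[of _ D] exI[of _ "\<lambda>d z. a * P d z"])
      (simp add: homogeneous_poly_cmult sum_distrib_left)
qed

lemma graded_poly_fun_coordinate_mult:
  fixes F :: "complex ^ 'N \<Rightarrow> complex"
  assumes "graded_poly_fun F"
  shows "graded_poly_fun (\<lambda>z. z $ l * F z)"
proof -
  obtain D P where P: "\<And>d. homogeneous_poly d (P d)" "\<And>d z. d > D \<Longrightarrow> P d z = 0" "\<And>z. F z = (\<Sum>d\<le>D. P d z)"
    using assms(1) unfolding graded_poly_fun_def by blast
  let ?Q = "\<lambda>d z. case d of 0 \<Rightarrow> 0 | Suc d \<Rightarrow> z $ l * P d z"
  have "homogeneous_poly d (?Q d)" for d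
    by (cases d) (simp_all add: homogeneous_poly_zero homogeneous_poly_coordinate_mult P(1))
  moreover have "?Q d z = 0" if "d > Suc D" for d z
    using that by (cases d) (simp_all add: P(2))
  moreover have "z $ l * F z = (\<Sum>d\<le>Suc D. ?Q d z)" for z
    unfolding P(3) by (subst sum.atMost_Suc_shift) (simp add: sum_distrib_left)
  ultimately show ?thesis unfolding graded_poly_fun_def
    by (intro exI[of _ "Suc D"] exI[of _ ?Q] conjI allI impI)
qed

lemma graded_poly_fun_poly_mult:
  fixes F :: "complex ^ 'N \<Rightarrow> complex"
  assumes F: "graded_poly_fun F"
  shows "graded_poly_fun (\<lambda>z. poly q (z $ l) * F z)"
proof (induction q)
  case 0
  then show ?case by (simp add: graded_poly_fun_const)
next
  case (pCons a q)
  have "graded_poly_fun (\<lambda>z. a * F z + z $ l * (poly q (z $ l) * F z))"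
    by (intro graded_poly_fun_add graded_poly_fun_cmult graded_poly_fun_coordinate_mult F pCons.IH)
  then show ?case by (simp add: algebra_simps)
qed

lemma graded_poly_fun_sum:
  fixes F :: "'i \<Rightarrow> complex ^ 'N \<Rightarrow> complex"
  assumes "finite I" "\<And>j. j \<in> I \<Longrightarrow> graded_poly_fun (F j)"
  shows "graded_poly_fun (\<lambda>z. \<Sum>j\<in>I. F j z)"
  using assms by (induction I rule: finite_induct) (simp_all add: graded_poly_fun_const graded_poly_fun_add)

text \<open>
  For fixed \<open>z\<close>, both sides of \<open>F (c *s z) = c ^ k * F z\<close> are polynomials in \<open>c\<close>. Comparing the
  coefficients of \<open>c ^ k\<close> shows that \<open>F\<close> is its own part of degree \<open>k\<close>.
\<close>

lemma homogeneous_poly_if_graded: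
  fixes F :: "complex ^ 'N \<Rightarrow> complex"
  assumes F: "graded_poly_fun F" and hom: "\<And>c z. F (c *s z) = c ^ k * F z"
  shows "homogeneous_poly k F"
proof -
  obtain D P where P: "\<And>d. homogeneous_poly d (P d)" "\<And>d z. d > D \<Longrightarrow> P d z = 0" "\<And>z. F z = (\<Sum>d\<le>D. P d z)"
    using F unfolding graded_poly_fun_def by blast
  have "F z = P k z" for z
  proof -
    let ?p = "\<Sum>d\<le>D. monom (P d z) d" and ?q = "monom (F z) k"
    have "poly ?p c = poly ?q c" for c
      using hom[of c z] unfolding P(3)[of "c *s z"]
      by (simp add: poly_sum poly_monom homogeneous_poly_scale[OF P(1)] mult.commute)
    then have "?p = ?q" by (simp add: poly_eq_poly_eq_iff[symmetric] fun_eq_iff)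
    then have "coeff ?p k = coeff ?q k" by simp
    then show ?thesis using P(2)[of k z] by (auto simp: coeff_sum coeff_monom not_le split: if_splits)
  qed
  then have "F = P k" by auto
  then show ?thesis using P(1) by simp
qed

text \<open>
  Interpolation at the nodes \<open>0, \<dots>, k\<close>.
\<close>

lemma lagrange_interpolation:
  "\<exists>L :: nat \<Rightarrow> complex poly. \<forall>q. degree q \<le> k \<longrightarrow> (\<forall>c. poly q c = (\<Sum>j\<le>k. poly (L j) c * poly q (of_nat j)))"
proof -
  define L where "L j = (\<Prod>m\<in>{..k} - {j}. smult (1 / (of_nat j - of_nat m)) [:- of_nat m, 1 :: complex:])" for j :: nat
  have L: "poly (L j) (of_nat l) = (if l = j then 1 else 0 :: complex)" if "l \<le> k" "j \<le> k" for l j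
    using that by (auto simp: L_def poly_prod diff_divide_distrib[symmetric] intro!: prod.neutral)
  have deg: "degree (L j) \<le> k" if "j \<le> k" for j
  proof -
    have "degree (L j) \<le> (\<Sum>m\<in>{..k} - {j}. degree (smult (1 / (of_nat j - of_nat m)) [:- of_nat m, 1 :: complex:]))"
      unfolding L_def by (rule order_trans[OF degree_prod_sum_le]) (simp_all add: o_def)
    also have "\<dots> \<le> (\<Sum>m\<in>{..k} - {j}. 1)" by (intro sum_mono) simp
    also have "\<dots> = k" using that by simp
    finally show ?thesis .
  qed
  have E: "q = (\<Sum>j\<le>k. smult (poly q (of_nat j)) (L j))" if q: "degree q \<le> k" for q
  proof (rule poly_eqI_degree)
    show "poly q x = poly (\<Sum>j\<le>k. smult (poly q (of_nat j)) (L j)) x" if "x \<in> of_nat ` {..k}" for x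
      using that by (auto simp: poly_sum L if_distrib[where f = "(*) _"] cong: if_cong)
    have card: "card (of_nat ` {..k} :: complex set) = Suc k"
      by (subst card_image) (auto simp: inj_on_def)
    show "degree q < card (of_nat ` {..k} :: complex set)" unfolding card using q by simp
    have "degree (\<Sum>j\<le>k. smult (poly q (of_nat j)) (L j)) \<le> k"
      by (intro degree_sum_le) (auto intro: deg)
    then show "degree (\<Sum>j\<le>k. smult (poly q (of_nat j)) (L j)) < card (of_nat ` {..k} :: complex set)"
      unfolding card by simp
  qed
  have "poly q c = (\<Sum>j\<le>k. poly (L j) c * poly q (of_nat j))" if q: "degree q \<le> k" for q c
  proof -
    have "poly q c = poly (\<Sum>j\<le>k. smult (poly q (of_nat j)) (L j)) c"
      by (rule arg_cong[OF E[OF q], of "\<lambda>r. poly r c"])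
    also have "\<dots> = (\<Sum>j\<le>k. poly (L j) c * poly q (of_nat j))"
      by (simp add: poly_sum mult.commute)
    finally show ?thesis .
  qed
  then show ?thesis by (intro exI[of _ L] allI impI)
qed

text \<open>
  Lagrange interpolation in one coordinate writes \<open>F\<close> as a combination, with polynomial coefficients
  in that coordinate, of translates of \<open>F\<close> in which the coordinate has been set to \<open>0\<close>. Treating
  the coordinates one after the other leaves only constants. The bound \<open>k\<close> on the degrees, uniform in
  \<open>z\<close>, is what makes one set of nodes sufficient.
\<close>

lemma graded_poly_fun_if_separately_poly:
  fixes F :: "complex ^ 'N \<Rightarrow> complex"
  assumes "\<And>z i. \<exists>q. degree q \<le> k \<and> (\<forall>c. F (z + c *s axis i 1) = poly q c)"
  shows "graded_poly_fun F"
proof -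
  obtain L :: "nat \<Rightarrow> complex poly"
    where L: "\<And>q c. degree q \<le> k \<Longrightarrow> poly q c = (\<Sum>j\<le>k. poly (L j) c * poly q (of_nat j))"
    using lagrange_interpolation by blast
  have "graded_poly_fun (\<lambda>z. F (\<chi> i. if i \<in> S then z $ i else 0))" if "finite S" for S
    using that assms
  proof (induction S arbitrary: F rule: finite_induct)
    case empty
    then show ?case by (simp add: graded_poly_fun_const)
  next
    case (insert l S)
    have "F (\<chi> i. if i \<in> insert l S then z $ i else 0)
        = (\<Sum>j\<le>k. poly (L j) (z $ l) * F ((\<chi> i. if i \<in> S then z $ i else 0) + of_nat j *s axis l 1))" for z
    proof -
      let ?z = "\<chi> i. if i \<in> S then z $ i else 0"
      obtain q where q: "degree q \<le> k" "\<And>c. F (?z + c *s axis l 1) = poly q c"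
        using insert.prems by blast
      have "(\<chi> i. if i \<in> insert l S then z $ i else 0) = ?z + (z $ l) *s axis l 1"
        using insert.hyps by (auto simp: vec_eq_iff axis_def)
      then show ?thesis using L[OF q(1), of "z $ l"] by (simp only: q(2))
    qed
    moreover have "graded_poly_fun (\<lambda>z. \<Sum>j\<le>k. poly (L j) (z $ l) * F ((\<chi> i. if i \<in> S then z $ i else 0) + of_nat j *s axis l 1))"
    proof (intro graded_poly_fun_sum graded_poly_fun_poly_mult)
      fix j
      show "graded_poly_fun (\<lambda>z. F ((\<chi> i. if i \<in> S then z $ i else 0) + of_nat j *s axis l 1))"
      proof (rule insert.IH[of "\<lambda>z. F (z + of_nat j *s axis l 1)"])
        fix z i
        obtain q where "degree q \<le> k" "\<And>c. F ((z + of_nat j *s axis l 1) + c *s axis i 1) = poly q c"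
          using insert.prems by blast
        then show "\<exists>q. degree q \<le> k \<and> (\<forall>c. F (z + c *s axis i 1 + of_nat j *s axis l 1) = poly q c)"
          by (intro exI[of _ q]) (simp add: add_ac)
      qed
    qed simp
    ultimately show ?case by simp
  qed
  from this[of UNIV] show ?thesis by simp
qed

lemma homogeneous_poly_slice_coeff:
  fixes f :: "complex ^ 'N \<Rightarrow> complex"
  assumes f: "f \<in> hol_ball"
  shows "homogeneous_poly k (slice_coeff f k)"
proof (rule homogeneous_poly_if_graded)
  show "graded_poly_fun (slice_coeff f k)"
    by (rule graded_poly_fun_if_separately_poly) (rule slice_coeff_line_poly[OF f])
qed (rule slice_coeff_scale[OF slice_holomorphic_if_hol_ball[OF f]])

text \<open>
  Existence is the polynomiality of the slice coefficients; uniqueness holds because the terms of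
  any expansion are determined on each slice by the power series of \<open>f\<close> there.
\<close>

lemma homogeneous_expansion_eq_slice_coeff:
  fixes f :: "complex ^ 'N \<Rightarrow> complex"
  assumes f: "f \<in> hol_ball"
  shows "homogeneous_expansion f = slice_coeff f"
  unfolding homogeneous_expansion_def
proof (rule the_equality, intro conjI allI ballI)
  have sh: "slice_holomorphic f" by (rule slice_holomorphic_if_hol_ball[OF f])
  show "homogeneous_poly k (slice_coeff f k)" for k by (rule homogeneous_poly_slice_coeff[OF f])
  show "(\<lambda>k. slice_coeff f k z) sums f z" if "z \<in> ball 0 1" for z
    using slice_coeff_sums[OF sh, of 1 z] that by simp
  fix F assume F: "(\<forall>k. homogeneous_poly k (F k)) \<and> (\<forall>z\<in>ball 0 1. (\<lambda>k. F k z) sums f z)"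
  have "F k z = slice_coeff f k z" for k z
  proof (rule slice_coeff_unique)
    fix c assume "c *s z \<in> ball 0 1"
    with F have "(\<lambda>k. F k (c *s z)) sums f (c *s z)" by blast
    moreover have "F k (c *s z) = F k z * c ^ k" for k
      using F homogeneous_poly_scale[of k "F k" c z] by simp
    ultimately show "(\<lambda>k. F k z * c ^ k) sums f (c *s z)" by simp
  qed
  then show "F = slice_coeff f" by (intro ext)
qed

lemma radial_deriv_eq_funpow_euler_deriv:
  fixes f :: "complex ^ 'N \<Rightarrow> complex"
  assumes f: "f \<in> hol_ball" and n: "1 \<le> n" and z: "z \<in> ball 0 1"
  shows "radial_deriv n f z = (euler_deriv ^^ n) f z"
proof -
  have "(\<lambda>k. of_nat k ^ n * slice_coeff f k z) sums (euler_deriv ^^ n) f z"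
    by (rule funpow_euler_deriv_sums[OF slice_holomorphic_if_hol_ball[OF f] z])
  from sums_split_initial_segment[OF this, of 1]
  have "(\<lambda>k. of_nat (Suc k) ^ n * slice_coeff f (Suc k) z) sums (euler_deriv ^^ n) f z"
    using n by (simp add: zero_power)
  then show ?thesis
    by (simp add: radial_deriv_def homogeneous_expansion_eq_slice_coeff[OF f] sums_iff)
qed

section \<open>The inclusion\<close>

lemma hardy_norm_le_log_mean:
  assumes "\<And>a. 0 < a \<Longrightarrow> log_mean p g a \<le> C"
  shows "hardy_norm p g \<le> C"
  unfolding hardy_norm_def
proof (rule SUP_least)
  fix r :: real assume "r \<in> {0<..<1}"
  then have "int_mean p r g = log_mean p g (- ln r)" by (simp add: log_mean_def)
  then show "int_mean p r g \<le> C" using assms[of "- ln r"] \<open>r \<in> {0<..<1}\<close> by simp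
qed

lemma nn_integral_log_mean_shift_le:
  fixes g :: "complex ^ 'N \<Rightarrow> complex"
  assumes p: "1 \<le> p" and g: "slice_holomorphic g" and a: "0 < a"
  shows "(\<integral>\<^sup>+s\<in>{0..t}. ennreal (s ^ k) * log_mean p g (a + s) \<partial>lborel)
    \<le> (\<integral>\<^sup>+s\<in>{0..t}. ennreal (s ^ k) * log_mean p g s \<partial>lborel)"
proof (rule nn_integral_mono_AE)
  have "AE s in lborel. s \<noteq> (0 :: real)" by (rule AE_lborel_singleton)
  then show "AE s in lborel. ennreal (s ^ k) * log_mean p g (a + s) * indicator {0..t} s
      \<le> ennreal (s ^ k) * log_mean p g s * indicator {0..t} s"
  proof eventually_elim
    case (elim s)
    then show ?case
      using a by (cases "s \<in> {0..t}") (auto intro!: mult_left_mono log_mean_antimono p g)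
  qed
qed

lemma neg_ln_one_minus_le:
  assumes "0 \<le> x" "x \<le> 1 / 2" shows "- ln (1 - x) \<le> 2 * (x :: real)"
proof -
  have "x\<^sup>2 \<le> x * (1 / 2)" unfolding power2_eq_square using assms by (intro mult_left_mono) auto
  then show ?thesis using ln_one_minus_pos_lower_bound[OF assms] by linarith
qed

text \<open>
  Substitute \<open>s = 2 u\<close> and use that \<open>exp (- 2 u) \<le> 1 - u\<close> for \<open>u \<le> 1 / 2\<close>: the means over spheres of
  radius \<open>exp (- s)\<close> are bounded by means over spheres of radius \<open>1 - u\<close>, since the depth
  \<open>- ln (1 - u)\<close> corresponds to the radius \<open>1 - u\<close>.
\<close>

lemma nn_integral_log_mean_le:
  fixes g :: "complex ^ 'N \<Rightarrow> complex"
  assumes p: "1 \<le> p" and g: "slice_holomorphic g" and t: "t \<le> 1"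
  shows "(\<integral>\<^sup>+s\<in>{0..t}. ennreal (s ^ k) * log_mean p g s \<partial>lborel)
    \<le> 2 ^ Suc k * (\<integral>\<^sup>+u\<in>{0..t / 2}. ennreal (u ^ k) * log_mean p g (- ln (1 - u)) \<partial>lborel)"
proof -
  note [measurable] = borel_measurable_log_mean[OF p g]
  have "(\<integral>\<^sup>+s\<in>{0..t}. ennreal (s ^ k) * log_mean p g s \<partial>lborel)
      = ennreal \<bar>2\<bar> * (\<integral>\<^sup>+u. ennreal ((0 + 2 * u) ^ k) * log_mean p g (0 + 2 * u) * indicator {0..t} (0 + 2 * u) \<partial>lborel)"
    by (rule nn_integral_real_affine) simp_all
  also have "\<dots> \<le> ennreal \<bar>2\<bar> * (\<integral>\<^sup>+u. 2 ^ k * (ennreal (u ^ k) * log_mean p g (- ln (1 - u)) * indicator {0..t / 2} u) \<partial>lborel)"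
  proof (intro mult_left_mono nn_integral_mono_AE)
    have "AE u in lborel. u \<noteq> (0 :: real)" by (rule AE_lborel_singleton)
    then show "AE u in lborel. ennreal ((0 + 2 * u) ^ k) * log_mean p g (0 + 2 * u) * indicator {0..t} (0 + 2 * u)
        \<le> 2 ^ k * (ennreal (u ^ k) * log_mean p g (- ln (1 - u)) * indicator {0..t / 2} u)"
    proof eventually_elim
      case (elim u)
      show ?case
      proof (cases "u \<in> {0..t / 2}")
        case True
        then have u: "0 < u" "u \<le> 1 / 2" using elim t by auto
        have "log_mean p g (2 * u) \<le> log_mean p g (- ln (1 - u))"
          using u neg_ln_one_minus_le[of u] by (intro log_mean_antimono p g) auto
        moreover have "ennreal ((2 * u) ^ k) = 2 ^ k * ennreal (u ^ k)"
          using u by (simp add: power_mult_distrib ennreal_mult ennreal_power[symmetric])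
        ultimately show ?thesis using True by (simp add: mult.assoc mult_left_mono)
      qed (auto simp: indicator_def)
    qed
  qed simp
  also have "\<dots> = 2 * (2 ^ k * (\<integral>\<^sup>+u\<in>{0..t / 2}. ennreal (u ^ k) * log_mean p g (- ln (1 - u)) \<partial>lborel))"
    by (subst nn_integral_cmult) simp_all
  finally show ?thesis by (simp add: mult.assoc)
qed

text \<open>
  This is \<open>\<phi> u \<le> \<phi> t (u / t)\<^sup>\<alpha>\<close>, multiplied by \<open>u ^ k / \<phi> u\<close>.
\<close>

lemma power_le_hardy_weight:
  fixes \<phi> :: "real \<Rightarrow> real"
  assumes pos: "\<And>x. x \<in> {0<..1} \<Longrightarrow> 0 < \<phi> x"
    and mono: "mono_on {0<..1} (\<lambda>x. \<phi> x / x powr \<alpha>)" and u: "0 < u" "u \<le> t" "t \<le> 1"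
  shows "u ^ k \<le> \<phi> t * ((u / t) powr \<alpha> / u * (u ^ Suc k / \<phi> u))"
proof -
  have "\<phi> u / u powr \<alpha> \<le> \<phi> t / t powr \<alpha>"
    using mono u by (auto simp: mono_on_def)
  moreover have "0 < \<phi> u" "0 < u powr \<alpha>" "0 < t powr \<alpha>" using pos u by auto
  ultimately have "1 \<le> \<phi> t * (u / t) powr \<alpha> / \<phi> u"
    using u by (simp add: powr_divide field_simps)
  then have "u ^ k * 1 \<le> u ^ k * (\<phi> t * (u / t) powr \<alpha> / \<phi> u)"
    using u by (intro mult_left_mono) auto
  also have "\<dots> = \<phi> t * ((u / t) powr \<alpha> / u * (u ^ Suc k / \<phi> u))"
    using u by simp
  finally show ?thesis by simp
qed

lemma nn_integral_power_le_hardy_average: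
  fixes \<phi> :: "real \<Rightarrow> real" and N :: "real \<Rightarrow> ennreal"
  assumes pos: "\<And>x. x \<in> {0<..1} \<Longrightarrow> 0 < \<phi> x"
    and mono: "mono_on {0<..1} (\<lambda>x. \<phi> x / x powr \<alpha>)" and t: "0 < t" "t < 1"
    and b: "b \<in> borel_measurable borel" "\<And>u. u \<in> {0<..<1} \<Longrightarrow> b u = N u * ennreal (u ^ Suc k / \<phi> u)"
  shows "(\<integral>\<^sup>+u\<in>{0..t}. ennreal (u ^ k) * N u \<partial>lborel)
    \<le> ennreal (\<phi> t) * (\<integral>\<^sup>+u\<in>{0..t}. ennreal ((u / t) powr \<alpha> / u) * b u \<partial>lborel)"
proof -
  note [measurable] = b(1)
  have "(\<integral>\<^sup>+u\<in>{0..t}. ennreal (u ^ k) * N u \<partial>lborel)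
      \<le> (\<integral>\<^sup>+u. ennreal (\<phi> t) * (ennreal ((u / t) powr \<alpha> / u) * b u * indicator {0..t} u) \<partial>lborel)"
  proof (rule nn_integral_mono_AE)
    have "AE u in lborel. u \<noteq> (0 :: real)" by (rule AE_lborel_singleton)
    then show "AE u in lborel. ennreal (u ^ k) * N u * indicator {0..t} u
      \<le> ennreal (\<phi> t) * (ennreal ((u / t) powr \<alpha> / u) * b u * indicator {0..t} u)"
    proof eventually_elim
      case (elim u)
      show ?case
      proof (cases "u \<in> {0..t}")
        case True
        then have u: "0 < u" "u \<le> t" "t \<le> 1" "u < 1" using elim t by auto
        have \<phi>0: "0 < \<phi> u" "0 < \<phi> t" using pos u t by auto
        have "ennreal (u ^ k) * N u \<le> ennreal (\<phi> t * ((u / t) powr \<alpha> / u * (u ^ Suc k / \<phi> u))) * N u"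
          by (intro mult_right_mono ennreal_leI power_le_hardy_weight[OF pos mono u(1-3)]) simp_all
        also have "\<dots> = ennreal (\<phi> t) * (ennreal ((u / t) powr \<alpha> / u) * b u)"
        proof -
          have nonneg: "0 \<le> \<phi> t" "0 \<le> (u / t) powr \<alpha> / u" "0 \<le> u ^ Suc k / \<phi> u"
            using u \<phi>0 by (simp_all add: less_imp_le)
          have bu: "b u = N u * ennreal (u ^ Suc k / \<phi> u)" using u by (intro b(2)) simp
          show ?thesis
            unfolding bu ennreal_mult[OF nonneg(1) mult_nonneg_nonneg[OF nonneg(2,3)]]
              ennreal_mult[OF nonneg(2,3)]
            by (simp only: mult_ac)
        qed
        finally show ?thesis using True by simp
      qed (auto simp: indicator_def)
    qed
  qed
  also have "\<dots> = ennreal (\<phi> t) * (\<integral>\<^sup>+u\<in>{0..t}. ennreal ((u / t) powr \<alpha> / u) * b u \<partial>lborel)"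
    by (rule nn_integral_cmult) measurable
  finally show ?thesis .
qed

text \<open>
  By Jensen's inequality once more, the \<open>q\<close>-th power of a single average is at most a
  multiple of the integral.
\<close>

lemma hardy_average_finite:
  fixes b :: "real \<Rightarrow> ennreal"
  assumes b [measurable]: "b \<in> borel_measurable borel" and q: "1 \<le> q" and \<alpha>: "0 < \<alpha>" and t: "0 < t" "t < 1"
    and fin: "(\<integral>\<^sup>+s\<in>{0<..<1}. ennpow (b s) q * ennreal (1 / s) \<partial>lborel) < \<infinity>"
  shows "(\<integral>\<^sup>+s\<in>{0..t}. ennreal ((s / t) powr \<alpha> / s) * b s \<partial>lborel) < \<infinity>"
proof -
  let ?C = "ennreal ((1 / \<alpha>) powr q) * ennreal \<alpha>"
  have "ennpow (\<integral>\<^sup>+s\<in>{0..t}. ennreal ((s / t) powr \<alpha> / s) * b s \<partial>lborel) q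
      \<le> (\<integral>\<^sup>+s\<in>{0..t}. ennpow (b s * ennreal (1 / \<alpha>)) q * ennreal (\<alpha> * (s / t) powr \<alpha> / s) \<partial>lborel)"
    by (rule ennpow_hardy_average_le[OF b q \<alpha> t(1)])
  also have "\<dots> \<le> (\<integral>\<^sup>+s. ?C * (ennpow (b s) q * ennreal (1 / s) * indicator {0<..<1} s) \<partial>lborel)"
  proof (rule nn_integral_mono)
    fix s :: real
    show "ennpow (b s * ennreal (1 / \<alpha>)) q * ennreal (\<alpha> * (s / t) powr \<alpha> / s) * indicator {0..t} s
      \<le> ?C * (ennpow (b s) q * ennreal (1 / s) * indicator {0<..<1} s)"
    proof (cases "s \<in> {0<..t}")
      case True
      have "(s / t) powr \<alpha> \<le> 1 powr \<alpha>" using True t \<alpha> by (intro powr_mono2) auto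
      then have "ennreal (\<alpha> * (s / t) powr \<alpha> / s) \<le> ennreal (\<alpha> * (1 / s))"
        using True \<alpha> by (intro ennreal_leI) (simp add: field_simps)
      also have "\<dots> = ennreal \<alpha> * ennreal (1 / s)" using True \<alpha> by (intro ennreal_mult) auto
      finally have "ennpow (b s * ennreal (1 / \<alpha>)) q * ennreal (\<alpha> * (s / t) powr \<alpha> / s)
        \<le> ennpow (b s * ennreal (1 / \<alpha>)) q * (ennreal \<alpha> * ennreal (1 / s))"
        by (rule mult_left_mono) simp
      also have "\<dots> = ?C * (ennpow (b s) q * ennreal (1 / s))"
        using q \<alpha> by (simp add: ennpow_mult ennpow_ennreal mult_ac)
      finally show ?thesis using True t by simp
    next
      case False
      then show ?thesis by (cases "s = 0") (auto simp: indicator_def)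
    qed
  qed
  also have "\<dots> = ?C * (\<integral>\<^sup>+s\<in>{0<..<1}. ennpow (b s) q * ennreal (1 / s) \<partial>lborel)"
    by (rule nn_integral_cmult) measurable
  also have "\<dots> < \<infinity>" using fin by (simp add: ennreal_mult_less_top)
  finally have f: "ennpow (\<integral>\<^sup>+s\<in>{0..t}. ennreal ((s / t) powr \<alpha> / s) * b s \<partial>lborel) q < \<infinity>" .
  show ?thesis
  proof (rule ccontr)
    assume "\<not> ?thesis"
    then have "(\<integral>\<^sup>+s\<in>{0..t}. ennreal ((s / t) powr \<alpha> / s) * b s \<partial>lborel) = \<top>"
      by (simp add: less_top[symmetric])
    with f show False by simp
  qed
qed

theorem corollary1p10:
  fixes n :: nat and p :: ennreal and q :: real and \<phi> :: "real \<Rightarrow> real"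
  assumes "n \<ge> 1" and "1 \<le> p" and "1 \<le> q"
    and "\<And>x. x \<in> {0<..1} \<Longrightarrow> \<phi> x > 0"
    and "continuous_on {0<..1} \<phi>"
    and "mono_on {0<..1} \<phi>"
    and "\<exists>\<alpha>>0. mono_on {0<..1} (\<lambda>x. \<phi> x / x powr \<alpha>)"
  shows "(Lambda_space p q n \<phi> :: (complex ^ 'N \<Rightarrow> complex) set) \<subseteq> Lip_space p q n \<phi>"
proof
  fix f :: "complex ^ 'N \<Rightarrow> complex"
  assume "f \<in> Lambda_space p q n \<phi>"
  then have f: "f \<in> hol_ball" and \<Lambda>: "(\<integral>\<^sup>+ r\<in>{0<..<1}.
      (ennpow (int_mean p r (radial_deriv n f) * ennreal ((1 - r) ^ n / \<phi> (1 - r))) q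
        * ennreal (1 / (1 - r))) \<partial>lborel) < \<infinity>"
    by (simp_all add: Lambda_space_def)
  note p = \<open>1 \<le> p\<close> and q = \<open>1 \<le> q\<close> and pos = assms(4)
  obtain \<alpha> where \<alpha>: "0 < \<alpha>" and mono: "mono_on {0<..1} (\<lambda>x. \<phi> x / x powr \<alpha>)"
    using assms(7) by blast
  obtain k where n: "n = Suc k" using \<open>n \<ge> 1\<close> by (cases n) auto
  have sh: "slice_holomorphic f" by (rule slice_holomorphic_if_hol_ball[OF f])
  define G where "G = (euler_deriv ^^ n) f"
  have G: "slice_holomorphic G" unfolding G_def by (rule slice_holomorphic_funpow_euler_deriv[OF sh])
  note [measurable] = borel_measurable_log_mean[OF p G]
  define N where "N u = log_mean p G (- ln (1 - u))" for u
  have N: "N u = int_mean p (1 - u) (radial_deriv n f)" if "u \<in> {0<..<1}" for u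
  proof -
    have "int_mean p (1 - u) (radial_deriv n f) = int_mean p (1 - u) G"
      unfolding G_def using that \<open>n \<ge> 1\<close>
      by (intro int_mean_cong_ball radial_deriv_eq_funpow_euler_deriv[OF f]) auto
    then show ?thesis using that by (simp add: N_def log_mean_def)
  qed
  \<comment> \<open>Nothing is known about \<open>\<phi>\<close> outside \<open>(0, 1]\<close>; the truncation makes it measurable on the line.\<close>
  define \<psi> where "\<psi> x = indicator {0<..1} x *\<^sub>R \<phi> x" for x
  have [measurable]: "\<psi> \<in> borel_measurable borel"
    unfolding \<psi>_def using assms(5) by (intro borel_measurable_continuous_on_indicator) simp_all
  define b where "b u = N u * ennreal (u ^ n / \<psi> u) * indicator {0<..<1} u" for u
  have b [measurable]: "b \<in> borel_measurable borel" unfolding b_def N_def by measurable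
  have b_eq: "b u = N u * ennreal (u ^ Suc k / \<phi> u)" if "u \<in> {0<..<1}" for u
    using that by (simp add: b_def \<psi>_def n)
  let ?F = "\<lambda>s. ennpow (b s) q * ennreal (1 / s) * indicator {0<..<1} s"
  have "(\<integral>\<^sup>+s. ?F s \<partial>lborel) = ennreal \<bar>- 1\<bar> * (\<integral>\<^sup>+r. ?F (1 + (- 1) * r) \<partial>lborel)"
    by (rule nn_integral_real_affine) simp_all
  also have "\<dots> = (\<integral>\<^sup>+ r\<in>{0<..<1}.
      (ennpow (int_mean p r (radial_deriv n f) * ennreal ((1 - r) ^ n / \<phi> (1 - r))) q
        * ennreal (1 / (1 - r))) \<partial>lborel)"
  proof -
    have "?F (1 + (- 1) * r) = ennpow (int_mean p r (radial_deriv n f) * ennreal ((1 - r) ^ n / \<phi> (1 - r))) q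
        * ennreal (1 / (1 - r)) * indicator {0<..<1} r" for r
    proof (cases "r \<in> {0<..<1}")
      case True
      then have "1 - r \<in> {0<..<1}" by auto
      then show ?thesis using True by (simp add: b_eq N n)
    qed (auto simp: indicator_def)
    then show ?thesis by simp
  qed
  finally have fin: "(\<integral>\<^sup>+s\<in>{0<..<1}. ennpow (b s) q * ennreal (1 / s) \<partial>lborel) < \<infinity>"
    using \<Lambda> by simp
  let ?A = "\<lambda>t. \<integral>\<^sup>+s\<in>{0..t}. ennreal (s ^ k) * log_mean p G s \<partial>lborel"
  let ?H = "\<lambda>t. \<integral>\<^sup>+s\<in>{0..t}. ennreal ((s / t) powr \<alpha> / s) * b s \<partial>lborel"
  have weight: "(\<integral>\<^sup>+u\<in>{0..t}. ennreal (u ^ k) * N u \<partial>lborel) \<le> ennreal (\<phi> t) * ?H t" if "0 < t" "t < 1" for t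
    using that by (intro nn_integral_power_le_hardy_average pos mono b b_eq)
  have A: "?A t \<le> 2 ^ n * (\<integral>\<^sup>+u\<in>{0..t / 2}. ennreal (u ^ k) * N u \<partial>lborel)" if "t \<le> 1" for t
    unfolding N_def n by (rule nn_integral_log_mean_le[OF p G that])
  \<comment> \<open>The interval is halved by the passage from \<open>exp (- s)\<close> to \<open>1 - s / 2\<close>, so that \<open>t = 1\<close> only
    involves the average at \<open>1 / 2\<close>, away from the centre of the ball.\<close>
  have A1: "?A 1 < \<infinity>"
  proof -
    have "?A 1 \<le> 2 ^ n * (ennreal (\<phi> (1 / 2)) * ?H (1 / 2))"
      by (rule order_trans[OF A mult_left_mono[OF weight]]) simp_all
    also have "\<dots> < \<infinity>"
      using hardy_average_finite[OF b q \<alpha> _ _ fin, of "1 / 2"]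
      by (simp add: ennreal_mult_less_top power_less_top_ennreal)
    finally show ?thesis .
  qed
  have "f \<in> hardy_space p"
  proof -
    obtain K D where KD: "K < \<infinity>" "D < \<infinity>" and le: "\<And>a. 0 < a \<Longrightarrow> log_mean p f a
        \<le> K + D * (\<integral>\<^sup>+s\<in>{0..1}. ennreal (s ^ k) * log_mean p ((euler_deriv ^^ Suc k) f) (a + s) \<partial>lborel)"
      using log_mean_le_iterated[OF p sh, of k] by blast
    have "hardy_norm p f \<le> K + D * ?A 1"
    proof (rule hardy_norm_le_log_mean)
      fix a :: real assume a: "0 < a"
      have "(\<integral>\<^sup>+s\<in>{0..1}. ennreal (s ^ k) * log_mean p G (a + s) \<partial>lborel) \<le> ?A 1"
        by (rule nn_integral_log_mean_shift_le[OF p G a])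
      with le[OF a] show "log_mean p f a \<le> K + D * ?A 1"
        unfolding n[symmetric] G_def[symmetric]
        by (elim order_trans) (intro add_left_mono mult_left_mono, simp_all)
    qed
    also have "\<dots> < \<infinity>" using KD A1 by (simp add: ennreal_mult_less_top)
    finally show ?thesis using f by (simp add: hardy_space_def)
  qed
  moreover have "(\<integral>\<^sup>+ t\<in>{0<..<1}. (ennpow (hardy_norm p (rot_diff_iter n t f) * ennreal (1 / \<phi> t)) q
      * ennreal (1 / t)) \<partial>lborel) < \<infinity>"
  proof -
    let ?C = "3 * 6 ^ k * 2 ^ n :: ennreal"
    have bound: "hardy_norm p (rot_diff_iter n t f) * ennreal (1 / \<phi> t) \<le> ?C * ?H t" if t: "0 < t" "t < 1" for t
    proof -
      have "hardy_norm p (rot_diff_iter n t f) \<le> 3 * 6 ^ k * ?A t"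
      proof (rule hardy_norm_le_log_mean)
        fix a :: real assume a: "0 < a"
        have "log_mean p (rot_diff_iter n t f) a
            \<le> 3 * 6 ^ k * (\<integral>\<^sup>+s\<in>{0..t}. ennreal (s ^ k) * log_mean p G (a + s) \<partial>lborel)"
          unfolding n G_def using t by (intro log_mean_rot_diff_iter_le p a sh) simp
        also have "\<dots> \<le> 3 * 6 ^ k * ?A t"
          by (intro mult_left_mono nn_integral_log_mean_shift_le p G a) simp
        finally show "log_mean p (rot_diff_iter n t f) a \<le> 3 * 6 ^ k * ?A t" .
      qed
      also have "?A t \<le> 2 ^ n * (ennreal (\<phi> t) * ?H t)"
      proof -
        have "(\<integral>\<^sup>+u\<in>{0..t / 2}. ennreal (u ^ k) * N u \<partial>lborel) \<le> (\<integral>\<^sup>+u\<in>{0..t}. ennreal (u ^ k) * N u \<partial>lborel)"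
          using t by (intro nn_integral_mono) (auto simp: indicator_def)
        also have "\<dots> \<le> ennreal (\<phi> t) * ?H t" by (rule weight[OF t])
        finally show ?thesis using t by (intro order_trans[OF A] mult_left_mono) simp_all
      qed
      finally have "hardy_norm p (rot_diff_iter n t f) * ennreal (1 / \<phi> t)
          \<le> 3 * 6 ^ k * (2 ^ n * (ennreal (\<phi> t) * ?H t)) * ennreal (1 / \<phi> t)"
        by (intro mult_right_mono) (simp_all add: mult_left_mono)
      also have "\<dots> = ?C * ?H t * (ennreal (\<phi> t) * ennreal (1 / \<phi> t))"
        by (simp add: mult_ac)
      also have "ennreal (\<phi> t) * ennreal (1 / \<phi> t) = 1"
        using pos[of t] t by (simp add: ennreal_mult[symmetric])
      finally show ?thesis by simp
    qed
    have "(\<integral>\<^sup>+ t\<in>{0<..<1}. (ennpow (hardy_norm p (rot_diff_iter n t f) * ennreal (1 / \<phi> t)) q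
        * ennreal (1 / t)) \<partial>lborel)
      \<le> (\<integral>\<^sup>+t. ennpow ?C q * (ennpow (?H t) q * ennreal (1 / t) * indicator {0<..<1} t) \<partial>lborel)"
    proof (rule nn_integral_mono)
      fix t :: real
      show "ennpow (hardy_norm p (rot_diff_iter n t f) * ennreal (1 / \<phi> t)) q * ennreal (1 / t) * indicator {0<..<1} t
        \<le> ennpow ?C q * (ennpow (?H t) q * ennreal (1 / t) * indicator {0<..<1} t)"
      proof (cases "t \<in> {0<..<1}")
        case True
        then have "ennpow (hardy_norm p (rot_diff_iter n t f) * ennreal (1 / \<phi> t)) q \<le> ennpow (?C * ?H t) q"
          using q by (intro ennpow_mono bound) auto
        also have "\<dots> = ennpow ?C q * ennpow (?H t) q" using q by (intro ennpow_mult) simp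
        finally have "ennpow (hardy_norm p (rot_diff_iter n t f) * ennreal (1 / \<phi> t)) q * ennreal (1 / t)
            \<le> ennpow ?C q * ennpow (?H t) q * ennreal (1 / t)"
          by (rule mult_right_mono) simp
        then show ?thesis using True by (simp add: mult.assoc)
      qed simp
    qed
    also have "\<dots> = ennpow ?C q * (\<integral>\<^sup>+t\<in>{0<..<1}. ennpow (?H t) q * ennreal (1 / t) \<partial>lborel)"
    proof (rule nn_integral_cmult)
      have "(\<lambda>(t, s). ennreal ((s / t) powr \<alpha> / s) * b s * (if 0 \<le> s \<and> s \<le> t then 1 else 0)) \<in> borel_measurable (borel \<Otimes>\<^sub>M lborel)"
        by measurable
      from lborel.borel_measurable_nn_integral[OF this]
      have "?H \<in> borel_measurable borel" by (simp add: indicator_def)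
      then show "(\<lambda>t. ennpow (?H t) q * ennreal (1 / t) * indicator {0<..<1} t) \<in> borel_measurable lborel"
        by simp
    qed
    also have "\<dots> \<le> ennpow ?C q * (ennreal ((1 / \<alpha>) powr q) * (\<integral>\<^sup>+s\<in>{0<..<1}. ennpow (b s) q * ennreal (1 / s) \<partial>lborel))"
      by (intro mult_left_mono hardy_inequality b q \<alpha>) simp
    also have "\<dots> < \<infinity>"
    proof -
      have "?C < \<infinity>" by (simp add: ennreal_mult_less_top power_less_top_ennreal)
      then have "ennpow ?C q < \<infinity>" by (cases ?C) (auto simp: ennpow_ennreal)
      then show ?thesis using fin by (simp add: ennreal_mult_less_top)
    qed
    finally show ?thesis .
  qed
  ultimately show "f \<in> Lip_space p q n \<phi>" by (simp add: Lip_space_def)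
qed

end
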